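(* The $1$-BHS problem can be solved by $6$ agents starting from a rooted initial configuration (all agents co-located at one safe node) in $O(|E|^2)$ rounds, where each agent has $O(\log n)$ bits of memory. Furthermore, each node requires only $O(\log n)$ bits of whiteboard storage.
   Context: A time-varying graph (TVG) is $\mathcal{G}=(V,E,\mathbb{T},\rho)$ with discrete rounds $\mathbb{T}=\mathbb{Z}^+$ and $\rho:E\times\mathbb{T}\to\{0,1\}$ indicating whether an edge is present in a round. Its footprint $G=(V,E)$ is an undirected, unweighted, connected graph with $n=|V|$ anonymous nodes; edges at a node $v$ of degree $\delta_v$ carry locally unique port numbers $0,\dots,\delta_v-1$. Each node has a whiteboard which visiting agents can read, write and erase. One node of $G$ is a black hole, which destroys any agent entering it without a trace; other nodes are safe. In $1$-BHS, in each round an adversary may remove at most one edge of $G$, provided the graph remains connected in every round. Agents have distinct IDs from $[1,n^c]$ ($c>1$ constant unknown to them), know their own ID, and have no knowledge of the number of agents, $n$, the maximum degree, the degree of the black hole, the black hole or missing edges. Execution is synchronous; in each round each agent at a safe node performs Look (reads the whiteboard, sees co-located agents and their parameters, learns whether its previous move attempt succeeded), Compute (chooses a port, may write on the whiteboard), Move (attempts to traverse the port; succeeds iff the edge is present in that round, otherwise stays). An agent knows the degree of its current node and its entry port, but cannot detect a missing incident edge except by trying to traverse it; agents crossing an edge do not see each other. $1$-BHS is solved when at least one agent survives, learns at least one edge (port) leading to the black hole, and terminates; time is the number of rounds until this happens. *)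

theory Defs
  imports Complex_Main "HOL-Library.Log_Nat"
begin

section \<open>Port-labelled footprint graph\<close>

text \<open>Nodes are 0..n-1. deg v is the degree of v; port v p (p < deg v) is the neighbour
reached from v through port p.\<close>

definition edges :: "nat \<Rightarrow> (nat \<Rightarrow> nat) \<Rightarrow> (nat \<Rightarrow> nat \<Rightarrow> nat) \<Rightarrow> nat set set" where
  "edges n deg port = {{v, port v p} | v p. v < n \<and> p < deg v}"

definition adj_rel :: "nat set set \<Rightarrow> (nat \<times> nat) set" where
  "adj_rel F = {(u, w). {u, w} \<in> F}"

definition connected_on :: "nat \<Rightarrow> nat set set \<Rightarrow> bool" where
  "connected_on n F \<longleftrightarrow> (\<forall>u<n. \<forall>w<n. (u, w) \<in> (adj_rel F)\<^sup>*)"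

definition port_graph :: "nat \<Rightarrow> (nat \<Rightarrow> nat) \<Rightarrow> (nat \<Rightarrow> nat \<Rightarrow> nat) \<Rightarrow> bool" where
  "port_graph n deg port \<longleftrightarrow>
     (\<forall>v<n. \<forall>p<deg v. port v p < n \<and> port v p \<noteq> v) \<and>
     (\<forall>v<n. inj_on (port v) {..<deg v}) \<and>
     (\<forall>v<n. \<forall>p<deg v. \<exists>q<deg (port v p). port (port v p) q = v) \<and>
     connected_on n (edges n deg port)"

text \<open>The port at the other endpoint leading back (entry port after traversal).\<close>
definition rport :: "(nat \<Rightarrow> nat) \<Rightarrow> (nat \<Rightarrow> nat \<Rightarrow> nat) \<Rightarrow> nat \<Rightarrow> nat \<Rightarrow> nat" where
  "rport deg port v p = (THE q. q < deg (port v p) \<and> port (port v p) q = v)"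

text \<open>1-BHS adversary: in every round at most one footprint edge is missing and the
remaining graph is connected.  (For deterministic algorithms an adaptive adversary is
equivalent to quantifying over all such schedules.)\<close>
definition one_bhs_adversary :: "nat \<Rightarrow> nat set set \<Rightarrow> (nat \<Rightarrow> nat set set) \<Rightarrow> bool" where
  "one_bhs_adversary n E M \<longleftrightarrow>
     (\<forall>t. M t \<subseteq> E \<and> card (M t) \<le> 1 \<and> connected_on n (E - M t))"

section \<open>Agents and synchronous execution\<close>

datatype act = Stay | Move nat | Halt nat

text \<open>An algorithm (the same for every agent): given own ID, own memory state, degree of the
current node, entry port, whether the previous move attempt failed, the list of
(ID, state) of the other co-located agents, and the current whiteboard content, it returns
new state, new whiteboard content and an action.  Memory states and whiteboard contents
are natural numbers (binary strings); their size in bits is floorlog 2.\<close>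
type_synonym alg = "nat \<Rightarrow> nat \<Rightarrow> nat \<Rightarrow> nat option \<Rightarrow> bool \<Rightarrow> (nat \<times> nat) list \<Rightarrow> nat
                     \<Rightarrow> nat \<times> nat \<times> act"

record ag =
  ag_pos :: nat
  ag_st :: nat
  ag_alive :: bool
  ag_out :: "nat option"
  ag_entry :: "nat option"
  ag_failed :: bool

record cfg =
  ags :: "nat \<Rightarrow> ag"
  wbs :: "nat \<Rightarrow> nat"

text \<open>Agents at a node perform Compute in mutual exclusion, in increasing order of ID.\<close>
fun seqc :: "(nat \<Rightarrow> nat \<Rightarrow> nat \<times> nat \<times> act) \<Rightarrow> nat list \<Rightarrow> nat
              \<Rightarrow> nat \<times> (nat \<times> (nat \<times> act)) list" where
  "seqc f [] w = (w, [])"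
| "seqc f (i # is) w =
     (case f i w of (s', w', a) \<Rightarrow>
        (case seqc f is w' of (w'', r) \<Rightarrow> (w'', (i, (s', a)) # r)))"

definition here :: "(nat \<Rightarrow> nat) \<Rightarrow> nat \<Rightarrow> cfg \<Rightarrow> nat \<Rightarrow> nat list" where
  "here ids k c v = sort_key ids (filter (\<lambda>j. ag_alive (ags c j) \<and> ag_pos (ags c j) = v) [0..<k])"

definition node_res :: "alg \<Rightarrow> (nat \<Rightarrow> nat) \<Rightarrow> (nat \<Rightarrow> nat) \<Rightarrow> nat \<Rightarrow> cfg \<Rightarrow> nat
                         \<Rightarrow> nat \<times> (nat \<times> (nat \<times> act)) list" where
  "node_res \<delta> deg ids k c v =
     seqc (\<lambda>i w. \<delta> (ids i) (ag_st (ags c i)) (deg v) (ag_entry (ags c i)) (ag_failed (ags c i))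
                   (map (\<lambda>j. (ids j, ag_st (ags c j))) (filter (\<lambda>j. j \<noteq> i) (here ids k c v))) w)
          (filter (\<lambda>j. ag_out (ags c j) = None) (here ids k c v)) (wbs c v)"

definition upd_agent :: "alg \<Rightarrow> (nat \<Rightarrow> nat) \<Rightarrow> (nat \<Rightarrow> nat \<Rightarrow> nat) \<Rightarrow> nat \<Rightarrow> (nat \<Rightarrow> nat)
                          \<Rightarrow> nat \<Rightarrow> nat set set \<Rightarrow> cfg \<Rightarrow> nat \<Rightarrow> ag" where
  "upd_agent \<delta> deg port bh ids k M c i =
     (let a = ags c i; v = ag_pos a in
      if ag_alive a \<and> ag_out a = None then
        (case map_of (snd (node_res \<delta> deg ids k c v)) i of
           None \<Rightarrow> a
         | Some (s', ac) \<Rightarrow>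
            (case ac of
               Stay \<Rightarrow> a\<lparr>ag_st := s', ag_failed := False\<rparr>
             | Move p \<Rightarrow>
                 (if p < deg v \<and> {v, port v p} \<notin> M then
                    a\<lparr>ag_st := s', ag_pos := port v p, ag_entry := Some (rport deg port v p),
                      ag_failed := False, ag_alive := (port v p \<noteq> bh)\<rparr>
                  else a\<lparr>ag_st := s', ag_failed := True\<rparr>)
             | Halt p \<Rightarrow> a\<lparr>ag_st := s', ag_out := Some p\<rparr>))
      else a)"

definition step :: "alg \<Rightarrow> (nat \<Rightarrow> nat) \<Rightarrow> (nat \<Rightarrow> nat \<Rightarrow> nat) \<Rightarrow> nat \<Rightarrow> (nat \<Rightarrow> nat)
                     \<Rightarrow> nat \<Rightarrow> nat set set \<Rightarrow> cfg \<Rightarrow> cfg" where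
  "step \<delta> deg port bh ids k M c =
     \<lparr>ags = (\<lambda>i. upd_agent \<delta> deg port bh ids k M c i),
      wbs = (\<lambda>v. fst (node_res \<delta> deg ids k c v))\<rparr>"

text \<open>Rooted initial configuration: all agents at node s, memory 0, whiteboards empty (0).\<close>
definition init_cfg :: "nat \<Rightarrow> cfg" where
  "init_cfg s = \<lparr>ags = (\<lambda>i. \<lparr>ag_pos = s, ag_st = 0, ag_alive = True, ag_out = None,
                               ag_entry = None, ag_failed = False\<rparr>),
                 wbs = (\<lambda>v. 0)\<rparr>"

text \<open>exec ... t is the configuration after t rounds; round t+1 uses missing edges M t.\<close>
primrec exec :: "alg \<Rightarrow> (nat \<Rightarrow> nat) \<Rightarrow> (nat \<Rightarrow> nat \<Rightarrow> nat) \<Rightarrow> nat \<Rightarrow> nat \<Rightarrow> (nat \<Rightarrow> nat)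
                  \<Rightarrow> nat \<Rightarrow> (nat \<Rightarrow> nat set set) \<Rightarrow> nat \<Rightarrow> cfg" where
  "exec \<delta> deg port bh s ids k M 0 = init_cfg s"
| "exec \<delta> deg port bh s ids k M (Suc t) = step \<delta> deg port bh ids k (M t) (exec \<delta> deg port bh s ids k M t)"

text \<open>Solved by round T: every agent that has terminated reported a port of its (safe) node
leading to the black hole, at least one agent has terminated; memory of living agents and
whiteboards stay within K * log n bits in all rounds up to T.\<close>
definition solves_within :: "alg \<Rightarrow> nat \<Rightarrow> (nat \<Rightarrow> nat) \<Rightarrow> (nat \<Rightarrow> nat \<Rightarrow> nat) \<Rightarrow> nat \<Rightarrow> nat
                               \<Rightarrow> (nat \<Rightarrow> nat) \<Rightarrow> nat \<Rightarrow> (nat \<Rightarrow> nat set set) \<Rightarrow> nat \<Rightarrow> nat \<Rightarrow> bool" where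
  "solves_within \<delta> n deg port bh s ids k M K T \<longleftrightarrow>
     (let c = exec \<delta> deg port bh s ids k M in
       (\<exists>i<k. ag_alive (ags (c T) i) \<and> ag_out (ags (c T) i) \<noteq> None) \<and>
       (\<forall>i<k. \<forall>p. ag_out (ags (c T) i) = Some p \<longrightarrow>
            ag_alive (ags (c T) i) \<and> p < deg (ag_pos (ags (c T) i)) \<and>
            port (ag_pos (ags (c T) i)) p = bh) \<and>
       (\<forall>t\<le>T. \<forall>i<k. ag_alive (ags (c t) i) \<longrightarrow> floorlog 2 (ag_st (ags (c t) i)) \<le> K * floorlog 2 n) \<and>
       (\<forall>t\<le>T. \<forall>v<n. floorlog 2 (wbs (c t) v) \<le> K * floorlog 2 n))"

end

theory Submission
  imports Defs "HOL-Library.Nat_Bijection"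
begin

text \<open>The six agents form two teams, each with a leader and two companions. A team crosses an edge cautiously:
a companion goes ahead and returns, and as long as it is missing the second companion attempts the edge
in every round. When that attempt succeeds the edge is present, so the first companion comes back in
the same round unless the other end is the black hole; a leader that then sees neither of them knows
that the port leads to the black hole.

The first team performs one depth-first search of the graph and waits whenever it is blocked. It makes
\<open>O(|E|)\<close> steps altogether, and in a round without progress the adversary spends its removal on the
edge \<open>e\<close> that this team wants to cross. The second team performs depth-first searches with new
identifiers, skipping a port at which it is blocked and restarting when it is hindered otherwise.
While \<open>e\<close> is missing it searches the connected graph without \<open>e\<close> undisturbed, hence finds the black hole
within \<open>O(|E|)\<close> rounds.

It remains to exclude that the second team is itself split over \<open>e\<close>, waiting for its scout. When the
first team wants to cross that edge it meets either the waiting part or the stranded scout, and the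
teams swap roles: the split team takes over the global search, and the intact team starts a new
search. Two scouts that cross an edge simultaneously in opposite directions change teams.\<close>

section \<open>The algorithm\<close>

text \<open>Role swaps may occur again and again, so a swap must not lose any work of the global
  search. Its marks keep the identifier 1 throughout and stay on the whiteboards; only the pending
  order passes from one team to the other. The other search may be abandoned at any time: a restart
  takes the current round number as identifier and thereby invalidates all old marks without
  visiting them.

  The time bound comes from a lexicographic potential. Its first component, the rank of the global
  search, is O(|E|) and never falls. Its second component matters only while the edge
  \<open>e\<close> of the global search is missing. When such a period begins, the other search may
  rest on tree edges or skips that do not fit the absence of \<open>e\<close>; it then advances for
  at most O(|E|) rounds before it restarts or an agent terminates. After that restart, running out
  of ports without finding the black hole would contradict the connectivity of the graph without
  \<open>e\<close>. These two stages give the factor 2 in \<open>2 * RB\<close>, and the two linear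
  bounds multiply.\<close>

text \<open>Phases of a leader with port \<open>p\<close>: it orders the first companion through \<open>p\<close> (\<open>PO\<close>); that
companion is away and the second one tries to follow (\<open>PU\<close>); the first one is back, so \<open>p\<close> is safe,
and the second one is away (\<open>PS\<close>); all three move through \<open>p\<close> (\<open>PD\<close>).

The first field of every state is the team. A leader \<open>L\<close> moreover stores whether its team runs the
global search, phase and port, whether the port is explored (\<open>True\<close>) or backtracked through, whether
the intended move ends, rather than starts, at its node, the round number and the identifier
of its search. \<open>F\<close> is a companion and \<open>Tr\<close> a companion that attempted to move (\<open>True\<close>: the second one);
\<open>Sc\<close> is a scout that knows its way back and possibly carries an order of the global search.\<close>
datatype phase = PO | PU | PS | PD

datatype lst = Ini
  | is_L: L (tm: bool) (kp: bool) (lph: phase) (lp: nat) (lm: bool) (larr: bool) (lclk: nat) (lid: nat)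
  | F bool bool
  | Tr bool bool
  | Sc bool nat "bool option"

text \<open>\<open>Th k m\<close>: consult the marks of the global (\<open>k\<close>) or of the restarting search. The marks of a
search at a node are its identifier, the port to the parent plus one (zero at the root), and the
port to be tried next.\<close>
datatype tmode = Arr nat bool | SkipF | Restart

datatype pln = Do lst act | Th bool tmode

type_synonym mark = "nat \<times> nat \<times> nat"

section \<open>Presence of the members of a team at a node\<close>

definition hasA :: "lst set \<Rightarrow> bool \<Rightarrow> bool" where
  "hasA V t \<longleftrightarrow> F t False \<in> V \<or> Tr t False \<in> V"
definition hasB :: "lst set \<Rightarrow> bool \<Rightarrow> bool" where
  "hasB V t \<longleftrightarrow> F t True \<in> V \<or> Tr t True \<in> V"
definition hasS :: "lst set \<Rightarrow> bool \<Rightarrow> bool" where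
  "hasS V t \<longleftrightarrow> (\<exists>q k. Sc t q k \<in> V)"
definition hasL :: "lst set \<Rightarrow> bool \<Rightarrow> bool" where
  "hasL V t \<longleftrightarrow> (\<exists>s\<in>V. is_L s \<and> tm s = t)"
definition ldr :: "lst set \<Rightarrow> bool \<Rightarrow> lst" where
  "ldr V t = (THE s. s \<in> V \<and> is_L s \<and> tm s = t)"
definition tokof :: "lst set \<Rightarrow> bool \<Rightarrow> bool option" where
  "tokof V t = (THE k. \<exists>q. Sc t q k \<in> V)"

definition eport :: "nat option \<Rightarrow> nat" where
  "eport en = (case en of None \<Rightarrow> 0 | Some e \<Rightarrow> e)"

lemma eport_Some[simp]: "eport (Some e) = e" by (simp add: eport_def)

text \<open>The situation of a team is inferred only from who is missing beside its leader. In phase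
  \<open>PU\<close> the second companion must be present: when both companions are missing, the
  black hole has destroyed both and the leader halts instead.\<close>

definition split_at :: "lst set \<Rightarrow> bool \<Rightarrow> nat \<Rightarrow> bool" where
  "split_at V t p \<longleftrightarrow> hasL V t \<and> lp (ldr V t) = p \<and>
     (lph (ldr V t) = PO \<and> \<not> hasA V t \<or>
      lph (ldr V t) = PU \<and> \<not> hasS V t \<and> hasB V t \<or>
      lph (ldr V t) = PS \<and> \<not> hasS V t)"

definition xord :: "lst set \<Rightarrow> bool \<Rightarrow> bool" where
  "xord V t \<longleftrightarrow> hasL V t \<and> kp (ldr V t) \<and> lph (ldr V t) = PO \<and> hasA V t"

text \<open>The team of the global search cannot use its port because the other team is split over that edge:
either its leader waits at the same port, or its scout is stranded at the node.\<close>
definition sw1 :: "lst set \<Rightarrow> bool \<Rightarrow> bool" where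
  "sw1 V t \<longleftrightarrow> xord V t \<and> split_at V (\<not> t) (lp (ldr V t))"

definition sw2 :: "lst set \<Rightarrow> bool \<Rightarrow> bool" where
  "sw2 V t \<longleftrightarrow> xord V t \<and> \<not> hasL V (\<not> t) \<and> (\<exists>k. Sc (\<not> t) (lp (ldr V t)) k \<in> V)"

text \<open>The last alternative compares no ports, because \<open>Tr\<close> does not store the
  port of entry and the leader of that companion is not in view. Skipping too often here does no
  harm to the bound: a team whose companion stands so is in situation \<open>Snt\<close> or
  \<open>Rev\<close> and progresses in that round whatever the adversary does.\<close>

definition skp :: "lst set \<Rightarrow> bool \<Rightarrow> bool" where
  "skp V t \<longleftrightarrow> hasL V (\<not> t) \<and> lp (ldr V (\<not> t)) = lp (ldr V t) \<or>
     (\<exists>k. Sc (\<not> t) (lp (ldr V t)) k \<in> V) \<or>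
     \<not> hasL V (\<not> t) \<and> (\<exists>r. Tr (\<not> t) r \<in> V)"

text \<open>A waiting leader adopts the order of the global search (\<open>k'\<close>,
  \<open>m'\<close>) when the other leader at the node discovers the split. If the order arrives
  with the scout instead, the ordered move ends at this very node: hence \<open>larr\<close>, or the
  immediate \<open>Arr\<close> at port \<open>p\<close>, without crossing the edge again.\<close>

fun planL :: "lst set \<Rightarrow> nat option \<Rightarrow> bool \<Rightarrow> lst \<Rightarrow> pln" where
  "planL V en fl (L t k ph p m arr clk i) =
   (let got = sw1 V (\<not> t); k' = (k \<or> got); m' = (if got then lm (ldr V (\<not> t)) else m);
        complete = (if arr then Th k (Arr p m)
                    else case tokof V t of Some m2 \<Rightarrow> Th True (Arr p m2)
                      | None \<Rightarrow> Do (L t k PD p m arr (Suc clk) i) (Move p))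
    in case ph of
      PO \<Rightarrow> if hasA V t then
              (if k then (if sw1 V t \<or> sw2 V t then Th False Restart
                          else Do (L t k PO p m arr (Suc clk) i) Stay)
               else (if Tr t False \<in> V \<or> skp V t then Th False (if m then SkipF else Restart)
                     else Do (L t k PO p m arr (Suc clk) i) Stay))
            else Do (L t k' PU p m' arr (Suc clk) i) Stay
    | PU \<Rightarrow> if hasS V t then
              (if hasB V t then complete
               else (case tokof V t of None \<Rightarrow> Do (L t k PS p m arr (Suc clk) i) Stay
                       | Some m2 \<Rightarrow> Do (L t True PS p m2 True (Suc clk) i) Stay))
            else (if hasB V t then Do (L t k' PU p m' arr (Suc clk) i) Stay
                  else Do (L t k PU p m arr (Suc clk) i) (Halt p))
    | PS \<Rightarrow> if hasS V t then complete else Do (L t k' PS p m' arr (Suc clk) i) Stay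
    | PD \<Rightarrow> if fl then (if k then Do (L t k PD p m arr (Suc clk) i) (Move p) else Th False Restart)
            else Th k (Arr (eport en) m))"
| "planL V en fl s = Do s Stay"

text \<open>Companions receive no messages: each recomputes the decision of the leader from the
  common view, so that all three act in the same round. The argument \<open>own\<close> tells that
  the companion's own attempt has just failed, which for the second search has the same effect as a
  skipped port.\<close>

definition planF :: "lst set \<Rightarrow> bool \<Rightarrow> bool \<Rightarrow> bool \<Rightarrow> bool \<Rightarrow> pln" where
  "planF V fl own t r =
   (let l = ldr V t;
        again = (if kp l \<and> fl then Do (F t r) (Move (lp l)) else Do (F t r) Stay);
        compl = (if larr l \<or> tokof V t \<noteq> None then Do (F t r) Stay else Do (F t r) (Move (lp l)))
    in case lph l of
        PO \<Rightarrow> if r then Do (F t r) Stay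
              else if (if kp l then sw1 V t \<or> sw2 V t else own \<or> skp V t) then Do (F t r) Stay
              else Do (Tr t r) (Move (lp l))
      | PU \<Rightarrow> if \<not> r then Do (F t r) Stay
              else if hasS V t then compl else Do (Tr t r) (Move (lp l))
      | PS \<Rightarrow> if r \<and> hasS V t then compl else Do (F t r) Stay
      | PD \<Rightarrow> again)"

text \<open>The edge has just been crossed. A leader of the other team that points back through it
  in phase \<open>PO\<close> and misses its first companion shows that this companion crossed in the
  opposite direction in the same round. Changing the team reunites both teams at once, whereas
  removing the edge would otherwise split both.\<close>

definition planT :: "lst set \<Rightarrow> nat option \<Rightarrow> bool \<Rightarrow> pln" where
  "planT V en t =
   (if hasL V (\<not> t) \<and> lph (ldr V (\<not> t)) = PO \<and> lp (ldr V (\<not> t)) = eport en \<and> \<not> hasA V (\<not> t)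
    then Do (Sc (\<not> t) (eport en) None) Stay
    else Do (Sc t (eport en) None) (Move (eport en)))"

text \<open>With its leader in view the scout is back. If the second companion is away, the two
  exchange their roles; otherwise the team is complete and, unless the order is already fulfilled
  here, moves on in this same round.\<close>

definition planS :: "lst set \<Rightarrow> bool \<Rightarrow> nat \<Rightarrow> bool option \<Rightarrow> pln" where
  "planS V t q k =
   (if hasL V t then
      (if lph (ldr V t) = PU \<and> \<not> hasB V t then Do (F t True) Stay
       else if larr (ldr V t) \<or> k \<noteq> None then Do (F t False) Stay
       else Do (F t False) (Move (lp (ldr V t))))
    else if sw2 V (\<not> t) \<and> lp (ldr V (\<not> t)) = q
      then Do (Sc t q (Some (lm (ldr V (\<not> t))))) (Move q)
    else Do (Sc t q k) (Move q))"

fun plan :: "lst set \<Rightarrow> nat option \<Rightarrow> bool \<Rightarrow> lst \<Rightarrow> pln" where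
  "plan V en fl (F t r) = planF V fl False t r"
| "plan V en fl (Tr t r) = (if fl then planF V fl True t r else planT V en t)"
| "plan V en fl (Sc t q k) = planS V t q k"
| "plan V en fl s = planL V en fl s"

text \<open>The last case is a search exhausted at its root. For the global search, which skips no
  ports, connectivity excludes it.\<close>

fun nxt :: "bool \<Rightarrow> mark \<Rightarrow> nat \<Rightarrow> nat \<Rightarrow> nat \<Rightarrow> mark \<times> nat \<times> bool \<times> nat" where
  "nxt k (j, pa, pt) d clk i =
    (if pt < d then ((j, pa, pt), pt, True, i)
     else if pa > 0 then ((j, pa, pt), pa - 1, False, i)
     else (((if k then 1 else clk), 0, 0), 0, True, clk))"

text \<open>An exploring team that reaches a node known to the search turns round at once and leaves
  the mark there alone; the pointer that led there advances only after the return. Thus a port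
  counts as tried only when the team is back, unless it is skipped.\<close>

fun think :: "bool \<Rightarrow> tmode \<Rightarrow> mark \<Rightarrow> nat \<Rightarrow> nat \<Rightarrow> nat \<Rightarrow> mark \<times> nat \<times> bool \<times> nat" where
  "think k (Arr e m) (j, pa, pt) d clk i =
    (if m then (if j \<noteq> (if k then 1 else i) then nxt k ((if k then 1 else i), Suc e, 0) d clk i
                else ((j, pa, pt), e, False, i))
     else nxt k (j, pa, Suc pt) d clk i)"
| "think k SkipF (j, pa, pt) d clk i = nxt k (j, pa, Suc pt) d clk i"
| "think k Restart (j, pa, pt) d clk i = (((if k then 1 else clk), 0, 0), 0, True, clk)"

section \<open>Coding of states and marks by natural numbers\<close>

fun phc :: "phase \<Rightarrow> nat" where "phc PO = 0" | "phc PU = 1" | "phc PS = 2" | "phc PD = 3"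

fun tokc :: "bool option \<Rightarrow> nat" where "tokc None = 0" | "tokc (Some b) = Suc (of_bool b)"

abbreviation pe :: "nat \<Rightarrow> nat \<Rightarrow> nat" where "pe a b \<equiv> prod_encode (a, b)"

fun enc :: "lst \<Rightarrow> nat" where
  "enc Ini = 0"
| "enc (L t k ph p m arr clk i) =
     Suc (pe 0 (pe (of_bool t) (pe (of_bool k) (pe (phc ph) (pe p (pe (of_bool m) (pe (of_bool arr) (pe clk i))))))))"
| "enc (F t r) = Suc (pe 1 (pe (of_bool t) (of_bool r)))"
| "enc (Tr t r) = Suc (pe 2 (pe (of_bool t) (of_bool r)))"
| "enc (Sc t q k) = Suc (pe 3 (pe (of_bool t) (pe q (tokc k))))"

lemma phc_eq: "phc a = phc b \<longleftrightarrow> a = b" by (cases a; cases b; simp)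
lemma tokc_eq: "tokc a = tokc b \<longleftrightarrow> a = b" by (cases a; cases b; simp add: of_bool_def)

lemma enc_inj: "enc a = enc b \<longleftrightarrow> a = b"
  by (cases a; cases b; simp add: phc_eq tokc_eq)

definition dec :: "nat \<Rightarrow> lst" where "dec = inv enc"

lemma dec_enc[simp]: "dec (enc s) = s"
  unfolding dec_def by (rule inv_f_f) (simp add: inj_def enc_inj)

lemma dec_0[simp]: "dec 0 = Ini" using dec_enc[of Ini] by simp

fun encm :: "mark \<Rightarrow> nat" where "encm (a, b, c) = pe a (pe b c)"
definition decm :: "nat \<Rightarrow> mark" where
  "decm w = (case prod_decode w of (a, w1) \<Rightarrow> (a, prod_decode w1))"
lemma decm_encm[simp]: "decm (encm x) = x" by (cases x) (simp add: decm_def)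
lemma encm_decm[simp]: "encm (decm x) = x"
proof -
  obtain a b where 1: "prod_decode x = (a, b)" by fastforce
  obtain c d where 2: "prod_decode b = (c, d)" by fastforce
  have "prod_encode (a, b) = x" "prod_encode (c, d) = b" using 1 2 by (metis prod_decode_inverse)+
  then show ?thesis by (simp add: decm_def 1 2)
qed

definition encw :: "(bool \<Rightarrow> mark) \<Rightarrow> nat" where "encw W = pe (encm (W True)) (encm (W False))"
definition decw :: "nat \<Rightarrow> bool \<Rightarrow> mark" where
  "decw w k = decm ((if k then fst else snd) (prod_decode w))"
lemma decw_encw[simp]: "decw (encw W) = W" by (rule ext) (simp add: decw_def encw_def)
lemma encw_decw[simp]: "encw (decw w) = w" by (simp add: decw_def encw_def)

text \<open>Both searches can start with identifier 1 since they own separate parts of a whiteboard,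
  and the clock starts at 2 so that the identifiers of later restarts are new. An untouched
  whiteboard decodes to identifier 0, hence to an unvisited node.\<close>

fun ini :: "nat \<Rightarrow> nat \<Rightarrow> nat \<times> nat \<times> act" where
  "ini r w =
   (if r = 0 then (enc (L False True PO 0 True False 2 1), encw ((decw w)(True := (1, 0, 0))), Stay)
    else if r = 1 then (enc (F False False), w, Stay)
    else if r = 2 then (enc (F False True), w, Stay)
    else if r = 3 then (enc (L True False PO 0 True False 2 1), encw ((decw w)(False := (1, 0, 0))), Stay)
    else if r = 4 then (enc (F True False), w, Stay)
    else (enc (F True True), w, Stay))"

definition react :: "lst \<Rightarrow> pln \<Rightarrow> nat \<Rightarrow> nat \<Rightarrow> nat \<times> nat \<times> act" where
  "react s pl d w =
    (case pl of Do s' a \<Rightarrow> (enc s', w, a)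
     | Th k x \<Rightarrow> (case think k x (decw w k) d (lclk s) (lid s) of (mk, p, m, i) \<Rightarrow>
         (enc (L (tm s) k PO p m False (Suc (lclk s)) i), encw ((decw w)(k := mk)), Stay)))"

text \<open>The ID enters only in the first round, through the rank of the agent among those at the
  start; from then on the roles stored in the states distinguish the agents.\<close>

definition bhs_alg :: alg where
  "bhs_alg me st d en fl oth w =
    (if dec st = Ini then ini (length (filter (\<lambda>x. fst x < me) oth)) w
     else react (dec st) (plan (insert (dec st) (dec ` snd ` set oth)) en fl (dec st)) d w)"

section \<open>One round of the execution\<close>

definition loc :: "cfg \<Rightarrow> nat \<Rightarrow> nat \<Rightarrow> lst \<Rightarrow> bool" where
  "loc c i v s \<longleftrightarrow> ag_alive (ags c i) \<and> ag_out (ags c i) = None \<and> ag_pos (ags c i) = v \<and> ag_st (ags c i) = enc s"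

abbreviation "ent c i \<equiv> ag_entry (ags c i)"
abbreviation "fld c i \<equiv> ag_failed (ags c i)"
abbreviation "alv c i \<equiv> ag_alive (ags c i)"

definition vw :: "cfg \<Rightarrow> nat \<Rightarrow> lst set" where "vw c v = {s. \<exists>i<6. loc c i v s}"

definition mk :: "cfg \<Rightarrow> bool \<Rightarrow> nat \<Rightarrow> mark" where "mk c k v = decw (wbs c v) k"

text \<open>No living agent has terminated, and the first round is over.\<close>
definition running :: "cfg \<Rightarrow> bool" where
  "running c \<longleftrightarrow> (\<forall>i<6. alv c i \<longrightarrow> (\<exists>v s. loc c i v s \<and> s \<noteq> Ini))"

definition plc :: "cfg \<Rightarrow> nat \<Rightarrow> pln" where
  "plc c i = plan (vw c (ag_pos (ags c i))) (ent c i) (fld c i) (dec (ag_st (ags c i)))"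

text \<open>Each part of the whiteboards is written by at most one agent per round, so that the order of
the computations at a node is irrelevant.\<close>
definition one_writer :: "cfg \<Rightarrow> bool" where
  "one_writer c \<longleftrightarrow> (\<forall>i<6. \<forall>j<6. \<forall>k x y. alv c i \<and> alv c j \<and> plc c i = Th k x \<and> plc c j = Th k y \<longrightarrow> i = j)"

text \<open>The agents at a node compute one after another, each on the whiteboard left by its
  predecessors. If an agent depends only on the part \<open>k\<close> that it alone overwrites, it
  still finds \<open>W0 k\<close> there, so the outcome is that of a simultaneous
  computation.\<close>

lemma seqc_separate:
  assumes "\<And>i k x W. i \<in> set xs \<Longrightarrow> P i = Th k x \<Longrightarrow> W k = W0 k \<Longrightarrow>
      f i (encw W) = (S i, encw (W(k := m i)), C i)"
    and "\<And>i s a W. i \<in> set xs \<Longrightarrow> P i = Do s a \<Longrightarrow> f i (encw W) = (S i, encw W, C i)"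
    and "\<And>i j k x y. i \<in> set xs \<Longrightarrow> j \<in> set xs \<Longrightarrow> P i = Th k x \<Longrightarrow> P j = Th k y \<Longrightarrow> i = j"
    and "distinct xs"
    and "\<And>i k x. i \<in> set xs \<Longrightarrow> P i = Th k x \<Longrightarrow> W k = W0 k"
  shows "\<exists>W' r. seqc f xs (encw W) = (encw W', r) \<and>
     (\<forall>i\<in>set xs. map_of r i = Some (S i, C i)) \<and>
     (\<forall>i\<in>set xs. \<forall>k x. P i = Th k x \<longrightarrow> W' k = m i) \<and>
     (\<forall>k. (\<forall>i\<in>set xs. \<forall>x. P i \<noteq> Th k x) \<longrightarrow> W' k = W k)"
  using assms
proof (induction xs arbitrary: W)
  case Nil
  then show ?case by auto
next
  case (Cons i xs)
  obtain W1 where W1: "f i (encw W) = (S i, encw W1, C i)"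
    and W1k: "\<And>k x. P i = Th k x \<Longrightarrow> W1 = W(k := m i)" and W1n: "\<And>s a. P i = Do s a \<Longrightarrow> W1 = W"
  proof (cases "P i")
    case (Do s a) then show ?thesis using Cons.prems(2)[of i s a W] that by auto
  next
    case (Th k x)
    have "W k = W0 k" using Cons.prems(5)[OF _ Th] by simp
    then have "f i (encw W) = (S i, encw (W(k := m i)), C i)" by (rule Cons.prems(1)[OF _ Th, rotated]) simp
    then show ?thesis by (rule that) (simp_all add: Th)
  qed
  have nj: "j \<noteq> i" if "j \<in> set xs" for j using that Cons.prems(4) by auto
  have "\<exists>W' r. seqc f xs (encw W1) = (encw W', r) \<and>
     (\<forall>i\<in>set xs. map_of r i = Some (S i, C i)) \<and>
     (\<forall>i\<in>set xs. \<forall>k x. P i = Th k x \<longrightarrow> W' k = m i) \<and>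
     (\<forall>k. (\<forall>i\<in>set xs. \<forall>x. P i \<noteq> Th k x) \<longrightarrow> W' k = W1 k)"
  proof (rule Cons.IH)
    fix j k x assume j: "j \<in> set xs" "P j = Th k x"
    have "W1 k = W k"
    proof (cases "P i")
      case (Do s a) then show ?thesis using W1n by simp
    next
      case (Th k' x')
      then have "k' \<noteq> k" using Cons.prems(3)[of i j k] j nj[OF j(1)] by auto
      then show ?thesis using W1k[OF Th] by simp
    qed
    then show "W1 k = W0 k" using Cons.prems(5)[of j k x] j by simp
  next
    show "distinct xs" using Cons.prems(4) by simp
  qed (use Cons.prems in \<open>auto\<close>)
  then obtain W' r where h: "seqc f xs (encw W1) = (encw W', r)"
     "\<forall>i\<in>set xs. map_of r i = Some (S i, C i)"
     "\<forall>i\<in>set xs. \<forall>k x. P i = Th k x \<longrightarrow> W' k = m i"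
     "\<forall>k. (\<forall>i\<in>set xs. \<forall>x. P i \<noteq> Th k x) \<longrightarrow> W' k = W1 k" by blast
  show ?case
  proof (intro exI conjI)
    show "seqc f (i # xs) (encw W) = (encw W', (i, (S i, C i)) # r)" using W1 h(1) by simp
    show "\<forall>j\<in>set (i # xs). map_of ((i, (S i, C i)) # r) j = Some (S j, C j)" using h(2) by auto
    show "\<forall>j\<in>set (i # xs). \<forall>k x. P j = Th k x \<longrightarrow> W' k = m j"
    proof (intro ballI allI impI)
      fix j k x assume j: "j \<in> set (i # xs)" "P j = Th k x"
      show "W' k = m j"
      proof (cases "j = i")
        case True
        then have "\<forall>a\<in>set xs. \<forall>y. P a \<noteq> Th k y" using Cons.prems(3)[of _ i k] j nj by force
        then show ?thesis using h(4) W1k True j by auto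
      next
        case False then show ?thesis using h(3) j by auto
      qed
    qed
    show "\<forall>k. (\<forall>j\<in>set (i # xs). \<forall>x. P j \<noteq> Th k x) \<longrightarrow> W' k = W k"
    proof (intro allI impI)
      fix k assume a: "\<forall>j\<in>set (i # xs). \<forall>x. P j \<noteq> Th k x"
      then have "W' k = W1 k" using h(4) by auto
      moreover have "W1 k = W k"
      proof (cases "P i")
        case (Do s b) then show ?thesis using W1n by simp
      next
        case (Th k' x')
        then have "k' \<noteq> k" using a by auto
        then show ?thesis using W1k[OF Th] by simp
      qed
      ultimately show "W' k = W k" by simp
    qed
  qed
qed

lemma set_here: "set (here ids k c v) = {j. j < k \<and> alv c j \<and> ag_pos (ags c j) = v}"
  by (auto simp: here_def)

lemma distinct_here: "distinct (here ids k c v)"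
  by (simp add: here_def distinct_sort)

lemma runningD: "running c \<Longrightarrow> i < 6 \<Longrightarrow> alv c i \<Longrightarrow>
   \<exists>s. s \<noteq> Ini \<and> ag_out (ags c i) = None \<and> ag_st (ags c i) = enc s \<and> loc c i (ag_pos (ags c i)) s"
  unfolding running_def loc_def by fastforce

text \<open>Agents that have halted would stay visible without being located by \<open>loc\<close>;
  \<open>running\<close> excludes them. The own state is inserted because an agent does not occur in
  its own list of companions.\<close>

lemma view_eq:
  assumes "running c" "i < 6" "loc c i v s"
  shows "insert s (dec ` snd ` set (map (\<lambda>j. (ids j, ag_st (ags c j))) (filter (\<lambda>j. j \<noteq> i) (here ids 6 c v)))) = vw c v"
    (is "?l = _")
proof -
  have "?l = insert s {dec (ag_st (ags c j)) |j. j < 6 \<and> j \<noteq> i \<and> alv c j \<and> ag_pos (ags c j) = v}"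
    by (auto simp: set_here image_iff)
  also have "\<dots> = vw c v"
  proof (rule set_eqI)
    fix x
    show "x \<in> insert s {dec (ag_st (ags c j)) |j. j < 6 \<and> j \<noteq> i \<and> alv c j \<and> ag_pos (ags c j) = v} \<longleftrightarrow> x \<in> vw c v"
    proof
      assume "x \<in> insert s {dec (ag_st (ags c j)) |j. j < 6 \<and> j \<noteq> i \<and> alv c j \<and> ag_pos (ags c j) = v}"
      then consider "x = s" | j where "x = dec (ag_st (ags c j))" "j < 6" "alv c j" "ag_pos (ags c j) = v" by auto
      then show "x \<in> vw c v"
      proof cases
        case 1 then show ?thesis using assms by (auto simp: vw_def)
      next
        case 2 then show ?thesis using runningD[OF assms(1) 2(2,3)] by (auto simp: vw_def)
      qed
    next
      assume "x \<in> vw c v"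
      then obtain j where j: "j < 6" "loc c j v x" by (auto simp: vw_def)
      then show "x \<in> insert s {dec (ag_st (ags c j)) |j. j < 6 \<and> j \<noteq> i \<and> alv c j \<and> ag_pos (ags c j) = v}"
        using assms(3) by (cases "j = i") (auto simp: loc_def enc_inj intro!: exI[of _ j])
    qed
  qed
  finally show ?thesis .
qed

lemma node_res_spec:
  assumes run: "running c" and one: "one_writer c"
  shows "\<exists>W r. node_res bhs_alg deg ids 6 c v = (encw W, r) \<and>
    (\<forall>i s s' a. i < 6 \<and> loc c i v s \<and> plc c i = Do s' a \<longrightarrow> map_of r i = Some (enc s', a)) \<and>
    (\<forall>i s k x m p b j. i < 6 \<and> loc c i v s \<and> plc c i = Th k x \<and> think k x (mk c k v) (deg v) (lclk s) (lid s) = (m, p, b, j)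
       \<longrightarrow> map_of r i = Some (enc (L (tm s) k PO p b False (Suc (lclk s)) j), Stay) \<and> W k = m) \<and>
    (\<forall>k. (\<forall>i s x. i < 6 \<and> loc c i v s \<longrightarrow> plc c i \<noteq> Th k x) \<longrightarrow> W k = mk c k v)"
proof -
  let ?xs = "filter (\<lambda>j. ag_out (ags c j) = None) (here ids 6 c v)"
  let ?f = "\<lambda>i w. bhs_alg (ids i) (ag_st (ags c i)) (deg v) (ent c i) (fld c i)
                   (map (\<lambda>j. (ids j, ag_st (ags c j))) (filter (\<lambda>j. j \<noteq> i) (here ids 6 c v))) w"
  define W0 where "W0 = (\<lambda>k. mk c k v)"
  have w0: "wbs c v = encw W0" unfolding W0_def mk_def by simp
  define st where "st i = dec (ag_st (ags c i))" for i
  define R where "R i = react (st i) (plc c i) (deg v) (wbs c v)" for i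
  have inx: "i \<in> set ?xs \<longleftrightarrow> i < 6 \<and> loc c i v (st i)" for i
  proof
    assume "i \<in> set ?xs"
    then have "i < 6" "alv c i" "ag_pos (ags c i) = v" by (auto simp: set_here)
    then show "i < 6 \<and> loc c i v (st i)" using runningD[OF run, of i] by (auto simp: loc_def st_def)
  qed (auto simp: set_here loc_def)
  have ff: "?f i w = react (st i) (plc c i) (deg v) w" and nI: "st i \<noteq> Ini"
    if i: "i \<in> set ?xs" for i w
  proof -
    have l: "loc c i v (st i)" "i < 6" using i inx by auto
    then have p: "ag_pos (ags c i) = v" "alv c i" by (auto simp: loc_def)
    show n: "st i \<noteq> Ini" using runningD[OF run l(2) p(2)] by (auto simp: st_def)
    have vv: "insert (dec (ag_st (ags c i))) (dec ` snd ` set (map (\<lambda>j. (ids j, ag_st (ags c j))) (filter (\<lambda>j. j \<noteq> i) (here ids 6 c v)))) = vw c v"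
      using view_eq[OF run l(2,1), of ids] by (simp only: st_def)
    show "?f i w = react (st i) (plc c i) (deg v) w"
      unfolding bhs_alg_def plc_def p vv using n by (simp add: st_def)
  qed
  have "\<exists>W' r. seqc ?f ?xs (encw W0) = (encw W', r) \<and>
     (\<forall>i\<in>set ?xs. map_of r i = Some (fst (R i), snd (snd (R i)))) \<and>
     (\<forall>i\<in>set ?xs. \<forall>k x. plc c i = Th k x \<longrightarrow> W' k = (case think k x (W0 k) (deg v) (lclk (st i)) (lid (st i)) of (m, _) \<Rightarrow> m)) \<and>
     (\<forall>k. (\<forall>i\<in>set ?xs. \<forall>x. plc c i \<noteq> Th k x) \<longrightarrow> W' k = W0 k)"
    (is "\<exists>W' r. _ \<and> _ \<and> (\<forall>i\<in>_. \<forall>k x. _ \<longrightarrow> W' k = ?mm i k x) \<and> _")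
  proof -
    define m where "m i = (case plc c i of Th k x \<Rightarrow> ?mm i k x | Do s a \<Rightarrow> (0, 0, 0))" for i
    have "\<exists>W' r. seqc ?f ?xs (encw W0) = (encw W', r) \<and>
     (\<forall>i\<in>set ?xs. map_of r i = Some (fst (R i), snd (snd (R i)))) \<and>
     (\<forall>i\<in>set ?xs. \<forall>k x. plc c i = Th k x \<longrightarrow> W' k = m i) \<and>
     (\<forall>k. (\<forall>i\<in>set ?xs. \<forall>x. plc c i \<noteq> Th k x) \<longrightarrow> W' k = W0 k)"
    proof (rule seqc_separate[where ?W0.0 = W0 and m = m])
      fix i k x W assume i: "i \<in> set ?xs" "plc c i = Th k x" "W k = W0 k"
      show "?f i (encw W) = (fst (R i), encw (W(k := m i)), snd (snd (R i)))"
        unfolding ff[OF i(1)] R_def w0 react_def m_def using i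
        by (simp split: prod.split del: think.simps enc.simps)
    next
      fix i s a W assume i: "i \<in> set ?xs" "plc c i = Do s a"
      show "?f i (encw W) = (fst (R i), encw W, snd (snd (R i)))"
        unfolding ff[OF i(1)] R_def w0 react_def using i by simp
    next
      fix i j k x y assume "i \<in> set ?xs" "j \<in> set ?xs" "plc c i = Th k x" "plc c j = Th k y"
      then show "i = j" using one inx unfolding one_writer_def loc_def by metis
    qed (auto simp: distinct_here)
    then show ?thesis unfolding m_def by (auto 0 4)
  qed
  then obtain W r where h: "seqc ?f ?xs (encw W0) = (encw W, r)"
     "\<forall>i\<in>set ?xs. map_of r i = Some (fst (R i), snd (snd (R i)))"
     "\<forall>i\<in>set ?xs. \<forall>k x. plc c i = Th k x \<longrightarrow> W k = ?mm i k x"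
     "\<forall>k. (\<forall>i\<in>set ?xs. \<forall>x. plc c i \<noteq> Th k x) \<longrightarrow> W k = W0 k" by blast
  have inx2: "i \<in> set ?xs \<and> st i = s" if "i < 6" "loc c i v s" for i s
    using that by (auto simp: set_here loc_def st_def)
  show ?thesis
  proof (intro exI[of _ W] exI[of _ r] conjI allI impI)
    show "node_res bhs_alg deg ids 6 c v = (encw W, r)"
      unfolding node_res_def w0 using h(1) by simp
  next
    fix i s s' a assume a: "i < 6 \<and> loc c i v s \<and> plc c i = Do s' a"
    then have "R i = (enc s', encw W0, a)" using inx2[of i s] by (simp add: R_def react_def w0)
    then show "map_of r i = Some (enc s', a)" using h(2) a inx2[of i s] by (simp del: enc.simps)
  next
    fix i s k x m p b j assume a: "i < 6 \<and> loc c i v s \<and> plc c i = Th k x \<and> think k x (mk c k v) (deg v) (lclk s) (lid s) = (m, p, b, j)"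
    then have t: "think k x (W0 k) (deg v) (lclk (st i)) (lid (st i)) = (m, p, b, j)"
      and s: "st i = s" and ix: "i \<in> set ?xs" using inx2[of i s] by (auto simp: W0_def)
    have R: "R i = (enc (L (tm s) k PO p b False (Suc (lclk s)) j), encw (W0(k := m)), Stay)"
      using a t s by (simp add: R_def react_def w0 del: think.simps enc.simps)
    show "map_of r i = Some (enc (L (tm s) k PO p b False (Suc (lclk s)) j), Stay)"
      using h(2) ix by (simp add: R del: enc.simps)
    show "W k = m" using h(3) a ix t by auto
  next
    fix k assume "\<forall>i s x. i < 6 \<and> loc c i v s \<longrightarrow> plc c i \<noteq> Th k x"
    then show "W k = mk c k v" using h(4) inx unfolding W0_def by blast
  qed
qed

lemma plc_eq: "loc c i v s \<Longrightarrow> plc c i = plan (vw c v) (ent c i) (fld c i) s"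
  by (simp add: plc_def loc_def)

section \<open>The effect of the individual actions on an agent\<close>

context
  fixes deg :: "nat \<Rightarrow> nat" and port :: "nat \<Rightarrow> nat \<Rightarrow> nat" and bh :: nat and ids :: "nat \<Rightarrow> nat"
    and M :: "nat set set" and c :: cfg
  assumes run: "running c" and one: "one_writer c"
begin

abbreviation (input) "nx \<equiv> step bhs_alg deg port bh ids 6 M c"

lemma upd_Do:
  assumes "i < 6" "loc c i v s" "plc c i = Do s' a"
  shows "ags nx i = (case a of
               Stay \<Rightarrow> (ags c i)\<lparr>ag_st := enc s', ag_failed := False\<rparr>
             | Move p \<Rightarrow>
                 (if p < deg v \<and> {v, port v p} \<notin> M then
                    (ags c i)\<lparr>ag_st := enc s', ag_pos := port v p, ag_entry := Some (rport deg port v p),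
                      ag_failed := False, ag_alive := (port v p \<noteq> bh)\<rparr>
                  else (ags c i)\<lparr>ag_st := enc s', ag_failed := True\<rparr>)
             | Halt p \<Rightarrow> (ags c i)\<lparr>ag_st := enc s', ag_out := Some p\<rparr>)"
proof -
  have p: "ag_pos (ags c i) = v" "alv c i" "ag_out (ags c i) = None" using assms by (auto simp: loc_def)
  obtain W r where "node_res bhs_alg deg ids 6 c v = (encw W, r)" "map_of r i = Some (enc s', a)"
    using node_res_spec[OF run one, of deg ids v] assms by metis
  then show ?thesis by (cases a) (simp_all add: step_def upd_agent_def p Let_def del: enc.simps)
qed

lemma stay_step:
  assumes "i < 6" "loc c i v s" "plc c i = Do s' Stay"
  shows "loc nx i v s'" "ent nx i = ent c i" "\<not> fld nx i"
  using upd_Do[OF assms] assms(2) by (auto simp: loc_def)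

lemma move_step:
  assumes "i < 6" "loc c i v s" "plc c i = Do s' (Move p)" "p < deg v" "{v, port v p} \<notin> M"
  shows "port v p \<noteq> bh \<Longrightarrow> loc nx i (port v p) s'" "port v p = bh \<Longrightarrow> \<not> alv nx i"
    "ent nx i = Some (rport deg port v p)" "\<not> fld nx i"
  using upd_Do[OF assms(1-3)] assms(2,4,5) by (auto simp: loc_def)

lemma block_step:
  assumes "i < 6" "loc c i v s" "plc c i = Do s' (Move p)" "{v, port v p} \<in> M"
  shows "loc nx i v s'" "ent nx i = ent c i" "fld nx i"
  using upd_Do[OF assms(1-3)] assms(2,4) by (auto simp: loc_def)

lemma halt_step:
  assumes "i < 6" "loc c i v s" "plc c i = Do s' (Halt p)"
  shows "alv nx i" "ag_out (ags nx i) = Some p" "ag_pos (ags nx i) = v"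
  using upd_Do[OF assms(1-3)] assms(2) by (auto simp: loc_def)

lemma think_step:
  assumes "i < 6" "loc c i v s" "plc c i = Th k x"
    "think k x (mk c k v) (deg v) (lclk s) (lid s) = (m, p, b, j)"
  shows "loc nx i v (L (tm s) k PO p b False (Suc (lclk s)) j)" "mk nx k v = m" "\<not> fld nx i"
proof -
  have p: "ag_pos (ags c i) = v" "alv c i" "ag_out (ags c i) = None" using assms by (auto simp: loc_def)
  obtain W r where h: "node_res bhs_alg deg ids 6 c v = (encw W, r)"
    "map_of r i = Some (enc (L (tm s) k PO p b False (Suc (lclk s)) j), Stay)" "W k = m"
    using node_res_spec[OF run one, of deg ids v] assms by metis
  have "ags nx i = (ags c i)\<lparr>ag_st := enc (L (tm s) k PO p b False (Suc (lclk s)) j), ag_failed := False\<rparr>"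
    using h by (simp add: step_def upd_agent_def p Let_def del: enc.simps)
  then show "loc nx i v (L (tm s) k PO p b False (Suc (lclk s)) j)" "\<not> fld nx i"
    using p by (auto simp: loc_def)
  show "mk nx k v = m" using h by (simp add: step_def mk_def)
qed

lemma dead_step: "\<not> alv c i \<Longrightarrow> \<not> alv nx i"
  by (simp add: step_def upd_agent_def Let_def)

lemma mk_unwritten:
  assumes "\<And>i s x. i < 6 \<Longrightarrow> loc c i v s \<Longrightarrow> plc c i \<noteq> Th k x"
  shows "mk nx k v = mk c k v"
proof -
  obtain W r where h: "node_res bhs_alg deg ids 6 c v = (encw W, r)" "W k = mk c k v"
    using node_res_spec[OF run one, of deg ids v] assms by metis
  then show ?thesis by (simp add: step_def mk_def)
qed

lemma out_step:
  assumes "i < 6" "ag_out (ags nx i) = Some p" "alv c i"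
  shows "\<exists>v s s'. loc c i v s \<and> plc c i = Do s' (Halt p)"
proof -
  obtain s where s: "loc c i (ag_pos (ags c i)) s" "ag_out (ags c i) = None" using runningD[OF run assms(1,3)] by auto
  show ?thesis
  proof (cases "plc c i")
    case (Do s' a)
    then show ?thesis using upd_Do[OF assms(1) s(1) Do] assms(2) s by (auto split: act.splits if_splits)
  next
    case (Th k x)
    obtain m p b j where "think k x (mk c k (ag_pos (ags c i))) (deg (ag_pos (ags c i))) (lclk s) (lid s) = (m, p, b, j)"
      using prod_cases4 by blast
    from think_step(1)[OF assms(1) s(1) Th this] assms(2) show ?thesis by (simp add: loc_def)
  qed
qed

end

section \<open>Teams\<close>

text \<open>The situation of a team at the beginning of a round: the first companion is about to move (\<open>Ord\<close>),
has just moved (\<open>Snt\<close>), is away while the second one tries to follow (\<open>Tst\<close>); the two companions have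
changed places (\<open>Rev\<close>) or are both lost (\<open>Ded\<close>); all are back (\<open>Cmp\<close>); the port is safe but the scout is
away (\<open>Saf\<close>); the common move has failed (\<open>Blk\<close>) or succeeded (\<open>Crs\<close>).\<close>
datatype tph = Ord | Snt | Tst | Rev | Ded | Cmp | Saf | Blk | Crs

text \<open>A team as seen from outside: companions \<open>ta\<close> and \<open>tb\<close>, leader
  \<open>tl\<close>, the node \<open>tu\<close> of the leader before a crossing, and its port
  \<open>tp\<close>. The fields \<open>tk\<close>, \<open>tmd\<close>, \<open>tarr\<close>,
  \<open>tck\<close>, \<open>tid\<close> mirror the state of the leader, and \<open>ttok\<close> is
  the order carried by the scout. \<open>tx\<close> refines the situation: an attempt has failed
  (\<open>Ord\<close>, \<open>Tst\<close>), or the leader is in \<open>PS\<close> rather than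
  \<open>PU\<close> (\<open>Cmp\<close>). \<open>tq\<close> is the port that a scout beside its
  leader still stores.\<close>

record team =
  ta :: nat
  tb :: nat
  tl :: nat
  tu :: nat
  tp :: nat
  tph :: tph
  tx :: bool
  tk :: bool
  tmd :: bool
  tarr :: bool
  ttok :: "bool option"
  tq :: nat
  tck :: nat
  tid :: nat

definition ldst :: "bool \<Rightarrow> team \<Rightarrow> phase \<Rightarrow> lst" where
  "ldst t T ph = L t (tk T) ph (tp T) (tmd T) (tarr T) (tck T) (tid T)"

lemma ldst_sel[simp]: "is_L (ldst t T ph)" "tm (ldst t T ph) = t" "kp (ldst t T ph) = tk T"
  "lph (ldst t T ph) = ph" "lp (ldst t T ph) = tp T" "lm (ldst t T ph) = tmd T"
  "larr (ldst t T ph) = tarr T" "lclk (ldst t T ph) = tck T" "lid (ldst t T ph) = tid T"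
  by (simp_all add: ldst_def)

fun tmof :: "lst \<Rightarrow> bool" where
  "tmof (L t _ _ _ _ _ _ _) = t" | "tmof (F t _) = t" | "tmof (Tr t _) = t"
| "tmof (Sc t _ _) = t" | "tmof Ini = True"

lemma tmof_ldst[simp]: "tmof (ldst t T ph) = t" by (simp add: ldst_def)

lemma ldst_neq[simp]: "ldst t T ph \<noteq> F t' r" "ldst t T ph \<noteq> Tr t' r" "ldst t T ph \<noteq> Sc t' q k" "ldst t T ph \<noteq> Ini"
  "F t' r \<noteq> ldst t T ph" "Tr t' r \<noteq> ldst t T ph" "Sc t' q k \<noteq> ldst t T ph"
  by (simp_all add: ldst_def)

section \<open>Ports of the footprint and situations of a team\<close>

locale graph =
  fixes n :: nat and deg :: "nat \<Rightarrow> nat" and port :: "nat \<Rightarrow> nat \<Rightarrow> nat" and bh :: nat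
  assumes pg: "port_graph n deg port" and bhn: "bh < n"
begin

lemma port_lt: "v < n \<Longrightarrow> p < deg v \<Longrightarrow> port v p < n"
  and port_ne: "v < n \<Longrightarrow> p < deg v \<Longrightarrow> port v p \<noteq> v"
  and port_inj: "v < n \<Longrightarrow> p < deg v \<Longrightarrow> q < deg v \<Longrightarrow> port v p = port v q \<Longrightarrow> p = q"
  using pg by (auto simp: port_graph_def dest: inj_onD)

abbreviation rp :: "nat \<Rightarrow> nat \<Rightarrow> nat" where "rp \<equiv> rport deg port"

lemma rp: assumes "v < n" "p < deg v"
  shows "rp v p < deg (port v p)" "port (port v p) (rp v p) = v"
proof -
  obtain q where q: "q < deg (port v p)" "port (port v p) q = v"
    using pg assms unfolding port_graph_def by blast
  have "rp v p < deg (port v p) \<and> port (port v p) (rp v p) = v" unfolding rport_def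
    by (rule theI[of _ q]) (use q port_inj[OF port_lt[OF assms]] in auto)
  then show "rp v p < deg (port v p)" "port (port v p) (rp v p) = v" by auto
qed

lemma rp_eq: assumes "v < n" "p < deg v" "q < deg (port v p)" "port (port v p) q = v"
  shows "rp v p = q"
  using port_inj[OF port_lt[OF assms(1,2)] rp(1)[OF assms(1,2)] assms(3)] rp(2)[OF assms(1,2)] assms(4) by simp

lemma rp_rp: assumes "v < n" "p < deg v" shows "rp (port v p) (rp v p) = p"
proof -
  have "rp (port v p) (rp v p) < deg v" "port v (rp (port v p) (rp v p)) = port v p"
    using rp[OF port_lt[OF assms] rp(1)[OF assms]] rp(2)[OF assms] by auto
  then show ?thesis using port_inj[OF assms(1)] assms(2) by blast
qed

definition tw :: "team \<Rightarrow> nat" where "tw T = port (tu T) (tp T)"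
definition tr :: "team \<Rightarrow> nat" where "tr T = rp (tu T) (tp T)"
definition lpos :: "team \<Rightarrow> nat" where "lpos T = (if tph T = Crs then tw T else tu T)"

fun lphs :: "tph \<Rightarrow> bool \<Rightarrow> phase" where
  "lphs Ord x = PO" | "lphs Snt x = PO" | "lphs Tst x = PU" | "lphs Rev x = PU" | "lphs Ded x = PU"
| "lphs Cmp x = (if x then PS else PU)" | "lphs Saf x = PS" | "lphs Blk x = PD" | "lphs Crs x = PD"

definition geo :: "team \<Rightarrow> bool" where
  "geo T \<longleftrightarrow> tu T < n \<and> tu T \<noteq> bh \<and> tp T < deg (tu T) \<and> ta T < 6 \<and> tb T < 6 \<and> tl T < 6"

text \<open>\<open>Snt\<close> and \<open>Tst\<close> cover a destroyed as well as a living scout: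
  the leader cannot tell them apart, only this description from outside can.\<close>

definition teamrel :: "cfg \<Rightarrow> bool \<Rightarrow> team \<Rightarrow> bool" where
  "teamrel c t T \<longleftrightarrow>
    loc c (tl T) (lpos T) (ldst t T (lphs (tph T) (tx T))) \<and>
    (case tph T of
      Ord \<Rightarrow> loc c (tb T) (tu T) (F t True) \<and>
        (if tx T then loc c (ta T) (tu T) (Tr t False) \<and> fld c (ta T) else loc c (ta T) (tu T) (F t False))
    | Snt \<Rightarrow> loc c (tb T) (tu T) (F t True) \<and>
        (if tw T = bh then \<not> alv c (ta T)
         else loc c (ta T) (tw T) (Tr t False) \<and> ent c (ta T) = Some (tr T) \<and> \<not> fld c (ta T))
    | Tst \<Rightarrow> (if tx T then loc c (tb T) (tu T) (Tr t True) \<and> fld c (tb T) else loc c (tb T) (tu T) (F t True)) \<and>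
        (if tw T = bh then \<not> alv c (ta T) else loc c (ta T) (tw T) (Sc t (tr T) (ttok T)))
    | Rev \<Rightarrow> tw T \<noteq> bh \<and> loc c (ta T) (tu T) (Sc t (tr T) (ttok T)) \<and>
        loc c (tb T) (tw T) (Tr t True) \<and> ent c (tb T) = Some (tr T) \<and> \<not> fld c (tb T)
    | Ded \<Rightarrow> tw T = bh \<and> \<not> alv c (ta T) \<and> \<not> alv c (tb T)
    | Cmp \<Rightarrow> tw T \<noteq> bh \<and> loc c (tb T) (tu T) (F t True) \<and> loc c (ta T) (tu T) (Sc t (tq T) (ttok T))
    | Saf \<Rightarrow> tw T \<noteq> bh \<and> loc c (tb T) (tu T) (F t True) \<and> loc c (ta T) (tw T) (Sc t (tr T) (ttok T))
    | Blk \<Rightarrow> tw T \<noteq> bh \<and> loc c (ta T) (tu T) (F t False) \<and> fld c (ta T) \<and> loc c (tb T) (tu T) (F t True) \<and> fld c (tb T)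
        \<and> fld c (tl T)
    | Crs \<Rightarrow> tw T \<noteq> bh \<and> loc c (ta T) (tw T) (F t False) \<and> \<not> fld c (ta T) \<and> loc c (tb T) (tw T) (F t True) \<and> \<not> fld c (tb T)
        \<and> \<not> fld c (tl T) \<and> ent c (tl T) = Some (tr T))"

definition TSm :: "bool \<Rightarrow> team \<Rightarrow> nat \<Rightarrow> lst set" where
  "TSm t T v = (case tph T of
      Ord \<Rightarrow> if v = tu T then {F t True, if tx T then Tr t False else F t False} else {}
    | Snt \<Rightarrow> if v = tu T then {F t True} else if v = tw T \<and> v \<noteq> bh then {Tr t False} else {}
    | Tst \<Rightarrow> if v = tu T then {if tx T then Tr t True else F t True}
            else if v = tw T \<and> v \<noteq> bh then {Sc t (tr T) (ttok T)} else {}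
    | Rev \<Rightarrow> if v = tu T then {Sc t (tr T) (ttok T)} else if v = tw T then {Tr t True} else {}
    | Ded \<Rightarrow> {}
    | Cmp \<Rightarrow> if v = tu T then {F t True, Sc t (tq T) (ttok T)} else {}
    | Saf \<Rightarrow> if v = tu T then {F t True} else if v = tw T then {Sc t (tr T) (ttok T)} else {}
    | Blk \<Rightarrow> if v = tu T then {F t True, F t False} else {}
    | Crs \<Rightarrow> if v = tw T then {F t True, F t False} else {})"
definition TS :: "bool \<Rightarrow> team \<Rightarrow> nat \<Rightarrow> lst set" where
  "TS t T v = (if v = lpos T then {ldst t T (lphs (tph T) (tx T))} else {}) \<union> TSm t T v"

lemma geo_uw: "geo T \<Longrightarrow> tu T \<noteq> tw T" "geo T \<Longrightarrow> tw T \<noteq> tu T"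
  using port_ne[of "tu T" "tp T"] by (auto simp: geo_def tw_def)

lemma TSm_notL: "s \<in> TSm t T v \<Longrightarrow> \<not> is_L s"
  by (cases "tph T") (auto simp: TSm_def split: if_splits)

lemma tmof_TS: "s \<in> TS t T v \<Longrightarrow> tmof s = t"
  by (cases "tph T") (auto simp: TS_def TSm_def split: if_splits)

lemma loc_iff: "loc c i v s \<Longrightarrow> loc c i v' s' \<longleftrightarrow> v' = v \<and> s' = s"
  by (auto simp: loc_def enc_inj)
lemma loc_alv: "\<not> alv c i \<Longrightarrow> \<not> loc c i v s"
  by (auto simp: loc_def)

lemma TS_eq:
  assumes "teamrel c t T" "geo T"
  shows "{s. loc c (ta T) v s \<or> loc c (tb T) v s \<or> loc c (tl T) v s} = TS t T v"
proof -
  have l: "loc c (tl T) v s \<longleftrightarrow> v = lpos T \<and> s = ldst t T (lphs (tph T) (tx T))" for s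
    using loc_iff[of c "tl T" "lpos T" "ldst t T (lphs (tph T) (tx T))"] assms by (simp add: teamrel_def)
  have rest: "loc c (ta T) v s \<or> loc c (tb T) v s \<longleftrightarrow> s \<in> TSm t T v" for s
  proof (cases "tph T")
    case Ord
    then have 1: "loc c (tb T) (tu T) (F t True)" and 2: "loc c (ta T) (tu T) (if tx T then Tr t False else F t False)"
      using assms by (auto simp: teamrel_def)
    show ?thesis using geo_uw[OF assms(2)] by (auto simp: Ord loc_iff[OF 1] loc_iff[OF 2] TSm_def)
  next
    case Cmp
    then have 1: "loc c (tb T) (tu T) (F t True)" and 2: "loc c (ta T) (tu T) (Sc t (tq T) (ttok T))"
      using assms by (auto simp: teamrel_def)
    show ?thesis using geo_uw[OF assms(2)] by (auto simp: Cmp loc_iff[OF 1] loc_iff[OF 2] TSm_def)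
  next
    case Saf
    then have 1: "loc c (tb T) (tu T) (F t True)" and 2: "loc c (ta T) (tw T) (Sc t (tr T) (ttok T))"
      using assms by (auto simp: teamrel_def)
    show ?thesis using geo_uw[OF assms(2)] by (auto simp: Saf loc_iff[OF 1] loc_iff[OF 2] TSm_def)
  next
    case Rev
    then have 1: "loc c (tb T) (tw T) (Tr t True)" and 2: "loc c (ta T) (tu T) (Sc t (tr T) (ttok T))"
      using assms by (auto simp: teamrel_def)
    show ?thesis using geo_uw[OF assms(2)] by (auto simp: Rev loc_iff[OF 1] loc_iff[OF 2] TSm_def)
  next
    case Blk
    then have 1: "loc c (tb T) (tu T) (F t True)" and 2: "loc c (ta T) (tu T) (F t False)"
      using assms by (auto simp: teamrel_def)
    show ?thesis using geo_uw[OF assms(2)] by (auto simp: Blk loc_iff[OF 1] loc_iff[OF 2] TSm_def)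
  next
    case Crs
    then have 1: "loc c (tb T) (tw T) (F t True)" and 2: "loc c (ta T) (tw T) (F t False)"
      using assms by (auto simp: teamrel_def)
    show ?thesis using geo_uw[OF assms(2)] by (auto simp: Crs loc_iff[OF 1] loc_iff[OF 2] TSm_def)
  next
    case Ded
    then have 1: "\<not> alv c (ta T)" "\<not> alv c (tb T)" using assms by (auto simp: teamrel_def)
    then show ?thesis by (auto simp: Ded loc_alv TSm_def)
  next
    case Snt
    then have 1: "loc c (tb T) (tu T) (F t True)" using assms by (auto simp: teamrel_def)
    show ?thesis
    proof (cases "tw T = bh")
      case True
      then have 2: "\<not> alv c (ta T)" using Snt assms by (auto simp: teamrel_def)
      show ?thesis using geo_uw[OF assms(2)] True by (auto simp: Snt loc_iff[OF 1] loc_alv[OF 2] TSm_def)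
    next
      case False
      then have 2: "loc c (ta T) (tw T) (Tr t False)" using Snt assms by (auto simp: teamrel_def)
      show ?thesis using geo_uw[OF assms(2)] False by (auto simp: Snt loc_iff[OF 1] loc_iff[OF 2] TSm_def)
    qed
  next
    case Tst
    then have 1: "loc c (tb T) (tu T) (if tx T then Tr t True else F t True)" using assms by (auto simp: teamrel_def)
    show ?thesis
    proof (cases "tw T = bh")
      case True
      then have 2: "\<not> alv c (ta T)" using Tst assms by (auto simp: teamrel_def)
      show ?thesis using geo_uw[OF assms(2)] True by (auto simp: Tst loc_iff[OF 1] loc_alv[OF 2] TSm_def)
    next
      case False
      then have 2: "loc c (ta T) (tw T) (Sc t (tr T) (ttok T))" using Tst assms by (auto simp: teamrel_def)
      show ?thesis using geo_uw[OF assms(2)] False by (auto simp: Tst loc_iff[OF 1] loc_iff[OF 2] TSm_def)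
    qed
  qed
  show ?thesis using l rest unfolding TS_def by auto
qed

definition own :: "cfg \<Rightarrow> bool \<Rightarrow> team \<Rightarrow> bool" where
  "own c t T \<longleftrightarrow> (\<forall>v s. s \<in> vw c v \<and> tmof s = t \<longleftrightarrow> s \<in> TS t T v)"

text \<open>The two teams comprise all six agents and every state names its team, so what a node
  shows of one team depends on that team alone. This allows each team to be analysed separately, the
  other one entering only through a few flags.\<close>

lemma ownI:
  assumes "teamrel c t T" "teamrel c (\<not> t) T'" "geo T" "geo T'"
    "{ta T, tb T, tl T, ta T', tb T', tl T'} = {..<6}"
  shows "own c t T" "own c (\<not> t) T'"
proof -
  have "vw c v = TS t T v \<union> TS (\<not> t) T' v" for v
  proof -
    have "vw c v = {s. \<exists>i\<in>{ta T, tb T, tl T, ta T', tb T', tl T'}. loc c i v s}"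
      unfolding assms(5) by (auto simp: vw_def)
    then show ?thesis using TS_eq[OF assms(1,3), of v] TS_eq[OF assms(2,4), of v] by blast
  qed
  then show "own c t T" "own c (\<not> t) T'" unfolding own_def using tmof_TS by auto
qed

context
  fixes c t T assumes own: "own c t T" and geo: "geo T"
begin

lemma own_in: "tmof s = t \<Longrightarrow> s \<in> vw c v \<longleftrightarrow> s \<in> TS t T v"
  using own by (auto simp: own_def)

lemma own_L_iff: "s \<in> vw c v \<and> is_L s \<and> tm s = t \<longleftrightarrow> v = lpos T \<and> s = ldst t T (lphs (tph T) (tx T))"
proof -
  have "is_L s \<and> tm s = t \<Longrightarrow> tmof s = t" by (cases s) auto
  then have "s \<in> vw c v \<and> is_L s \<and> tm s = t \<longleftrightarrow> s \<in> TS t T v \<and> is_L s \<and> tm s = t"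
    using own_in by blast
  also have "\<dots> \<longleftrightarrow> v = lpos T \<and> s = ldst t T (lphs (tph T) (tx T))"
    using TSm_notL by (auto simp: TS_def)
  finally show ?thesis .
qed

lemma own_L: "hasL (vw c v) t \<longleftrightarrow> v = lpos T"
  unfolding hasL_def Bex_def using own_L_iff by auto

lemma own_ldr: "ldr (vw c (lpos T)) t = ldst t T (lphs (tph T) (tx T))"
  unfolding ldr_def own_L_iff by auto

lemma own_m: "tmof s = t \<Longrightarrow> \<not> is_L s \<Longrightarrow> s \<in> vw c v \<longleftrightarrow> s \<in> TSm t T v"
  by (auto simp: own_in TS_def)

lemma own_A: "hasA (vw c v) t \<longleftrightarrow> tph T \<in> {Ord, Blk} \<and> v = tu T \<or> tph T = Snt \<and> v = tw T \<and> v \<noteq> bh \<or> tph T = Crs \<and> v = tw T"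
  using geo_uw[OF geo] by (cases "tph T") (auto simp: hasA_def own_m TSm_def)

lemma own_B: "hasB (vw c v) t \<longleftrightarrow> tph T \<in> {Ord, Snt, Tst, Cmp, Saf, Blk} \<and> v = tu T \<or> tph T \<in> {Rev, Crs} \<and> v = tw T"
  using geo_uw[OF geo] by (cases "tph T") (auto simp: hasB_def own_m TSm_def)

lemma own_Sc: "Sc t p' k \<in> vw c v \<longleftrightarrow> k = ttok T \<and>
   (tph T = Tst \<and> v = tw T \<and> v \<noteq> bh \<and> p' = tr T \<or> tph T = Saf \<and> v = tw T \<and> p' = tr T \<or>
    tph T = Rev \<and> v = tu T \<and> p' = tr T \<or> tph T = Cmp \<and> v = tu T \<and> p' = tq T)"
  using geo_uw[OF geo] by (cases "tph T") (auto simp: own_m TSm_def)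

lemma own_S: "hasS (vw c v) t \<longleftrightarrow> tph T \<in> {Rev, Cmp} \<and> v = tu T \<or> tph T = Tst \<and> v = tw T \<and> v \<noteq> bh \<or> tph T = Saf \<and> v = tw T"
  unfolding hasS_def own_Sc by auto

lemma own_tok: "hasS (vw c v) t \<Longrightarrow> tokof (vw c v) t = ttok T"
  unfolding hasS_def tokof_def own_Sc by blast

lemma own_Tr: "Tr t r \<in> vw c v \<longleftrightarrow> tph T = Ord \<and> tx T \<and> v = tu T \<and> \<not> r \<or> tph T = Snt \<and> v = tw T \<and> v \<noteq> bh \<and> \<not> r \<or>
   tph T = Tst \<and> tx T \<and> v = tu T \<and> r \<or> tph T = Rev \<and> v = tw T \<and> r"
  using geo_uw[OF geo] by (cases "tph T") (auto simp: own_m TSm_def)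

end

text \<open>The influence of the other team: the teams swap roles (\<open>xsw\<close>), a port is skipped (\<open>ysk\<close>), a waiting
leader or a stranded scout takes over the order of the global search (\<open>got\<close>, \<open>gtk\<close>), a scout joins
the other team because the two scouts crossed the same edge simultaneously (\<open>exch\<close>).\<close>
definition xsw :: "cfg \<Rightarrow> bool \<Rightarrow> team \<Rightarrow> bool" where
  "xsw c t T \<longleftrightarrow> sw1 (vw c (tu T)) t \<or> sw2 (vw c (tu T)) t"
definition ysk :: "cfg \<Rightarrow> bool \<Rightarrow> team \<Rightarrow> bool" where
  "ysk c t T \<longleftrightarrow> skp (vw c (tu T)) t"
definition got :: "cfg \<Rightarrow> bool \<Rightarrow> team \<Rightarrow> bool option" where
  "got c t T = (if sw1 (vw c (tu T)) (\<not> t) then Some (lm (ldr (vw c (tu T)) (\<not> t))) else None)"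
definition gtk :: "cfg \<Rightarrow> bool \<Rightarrow> team \<Rightarrow> bool option" where
  "gtk c t T = (if sw2 (vw c (tw T)) (\<not> t) \<and> lp (ldr (vw c (tw T)) (\<not> t)) = tr T
                then Some (lm (ldr (vw c (tw T)) (\<not> t))) else None)"
definition exch :: "cfg \<Rightarrow> bool \<Rightarrow> team \<Rightarrow> bool" where
  "exch c t T \<longleftrightarrow> hasL (vw c (tw T)) (\<not> t) \<and> lph (ldr (vw c (tw T)) (\<not> t)) = PO \<and>
     lp (ldr (vw c (tw T)) (\<not> t)) = tr T \<and> \<not> hasA (vw c (tw T)) (\<not> t)"

definition tick :: "team \<Rightarrow> team" where "tick T = T\<lparr>tck := Suc (tck T)\<rparr>"
definition absorb :: "bool option \<Rightarrow> team \<Rightarrow> team" where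
  "absorb g T = (case g of None \<Rightarrow> T | Some m \<Rightarrow> T\<lparr>tk := True, tmd := m\<rparr>)"
definition tabsorb :: "bool option \<Rightarrow> team \<Rightarrow> team" where
  "tabsorb g T = (case g of None \<Rightarrow> T | Some m \<Rightarrow> T\<lparr>ttok := Some m\<rparr>)"

section \<open>Planned actions in every situation of a team\<close>

context
  fixes c t T
  assumes rel: "teamrel c t T" and own: "own c t T" and geo: "geo T"
begin

lemmas ownD = own_L[OF own geo] own_ldr[OF own geo] own_A[OF own geo] own_B[OF own geo] own_S[OF own geo]
  own_Tr[OF own geo]

lemma ldr_at: "v = lpos T \<Longrightarrow> ldr (vw c v) t = ldst t T (lphs (tph T) (tx T))"
  using own_ldr[OF own geo] by simp

lemma plan_Ord:
  assumes "tph T = Ord"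
  shows "plc c (tl T) = (if tk T then (if xsw c t T then Th False Restart else Do (ldst t (tick T) PO) Stay)
       else if tx T \<or> ysk c t T then Th False (if tmd T then SkipF else Restart) else Do (ldst t (tick T) PO) Stay)" (is ?l)
    "plc c (ta T) = (if (if tk T then xsw c t T else tx T \<or> ysk c t T) then Do (F t False) Stay else Do (Tr t False) (Move (tp T)))" (is ?x)
    "plc c (tb T) = Do (F t True) Stay"
proof -
  have l: "loc c (tl T) (tu T) (ldst t T PO)" "loc c (tb T) (tu T) (F t True)"
     "loc c (ta T) (tu T) (if tx T then Tr t False else F t False)" "tx T \<longrightarrow> fld c (ta T)"
    using rel assms by (auto simp: teamrel_def lpos_def)
  have r: "ldr (vw c (tu T)) t = ldst t T PO" using ldr_at[of "tu T"] assms by (simp add: lpos_def)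
  show ?l
    using assms unfolding plc_eq[OF l(1)] by (simp add: ldst_def tick_def ownD xsw_def ysk_def)
  show ?x
    using assms l(4) unfolding plc_eq[OF l(3)] by (auto simp: planF_def r Let_def xsw_def ysk_def)
  show "plc c (tb T) = Do (F t True) Stay"
    unfolding plc_eq[OF l(2)] by (simp add: planF_def r)
qed

lemma plan_Snt:
  assumes "tph T = Snt"
  shows "plc c (tl T) = Do (ldst t (absorb (got c t T) (tick T)) PU) Stay" (is ?l)
    "plc c (tb T) = Do (F t True) Stay"
    "tw T \<noteq> bh \<Longrightarrow> plc c (ta T) = (if exch c t T then Do (Sc (\<not> t) (tr T) None) Stay else Do (Sc t (tr T) None) (Move (tr T)))" (is "_ \<Longrightarrow> ?y")
proof -
  have l: "loc c (tl T) (tu T) (ldst t T PO)" "loc c (tb T) (tu T) (F t True)"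
     "tw T \<noteq> bh \<Longrightarrow> loc c (ta T) (tw T) (Tr t False) \<and> ent c (ta T) = Some (tr T) \<and> \<not> fld c (ta T)"
    using rel assms by (auto simp: teamrel_def lpos_def)
  have r: "ldr (vw c (tu T)) t = ldst t T PO" using ldr_at[of "tu T"] assms by (simp add: lpos_def)
  show ?l
    using assms geo_uw[OF geo] unfolding plc_eq[OF l(1)] by (auto simp: ldst_def tick_def absorb_def ownD got_def)
  show "plc c (tb T) = Do (F t True) Stay"
    unfolding plc_eq[OF l(2)] by (simp add: planF_def r)
  assume w: "tw T \<noteq> bh"
  have l3: "loc c (ta T) (tw T) (Tr t False)" using l(3)[OF w] by simp
  show ?y
    using l(3)[OF w] unfolding plc_eq[OF l3] by (simp add: planT_def exch_def)
qed

lemma plan_Tst: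
  assumes "tph T = Tst"
  shows "plc c (tl T) = Do (ldst t (absorb (got c t T) (tick T)) PU) Stay" (is ?l)
    "plc c (tb T) = Do (Tr t True) (Move (tp T))"
    "tw T \<noteq> bh \<Longrightarrow> plc c (ta T) = Do (Sc t (tr T) (ttok (tabsorb (gtk c t T) T))) (Move (tr T))" (is "_ \<Longrightarrow> ?y")
proof -
  have l: "loc c (tl T) (tu T) (ldst t T PU)" "loc c (tb T) (tu T) (if tx T then Tr t True else F t True)"
     "tx T \<longrightarrow> fld c (tb T)"
     "tw T \<noteq> bh \<Longrightarrow> loc c (ta T) (tw T) (Sc t (tr T) (ttok T))"
    using rel assms by (auto simp: teamrel_def lpos_def)
  have r: "ldr (vw c (tu T)) t = ldst t T PU" using ldr_at[of "tu T"] assms by (simp add: lpos_def)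
  show ?l
    using assms geo_uw[OF geo] unfolding plc_eq[OF l(1)] by (auto simp: ldst_def tick_def absorb_def ownD got_def)
  show "plc c (tb T) = Do (Tr t True) (Move (tp T))"
    using l(3) assms geo_uw[OF geo] unfolding plc_eq[OF l(2)] by (auto simp: planF_def r ownD)
  assume w: "tw T \<noteq> bh"
  show ?y
    using assms geo_uw[OF geo] unfolding plc_eq[OF l(4)[OF w]] by (auto simp: planS_def ownD lpos_def gtk_def tabsorb_def)
qed

lemma plan_Rev:
  assumes "tph T = Rev"
  shows "plc c (tl T) = (case ttok T of None \<Rightarrow> Do (ldst t (tick T) PS) Stay
      | Some m \<Rightarrow> Do (ldst t (tick (T\<lparr>tk := True, tmd := m, tarr := True\<rparr>)) PS) Stay)" (is ?l)
    "plc c (ta T) = Do (F t True) Stay"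
    "plc c (tb T) = (if exch c t T then Do (Sc (\<not> t) (tr T) None) Stay else Do (Sc t (tr T) None) (Move (tr T)))" (is ?y)
proof -
  have l: "loc c (tl T) (tu T) (ldst t T PU)" "loc c (ta T) (tu T) (Sc t (tr T) (ttok T))"
     "loc c (tb T) (tw T) (Tr t True)" "ent c (tb T) = Some (tr T)" "\<not> fld c (tb T)"
    using rel assms by (auto simp: teamrel_def lpos_def)
  have r: "ldr (vw c (tu T)) t = ldst t T PU" using ldr_at[of "tu T"] assms by (simp add: lpos_def)
  have tk: "tokof (vw c (tu T)) t = ttok T" using own_tok[OF own geo, of "tu T"] assms by (simp add: ownD)
  show ?l
    using assms geo_uw[OF geo] unfolding plc_eq[OF l(1)] by (auto simp: ldst_def tick_def ownD tk split: option.splits)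
  show "plc c (ta T) = Do (F t True) Stay"
    using assms geo_uw[OF geo] unfolding plc_eq[OF l(2)] by (auto simp: planS_def r ownD lpos_def)
  show ?y
    using l(4,5) unfolding plc_eq[OF l(3)] by (simp add: planT_def exch_def)
qed

lemma plan_Ded:
  assumes "tph T = Ded"
  shows "plc c (tl T) = Do (ldst t (tick T) PU) (Halt (tp T))"
proof -
  have l: "loc c (tl T) (tu T) (ldst t T PU)" using rel assms by (auto simp: teamrel_def lpos_def)
  show ?thesis using assms unfolding plc_eq[OF l(1)] by (auto simp: ldst_def tick_def ownD)
qed

lemma plan_Cmp:
  assumes "tph T = Cmp"
  shows "plc c (tl T) = (if tarr T then Th (tk T) (Arr (tp T) (tmd T)) else case ttok T of Some m \<Rightarrow> Th True (Arr (tp T) m)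
      | None \<Rightarrow> Do (ldst t (tick T) PD) (Move (tp T)))" (is ?l)
    "plc c (ta T) = (if tarr T \<or> ttok T \<noteq> None then Do (F t False) Stay else Do (F t False) (Move (tp T)))" (is ?x)
    "plc c (tb T) = (if tarr T \<or> ttok T \<noteq> None then Do (F t True) Stay else Do (F t True) (Move (tp T)))" (is ?y)
proof -
  have l: "loc c (tl T) (tu T) (ldst t T (if tx T then PS else PU))" "loc c (ta T) (tu T) (Sc t (tq T) (ttok T))"
     "loc c (tb T) (tu T) (F t True)"
    using rel assms by (auto simp: teamrel_def lpos_def)
  have r: "ldr (vw c (tu T)) t = ldst t T (if tx T then PS else PU)" using ldr_at[of "tu T"] assms by (simp add: lpos_def)
  have tk: "tokof (vw c (tu T)) t = ttok T" using own_tok[OF own geo, of "tu T"] assms by (simp add: ownD)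
  show ?l
    using assms geo_uw[OF geo] unfolding plc_eq[OF l(1)] by (auto simp: ldst_def tick_def ownD tk Let_def split: option.splits)
  show ?x
    using assms geo_uw[OF geo] unfolding plc_eq[OF l(2)] by (auto simp: planS_def r ownD lpos_def)
  show ?y
    using assms geo_uw[OF geo] unfolding plc_eq[OF l(3)] by (auto simp: planF_def r ownD tk)
qed

lemma plan_Saf:
  assumes "tph T = Saf"
  shows "plc c (tl T) = Do (ldst t (absorb (got c t T) (tick T)) PS) Stay" (is ?l)
    "plc c (tb T) = Do (F t True) Stay"
    "plc c (ta T) = Do (Sc t (tr T) (ttok (tabsorb (gtk c t T) T))) (Move (tr T))" (is ?y)
proof -
  have l: "loc c (tl T) (tu T) (ldst t T PS)" "loc c (tb T) (tu T) (F t True)"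
     "loc c (ta T) (tw T) (Sc t (tr T) (ttok T))"
    using rel assms by (auto simp: teamrel_def lpos_def)
  have r: "ldr (vw c (tu T)) t = ldst t T PS" using ldr_at[of "tu T"] assms by (simp add: lpos_def)
  show ?l
    using assms geo_uw[OF geo] unfolding plc_eq[OF l(1)] by (auto simp: ldst_def tick_def absorb_def ownD got_def)
  show "plc c (tb T) = Do (F t True) Stay"
    using assms geo_uw[OF geo] unfolding plc_eq[OF l(2)] by (auto simp: planF_def r ownD)
  show ?y
    using assms geo_uw[OF geo] unfolding plc_eq[OF l(3)] by (auto simp: planS_def ownD lpos_def gtk_def tabsorb_def)
qed

lemma plan_Blk:
  assumes "tph T = Blk"
  shows "plc c (tl T) = (if tk T then Do (ldst t (tick T) PD) (Move (tp T)) else Th False Restart)" (is ?l)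
    "plc c (ta T) = (if tk T then Do (F t False) (Move (tp T)) else Do (F t False) Stay)" (is ?x)
    "plc c (tb T) = (if tk T then Do (F t True) (Move (tp T)) else Do (F t True) Stay)" (is ?y)
proof -
  have l: "loc c (tl T) (tu T) (ldst t T PD)" "loc c (ta T) (tu T) (F t False)"
     "loc c (tb T) (tu T) (F t True)" "fld c (tl T)" "fld c (ta T)" "fld c (tb T)"
    using rel assms by (auto simp: teamrel_def lpos_def)
  have r: "ldr (vw c (tu T)) t = ldst t T PD" using ldr_at[of "tu T"] assms by (simp add: lpos_def)
  show ?l
    using l(4) unfolding plc_eq[OF l(1)] by (simp add: ldst_def tick_def)
  show ?x
    using l(5) unfolding plc_eq[OF l(2)] by (simp add: planF_def r)
  show ?y
    using l(6) unfolding plc_eq[OF l(3)] by (simp add: planF_def r)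
qed

lemma plan_Crs:
  assumes "tph T = Crs"
  shows "plc c (tl T) = Th (tk T) (Arr (tr T) (tmd T))"
    "plc c (ta T) = Do (F t False) Stay"
    "plc c (tb T) = Do (F t True) Stay"
proof -
  have l: "loc c (tl T) (tw T) (ldst t T PD)" "loc c (ta T) (tw T) (F t False)"
     "loc c (tb T) (tw T) (F t True)" "\<not> fld c (tl T)" "\<not> fld c (ta T)" "\<not> fld c (tb T)" "ent c (tl T) = Some (tr T)"
    using rel assms by (auto simp: teamrel_def lpos_def)
  have r: "ldr (vw c (tw T)) t = ldst t T PD" using ldr_at[of "tw T"] assms by (simp add: lpos_def)
  show "plc c (tl T) = Th (tk T) (Arr (tr T) (tmd T))"
    using l(4,7) unfolding plc_eq[OF l(1)] by (simp add: ldst_def tick_def)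
  show "plc c (ta T) = Do (F t False) Stay"
    using l(5) unfolding plc_eq[OF l(2)] by (simp add: planF_def r)
  show "plc c (tb T) = Do (F t True) Stay"
    using l(6) unfolding plc_eq[OF l(3)] by (simp add: planF_def r)
qed

end

end

definition reord :: "team \<Rightarrow> nat \<Rightarrow> bool \<Rightarrow> nat \<Rightarrow> bool \<Rightarrow> nat \<Rightarrow> team" where
  "reord T v k p b j = T\<lparr>tu := v, tp := p, tph := Ord, tx := False, tk := k, tmd := b, tarr := False,
     ttok := None, tck := Suc (tck T), tid := j\<rparr>"

context graph
begin

section \<open>The effect of one round on a team\<close>

context
  fixes c :: cfg and t :: bool and T :: team and ids :: "nat \<Rightarrow> nat" and M :: "nat set set"
  assumes run: "running c" and one: "one_writer c"
    and rel: "teamrel c t T" and own: "own c t T" and geo: "geo T"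
begin

abbreviation (input) "cn \<equiv> step bhs_alg deg port bh ids 6 M c"

lemma geoD: "ta T < 6" "tb T < 6" "tl T < 6" "tp T < deg (tu T)" "tr T < deg (tw T)" "port (tw T) (tr T) = tu T"
   "tu T \<noteq> bh" "port (tu T) (tp T) = tw T" "tu T < n" "tw T < n" "rp (tu T) (tp T) = tr T" "rp (tw T) (tr T) = tp T"
  using geo rp[of "tu T" "tp T"] port_lt[of "tu T" "tp T"] rp_rp[of "tu T" "tp T"]
  by (auto simp: geo_def tr_def tw_def)

definition pr :: bool where "pr \<longleftrightarrow> {tu T, tw T} \<notin> M"

lemma pr_sym: "{tw T, tu T} \<in> M \<longleftrightarrow> \<not> pr" "{tu T, tw T} \<in> M \<longleftrightarrow> \<not> pr"
  by (auto simp: pr_def insert_commute)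

lemmas mvs = move_step[where deg = deg and port = port and bh = bh and ids = ids and M = M, OF run one]
lemmas bls = block_step[where deg = deg and port = port and bh = bh and ids = ids and M = M, OF run one]
lemmas stay = stay_step[where deg = deg and port = port and bh = bh and ids = ids and M = M, OF run one]
lemmas thk = think_step[where deg = deg and port = port and bh = bh and ids = ids and M = M, OF run one]

lemma go: assumes "i < 6" "loc c i (tu T) s" "plc c i = Do s' (Move (tp T))"
  shows "pr \<Longrightarrow> tw T \<noteq> bh \<Longrightarrow> loc cn i (tw T) s'" "pr \<Longrightarrow> tw T = bh \<Longrightarrow> \<not> alv cn i"
    "pr \<Longrightarrow> ent cn i = Some (tr T)" "pr \<Longrightarrow> \<not> fld cn i"
    "\<not> pr \<Longrightarrow> loc cn i (tu T) s'" "\<not> pr \<Longrightarrow> fld cn i"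
  using mvs[OF assms] bls[OF assms] geoD pr_sym by auto

lemma bak: assumes "i < 6" "loc c i (tw T) s" "plc c i = Do s' (Move (tr T))"
  shows "pr \<Longrightarrow> loc cn i (tu T) s'" "\<not> pr \<Longrightarrow> loc cn i (tw T) s'"
  using mvs[OF assms] bls[OF assms] geoD pr_sym by auto

lemmas dead = dead_step[where deg = deg and port = port and bh = bh and ids = ids and M = M and c = c, OF run one]

lemma think_team:
  assumes "loc c (tl T) v (ldst t T ph)" "plc c (tl T) = Th k x"
    "loc c (ta T) v s1" "plc c (ta T) = Do (F t False) Stay"
    "loc c (tb T) v s2" "plc c (tb T) = Do (F t True) Stay"
    "think k x (mk c k v) (deg v) (tck T) (tid T) = (m, p, b, j)"
  shows "teamrel cn t (reord T v k p b j)" "mk cn k v = m"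
proof -
  have 1: "think k x (mk c k v) (deg v) (lclk (ldst t T ph)) (lid (ldst t T ph)) = (m, p, b, j)" using assms by simp
  note th = thk[OF geoD(3) assms(1,2) 1]
  show "mk cn k v = m" using th by simp
  show "teamrel cn t (reord T v k p b j)"
    using th stay[OF geoD(1) assms(3,4)] stay[OF geoD(2) assms(5,6)]
    by (simp add: teamrel_def reord_def lpos_def ldst_def)
qed

lemma step_Ord_try:
  assumes "tph T = Ord" "if tk T then \<not> xsw c t T else \<not> tx T \<and> \<not> ysk c t T"
  shows "teamrel cn t (if pr then (tick T)\<lparr>tph := Snt\<rparr> else (tick T)\<lparr>tx := True\<rparr>)" (is "teamrel _ _ ?T")
proof -
  have l: "loc c (tl T) (tu T) (ldst t T PO)" "loc c (tb T) (tu T) (F t True)"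
     "loc c (ta T) (tu T) (if tx T then Tr t False else F t False)"
    using rel assms by (auto simp: teamrel_def lpos_def)
  have p: "plc c (tl T) = Do (ldst t (tick T) PO) Stay" "plc c (ta T) = Do (Tr t False) (Move (tp T))"
    "plc c (tb T) = Do (F t True) Stay"
    using plan_Ord[OF rel own geo assms(1)] assms(2) by (auto split: if_splits)
  note g = go[OF geoD(1) l(3) p(2)] stay[OF geoD(2) l(2) p(3)] stay[OF geoD(3) l(1) p(1)]
  define T' where "T' = ?T"
  have s: "tu T' = tu T" "tp T' = tp T" "ta T' = ta T" "tb T' = tb T" "tl T' = tl T"
     "tw T' = tw T" "tr T' = tr T" "ldst t (tick T) PO = ldst t T' PO" "tph T' = (if pr then Snt else Ord)" "tx T' = (tx T \<or> \<not> pr)"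
    by (simp_all add: T'_def tw_def tr_def tick_def ldst_def assms(1))
  have "teamrel cn t T'" using g by (auto simp: teamrel_def lpos_def s)
  then show ?thesis by (simp add: T'_def)
qed

lemma step_Ord_think:
  assumes "tph T = Ord" "if tk T then xsw c t T else tx T \<or> ysk c t T"
    "think False (if tk T \<or> \<not> tmd T then Restart else SkipF) (mk c False (tu T)) (deg (tu T)) (tck T) (tid T) = (m, p, b, j)"
  shows "teamrel cn t (reord T (tu T) False p b j)" "mk cn False (tu T) = m"
    "plc c (tl T) = Th False (if tk T \<or> \<not> tmd T then Restart else SkipF)"
proof -
  have l: "loc c (tl T) (tu T) (ldst t T PO)" "loc c (tb T) (tu T) (F t True)"
     "loc c (ta T) (tu T) (if tx T then Tr t False else F t False)"
    using rel assms by (auto simp: teamrel_def lpos_def)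
  show p: "plc c (tl T) = Th False (if tk T \<or> \<not> tmd T then Restart else SkipF)"
    using plan_Ord[OF rel own geo assms(1)] assms(2) by (auto split: if_splits)
  have p2: "plc c (ta T) = Do (F t False) Stay" "plc c (tb T) = Do (F t True) Stay"
    using plan_Ord[OF rel own geo assms(1)] assms(2) by (auto split: if_splits)
  show "teamrel cn t (reord T (tu T) False p b j)" "mk cn False (tu T) = m"
    using think_team[OF l(1) p l(3) p2(1) l(2) p2(2) assms(3)] by auto
qed

lemma step_Snt:
  assumes "tph T = Snt" "tw T \<noteq> bh \<Longrightarrow> \<not> exch c t T"
  shows "teamrel cn t ((absorb (got c t T) (tick T))\<lparr>tph := (if tw T \<noteq> bh \<and> pr then Cmp else Tst), tx := False, ttok := None, tq := tr T\<rparr>)" (is "teamrel _ _ ?T")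
proof -
  have l: "loc c (tl T) (tu T) (ldst t T PO)" "loc c (tb T) (tu T) (F t True)"
    using rel assms by (auto simp: teamrel_def lpos_def)
  note p = plan_Snt[OF rel own geo assms(1)]
  note g = stay[OF geoD(2) l(2) p(2)] stay[OF geoD(3) l(1) p(1)]
  define T' where "T' = ?T"
  have s: "tu T' = tu T" "tp T' = tp T" "ta T' = ta T" "tb T' = tb T" "tl T' = tl T" "tq T' = tr T" "ttok T' = None" "\<not> tx T'"
     "tw T' = tw T" "tr T' = tr T" "ldst t (absorb (got c t T) (tick T)) PU = ldst t T' PU" "tph T' = (if tw T \<noteq> bh \<and> pr then Cmp else Tst)"
    by (simp_all add: T'_def tw_def tr_def absorb_def tick_def ldst_def split: option.split)
  have "teamrel cn t T'"
  proof (cases "tw T = bh")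
    case True
    then have "\<not> alv c (ta T)" using rel assms(1) by (auto simp: teamrel_def)
    then show ?thesis using g True dead by (auto simp: teamrel_def lpos_def s)
  next
    case False
    then have la: "loc c (ta T) (tw T) (Tr t False)" using rel assms(1) by (auto simp: teamrel_def)
    have pa: "plc c (ta T) = Do (Sc t (tr T) None) (Move (tr T))" using p(3)[OF False] assms(2)[OF False] by simp
    show ?thesis using g False bak[OF geoD(1) la pa] by (auto simp: teamrel_def lpos_def s)
  qed
  then show ?thesis by (simp add: T'_def)
qed

text \<open>No \<open>teamrel\<close> is concluded: the scout ends the round in a state of the other
  team, and only the two teams together are complete again.\<close>

lemma step_exch:
  assumes "tph T = Snt" "tw T \<noteq> bh" "exch c t T"
  shows "loc cn (tl T) (tu T) (ldst t (absorb (got c t T) (tick T)) PU)" "loc cn (tb T) (tu T) (F t True)"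
    "loc cn (ta T) (tw T) (Sc (\<not> t) (tr T) None)"
proof -
  have l: "loc c (tl T) (tu T) (ldst t T PO)" "loc c (tb T) (tu T) (F t True)" "loc c (ta T) (tw T) (Tr t False)"
    using rel assms by (auto simp: teamrel_def lpos_def)
  note p = plan_Snt[OF rel own geo assms(1)]
  have pa: "plc c (ta T) = Do (Sc (\<not> t) (tr T) None) Stay" using p(3) assms by simp
  show "loc cn (tl T) (tu T) (ldst t (absorb (got c t T) (tick T)) PU)" "loc cn (tb T) (tu T) (F t True)"
    "loc cn (ta T) (tw T) (Sc (\<not> t) (tr T) None)"
    using stay(1)[OF geoD(2) l(2) p(2)] stay(1)[OF geoD(3) l(1) p(1)]
      stay(1)[OF geoD(1) l(3) pa] by auto
qed

lemma step_Tst: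
  assumes "tph T = Tst"
  shows "teamrel cn t ((tabsorb (if tw T = bh then None else gtk c t T) (absorb (got c t T) (tick T)))
     \<lparr>tph := (if pr then (if tw T = bh then Ded else Rev) else Tst), tx := True\<rparr>)" (is "teamrel _ _ ?T")
proof -
  have l: "loc c (tl T) (tu T) (ldst t T PU)" "loc c (tb T) (tu T) (if tx T then Tr t True else F t True)"
    using rel assms by (auto simp: teamrel_def lpos_def)
  note p = plan_Tst[OF rel own geo assms(1)]
  note g = go[OF geoD(2) l(2) p(2)] stay[OF geoD(3) l(1) p(1)]
  define T' where "T' = ?T"
  have s: "tu T' = tu T" "tp T' = tp T" "ta T' = ta T" "tb T' = tb T" "tl T' = tl T" "tx T'"
     "tw T \<noteq> bh \<Longrightarrow> ttok T' = ttok (tabsorb (gtk c t T) T)"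
     "tw T' = tw T" "tr T' = tr T" "ldst t (absorb (got c t T) (tick T)) PU = ldst t T' PU"
     "tph T' = (if pr then (if tw T = bh then Ded else Rev) else Tst)"
    by (simp_all add: T'_def tw_def tr_def absorb_def tabsorb_def tick_def ldst_def split: option.split)
  have "teamrel cn t T'"
  proof (cases "tw T = bh")
    case True
    then have "\<not> alv c (ta T)" using rel assms(1) by (auto simp: teamrel_def)
    then show ?thesis using g True dead by (auto simp: teamrel_def lpos_def s)
  next
    case False
    then have la: "loc c (ta T) (tw T) (Sc t (tr T) (ttok T))" using rel assms(1) by (auto simp: teamrel_def)
    show ?thesis using g False bak[OF geoD(1) la p(3)[OF False]] by (auto simp: teamrel_def lpos_def s)
  qed
  then show ?thesis by (simp add: T'_def)
qed

text \<open>The second companion has taken the place of the scout, so \<open>ta\<close> and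
  \<open>tb\<close> are exchanged. An order delivered by the returned scout is taken over with
  \<open>tarr\<close> set, since its move ends at the node of the leader.\<close>

lemma step_Rev:
  assumes "tph T = Rev" "\<not> exch c t T"
  shows "teamrel cn t ((case ttok T of None \<Rightarrow> tick T | Some m \<Rightarrow> tick (T\<lparr>tk := True, tmd := m, tarr := True\<rparr>))
     \<lparr>tph := (if pr then Cmp else Saf), tx := True, ta := tb T, tb := ta T, ttok := None, tq := tr T\<rparr>)"
proof -
  have l: "loc c (tl T) (tu T) (ldst t T PU)" "loc c (ta T) (tu T) (Sc t (tr T) (ttok T))" "loc c (tb T) (tw T) (Tr t True)" "tw T \<noteq> bh"
    using rel assms by (auto simp: teamrel_def lpos_def)
  note p = plan_Rev[OF rel own geo assms(1)]
  have pb: "plc c (tb T) = Do (Sc t (tr T) None) (Move (tr T))" using p(3) assms(2) by simp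
  define T1 where "T1 = (case ttok T of None \<Rightarrow> tick T | Some m \<Rightarrow> tick (T\<lparr>tk := True, tmd := m, tarr := True\<rparr>))"
  have pl: "plc c (tl T) = Do (ldst t T1 PS) Stay" using p(1) by (simp add: T1_def split: option.split)
  define T' where "T' = T1\<lparr>tph := (if pr then Cmp else Saf), tx := True, ta := tb T, tb := ta T, ttok := None, tq := tr T\<rparr>"
  note g = bak[OF geoD(2) l(3) pb] stay[OF geoD(3) l(1) pl] stay[OF geoD(1) l(2) p(2)]
  have s: "tu T' = tu T" "tp T' = tp T" "ta T' = tb T" "tb T' = ta T" "tl T' = tl T" "tx T'" "ttok T' = None" "tq T' = tr T"
     "tw T' = tw T" "tr T' = tr T" "ldst t T1 PS = ldst t T' PS" "tph T' = (if pr then Cmp else Saf)"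
    by (simp_all add: T'_def T1_def tw_def tr_def tick_def ldst_def split: option.split)
  have "teamrel cn t T'" using g l(4) by (auto simp: teamrel_def lpos_def s)
  then show ?thesis by (simp add: T'_def T1_def)
qed

lemma step_go:
  assumes "tph T = Cmp \<and> \<not> tarr T \<and> ttok T = None \<or> tph T = Blk \<and> tk T"
  shows "teamrel cn t ((tick T)\<lparr>tph := (if pr then Crs else Blk)\<rparr>)" (is "teamrel _ _ ?T")
proof -
  obtain ph s1 where l: "loc c (tl T) (tu T) (ldst t T ph)" "loc c (ta T) (tu T) s1" "loc c (tb T) (tu T) (F t True)" "tw T \<noteq> bh"
    using rel assms by (auto simp: teamrel_def lpos_def)
  have p: "plc c (tl T) = Do (ldst t (tick T) PD) (Move (tp T))" "plc c (ta T) = Do (F t False) (Move (tp T))" "plc c (tb T) = Do (F t True) (Move (tp T))"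
    using plan_Cmp[OF rel own geo] plan_Blk[OF rel own geo] assms by auto
  define T' where "T' = ?T"
  note g = go[OF geoD(3) l(1) p(1)] go[OF geoD(1) l(2) p(2)] go[OF geoD(2) l(3) p(3)]
  have s: "tu T' = tu T" "tp T' = tp T" "ta T' = ta T" "tb T' = tb T" "tl T' = tl T"
     "tw T' = tw T" "tr T' = tr T" "ldst t (tick T) PD = ldst t T' PD" "tph T' = (if pr then Crs else Blk)"
    by (simp_all add: T'_def tw_def tr_def tick_def ldst_def)
  have "teamrel cn t T'" using g l(4) by (auto simp: teamrel_def lpos_def s)
  then show ?thesis by (simp add: T'_def)
qed

lemma step_Cmp_think:
  assumes "tph T = Cmp" "tarr T \<and> ttok T = None \<and> k = tk T \<and> b0 = tmd T \<or> \<not> tarr T \<and> ttok T = Some b0 \<and> k"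
    "think k (Arr (tp T) b0) (mk c k (tu T)) (deg (tu T)) (tck T) (tid T) = (m, p, b, j)"
  shows "teamrel cn t (reord T (tu T) k p b j)" "mk cn k (tu T) = m" "plc c (tl T) = Th k (Arr (tp T) b0)"
proof -
  have l: "loc c (tl T) (tu T) (ldst t T (if tx T then PS else PU))" "loc c (ta T) (tu T) (Sc t (tq T) (ttok T))"
     "loc c (tb T) (tu T) (F t True)"
    using rel assms by (auto simp: teamrel_def lpos_def)
  show p: "plc c (tl T) = Th k (Arr (tp T) b0)" using plan_Cmp(1)[OF rel own geo assms(1)] assms(2) by auto
  have p2: "plc c (ta T) = Do (F t False) Stay" "plc c (tb T) = Do (F t True) Stay"
    using plan_Cmp(2,3)[OF rel own geo assms(1)] assms(2) by auto
  show "teamrel cn t (reord T (tu T) k p b j)" "mk cn k (tu T) = m"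
    using think_team[OF l(1) p l(2) p2(1) l(3) p2(2) assms(3)] by auto
qed

lemma step_Saf:
  assumes "tph T = Saf"
  shows "teamrel cn t ((tabsorb (gtk c t T) (absorb (got c t T) (tick T)))
     \<lparr>tph := (if pr then Cmp else Saf), tx := True, tq := tr T\<rparr>)" (is "teamrel _ _ ?T")
proof -
  have l: "loc c (tl T) (tu T) (ldst t T PS)" "loc c (tb T) (tu T) (F t True)" "loc c (ta T) (tw T) (Sc t (tr T) (ttok T))" "tw T \<noteq> bh"
    using rel assms by (auto simp: teamrel_def lpos_def)
  note p = plan_Saf[OF rel own geo assms(1)]
  note g = stay[OF geoD(2) l(2) p(2)] stay[OF geoD(3) l(1) p(1)] bak[OF geoD(1) l(3) p(3)]
  define T' where "T' = ?T"
  have s: "tu T' = tu T" "tp T' = tp T" "ta T' = ta T" "tb T' = tb T" "tl T' = tl T" "tx T'" "tq T' = tr T"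
     "ttok T' = ttok (tabsorb (gtk c t T) T)"
     "tw T' = tw T" "tr T' = tr T" "ldst t (absorb (got c t T) (tick T)) PS = ldst t T' PS"
     "tph T' = (if pr then Cmp else Saf)"
    by (simp_all add: T'_def tw_def tr_def absorb_def tabsorb_def tick_def ldst_def split: option.split)
  have "teamrel cn t T'" using g l(4) by (auto simp: teamrel_def lpos_def s)
  then show ?thesis by (simp add: T'_def)
qed

lemma step_Blk_think:
  assumes "tph T = Blk" "\<not> tk T"
    "think False Restart (mk c False (tu T)) (deg (tu T)) (tck T) (tid T) = (m, p, b, j)"
  shows "teamrel cn t (reord T (tu T) False p b j)" "mk cn False (tu T) = m" "plc c (tl T) = Th False Restart"
proof -
  have l: "loc c (tl T) (tu T) (ldst t T PD)" "loc c (ta T) (tu T) (F t False)" "loc c (tb T) (tu T) (F t True)"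
    using rel assms by (auto simp: teamrel_def lpos_def)
  show p: "plc c (tl T) = Th False Restart" using plan_Blk(1)[OF rel own geo assms(1)] assms(2) by auto
  have p2: "plc c (ta T) = Do (F t False) Stay" "plc c (tb T) = Do (F t True) Stay"
    using plan_Blk(2,3)[OF rel own geo assms(1)] assms(2) by auto
  show "teamrel cn t (reord T (tu T) False p b j)" "mk cn False (tu T) = m"
    using think_team[OF l(1) p l(2) p2(1) l(3) p2(2) assms(3)] by auto
qed

lemma step_Crs:
  assumes "tph T = Crs"
    "think (tk T) (Arr (tr T) (tmd T)) (mk c (tk T) (tw T)) (deg (tw T)) (tck T) (tid T) = (m, p, b, j)"
  shows "teamrel cn t (reord T (tw T) (tk T) p b j)" "mk cn (tk T) (tw T) = m" "plc c (tl T) = Th (tk T) (Arr (tr T) (tmd T))"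
proof -
  have l: "loc c (tl T) (tw T) (ldst t T PD)" "loc c (ta T) (tw T) (F t False)" "loc c (tb T) (tw T) (F t True)"
    using rel assms by (auto simp: teamrel_def lpos_def)
  note p = plan_Crs[OF rel own geo assms(1)]
  show "plc c (tl T) = Th (tk T) (Arr (tr T) (tmd T))" by (rule p(1))
  show "teamrel cn t (reord T (tw T) (tk T) p b j)" "mk cn (tk T) (tw T) = m"
    using think_team[OF l(1) p(1) l(2) p(2) l(3) p(3) assms(2)] by auto
qed

end

end

section \<open>Depth-first search\<close>

context graph
begin

abbreviation "E \<equiv> edges n deg port"

definition vis :: "nat \<Rightarrow> (nat \<Rightarrow> mark) \<Rightarrow> nat \<Rightarrow> bool" where "vis idx g v \<longleftrightarrow> v < n \<and> fst (g v) = idx"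
definition par :: "(nat \<Rightarrow> mark) \<Rightarrow> nat \<Rightarrow> nat" where "par g v = fst (snd (g v))"
definition ptr :: "(nat \<Rightarrow> mark) \<Rightarrow> nat \<Rightarrow> nat" where "ptr g v = snd (snd (g v))"

text \<open>The list is the stack of the search, its head being the top.\<close>
fun chain :: "(nat \<Rightarrow> mark) \<Rightarrow> nat list \<Rightarrow> bool" where
  "chain g [] \<longleftrightarrow> False"
| "chain g [v] \<longleftrightarrow> par g v = 0"
| "chain g (v # y # r) \<longleftrightarrow> 0 < par g v \<and> par g v - 1 < deg v \<and> port v (par g v - 1) = y \<and>
     ptr g y < deg y \<and> port y (ptr g y) = v \<and> chain g (y # r)"

fun avoids :: "nat set \<Rightarrow> nat list \<Rightarrow> bool" where
  "avoids e (v # y # r) \<longleftrightarrow> {v, y} \<noteq> e \<and> avoids e (y # r)"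
| "avoids e _ \<longleftrightarrow> True"

text \<open>\<open>K\<close> collects the skipped ports and is empty for the global search. Nothing
  here says that the edges of \<open>K\<close> are missing now; the missing edge may have changed
  since the skip, and \<open>FR\<close> later expresses that it has not mattered.\<close>

definition dfs :: "nat \<Rightarrow> (nat \<Rightarrow> mark) \<Rightarrow> (nat \<times> nat) set \<Rightarrow> nat list \<Rightarrow> bool" where
  "dfs idx g K st \<longleftrightarrow> (\<forall>v. vis idx g v \<longrightarrow> v \<noteq> bh \<and> ptr g v \<le> deg v) \<and> distinct st \<and>
     (\<forall>v\<in>set st. vis idx g v) \<and> chain g st \<and> (\<forall>v. vis idx g v \<and> v \<notin> set st \<longrightarrow> ptr g v = deg v) \<and>
     (\<forall>v j. vis idx g v \<and> j < ptr g v \<longrightarrow> vis idx g (port v j) \<or> (v, j) \<in> K)"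

text \<open>Without \<open>m\<close>, the node \<open>x\<close> is either a finished node just taken
  off the stack or a known node reached over a further edge. In both cases the move returns to the
  top of the stack, whose pointer still leads to \<open>x\<close>.\<close>

definition ordr :: "nat \<Rightarrow> (nat \<Rightarrow> mark) \<Rightarrow> nat list \<Rightarrow> nat \<Rightarrow> nat \<Rightarrow> bool \<Rightarrow> bool" where
  "ordr idx g st x p m \<longleftrightarrow> vis idx g x \<and> p < deg x \<and>
     (if m then hd st = x \<and> p = ptr g x
      else hd st = port x p \<and> ptr g (hd st) < deg (hd st) \<and> port (hd st) (ptr g (hd st)) = x)"

definition base :: "nat \<Rightarrow> (nat \<Rightarrow> mark) \<Rightarrow> nat" where
  "base idx g = (\<Sum>v<n. if fst (g v) = idx then Suc (ptr g v) else 0)"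

text \<open>One step of a search takes fewer than 20 rounds in which the team makes progress.\<close>
definition rk :: "nat \<Rightarrow> (nat \<Rightarrow> mark) \<Rightarrow> bool \<Rightarrow> nat" where
  "rk idx g m = 40 * base idx g + (if m then 0 else 20)"

text \<open>The pointer of the top does not occur in the chain, so it may advance freely.\<close>

lemma chain_cong:
  assumes "chain g (v # r)" "par g' v = par g v" "\<And>u. u \<in> set r \<Longrightarrow> g' u = g u"
  shows "chain g' (v # r)"
  using assms
proof (induction r arbitrary: v)
  case (Cons y r)
  then show ?case by (auto simp: par_def ptr_def)
qed simp

lemma chain_ne: "chain g st \<Longrightarrow> st \<noteq> []" by (cases st) auto

lemma base_upd:
  assumes "y < n"
  shows "base idx (g(y := mk')) + (if fst (g y) = idx then Suc (ptr g y) else 0) =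
     base idx g + (if fst mk' = idx then Suc (snd (snd mk')) else 0)"
proof -
  let ?f = "\<lambda>g v. if fst (g v) = idx then Suc (ptr g v) else 0"
  have s: "sum (?f g) {..<n} = ?f g y + sum (?f g) ({..<n} - {y})" for g :: "nat \<Rightarrow> mark"
    using assms by (simp add: sum.remove)
  have "sum (?f (g(y := mk'))) ({..<n} - {y}) = sum (?f g) ({..<n} - {y})"
    by (rule sum.cong) (auto simp: ptr_def)
  then show ?thesis unfolding base_def s by (simp add: ptr_def)
qed

text \<open>The certificate of an exhausted search: a set of safe nodes that can be left only
  through ports in \<open>K\<close>. It contradicts connectivity once the edges of \<open>K\<close>
  are missing.\<close>

definition closed_in :: "(nat \<times> nat) set \<Rightarrow> nat \<Rightarrow> bool" where
  "closed_in K y \<longleftrightarrow> (\<exists>S. y \<in> S \<and> S \<subseteq> {..<n} - {bh} \<and> (\<forall>v\<in>S. \<forall>j<deg v. port v j \<in> S \<or> (v, j) \<in> K))"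

text \<open>With a full pointer and no parent the stack is the root alone, so all ports of all
  visited nodes have been tried and the visited nodes form a closed set. The clause on
  \<open>e\<close> holds because backtracking uses only tree edges of the old stack.\<close>

lemma nxt_spec:
  assumes d: "dfs idx g K (x # r)" and gx: "g x = (idx, pa, pt)"
    and nx: "nxt k (idx, pa, pt) (deg x) clk i = (mk', p', m', i')"
  shows "(\<exists>st'. i' = i \<and> mk' = g x \<and> dfs idx g K st' \<and> ordr idx g st' x p' m' \<and>
             (\<forall>e. avoids e (x # r) \<longrightarrow> avoids e st' \<and> (\<not> m' \<longrightarrow> {x, port x p'} \<noteq> e)))
    \<or> closed_in K x \<and> (mk', p', m', i') = (((if k then 1 else clk), 0, 0), 0, True, clk)"
proof -
  have vx: "vis idx g x" and pl: "pt \<le> deg x" and xn: "x < n" using d gx by (auto simp: dfs_def vis_def ptr_def)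
  consider "pt < deg x" | "\<not> pt < deg x" "0 < pa" | "\<not> pt < deg x" "pa = 0" by auto
  then show ?thesis
  proof cases
    case 1
    then have "mk' = g x" "p' = pt" "m'" "i' = i" using nx gx by auto
    then show ?thesis using d 1 gx vx by (intro disjI1 exI[of _ "x # r"]) (auto simp: ordr_def ptr_def)
  next
    case 2
    then have e: "mk' = g x" "p' = pa - 1" "\<not> m'" "i' = i" using nx gx by auto
    have "chain g (x # r)" using d by (simp add: dfs_def)
    then obtain y r' where r: "r = y # r'" using 2 gx by (cases r) (auto simp: par_def)
    have c: "pa - 1 < deg x" "port x (pa - 1) = y" "ptr g y < deg y" "port y (ptr g y) = x" "chain g r"
      using d gx by (auto simp: dfs_def r par_def)
    have px: "ptr g x = deg x" using pl 2 gx by (simp add: ptr_def)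
    have "dfs idx g K r" unfolding dfs_def
    proof (intro conjI)
      show "\<forall>v. vis idx g v \<and> v \<notin> set r \<longrightarrow> ptr g v = deg v"
        using d px unfolding dfs_def by (metis set_ConsD)
    qed (use d c in \<open>simp_all add: dfs_def\<close>)
    moreover have "ordr idx g r x p' m'" using c e vx by (simp add: ordr_def r)
    moreover have "\<forall>e. avoids e (x # r) \<longrightarrow> avoids e r \<and> (\<not> m' \<longrightarrow> {x, port x p'} \<noteq> e)"
      using c e by (simp add: r)
    ultimately show ?thesis using e by blast
  next
    case 3
    then have e: "(mk', p', m', i') = (((if k then 1 else clk), 0, 0), 0, True, clk)" using nx by auto
    have "chain g (x # r)" using d by (simp add: dfs_def)
    then have r: "r = []" using 3 gx by (cases r) (auto simp: par_def)
    have "closed_in K x" unfolding closed_in_def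
    proof (intro exI[of _ "{v. vis idx g v}"] conjI ballI allI impI)
      show "x \<in> {v. vis idx g v}" using vx by simp
      show "{v. vis idx g v} \<subseteq> {..<n} - {bh}" using d by (auto simp: dfs_def vis_def)
      fix v j assume v: "v \<in> {v. vis idx g v}" and j: "j < deg v"
      have "ptr g v = deg v"
        using d v pl 3 gx r by (cases "v = x") (auto simp: dfs_def ptr_def)
      then show "port v j \<in> {v. vis idx g v} \<or> (v, j) \<in> K" using d v j by (auto simp: dfs_def)
    qed
    then show ?thesis using e by blast
  qed
qed

lemma dfs_upd_ptr:
  assumes d: "dfs idx g K (x # r)" and lt: "ptr g x < deg x"
    and K: "vis idx g (port x (ptr g x)) \<or> (x, ptr g x) \<in> K'" and KK: "K \<subseteq> K'"
  shows "dfs idx (g(x := (idx, par g x, Suc (ptr g x)))) K' (x # r)"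
proof -
  let ?g = "g(x := (idx, par g x, Suc (ptr g x)))"
  have vx: "vis idx g x" using d by (simp add: dfs_def)
  then have v: "vis idx ?g v \<longleftrightarrow> vis idx g v" for v by (auto simp: vis_def)
  have pt: "ptr ?g v = (if v = x then Suc (ptr g x) else ptr g v)" for v by (simp add: ptr_def)
  have ch: "chain g (x # r)" and ds: "distinct (x # r)" using d by (simp_all add: dfs_def)
  have c: "chain ?g (x # r)"
    by (rule chain_cong[OF ch]) (use ds in \<open>auto simp: par_def\<close>)
  show ?thesis unfolding dfs_def v
  proof (intro conjI)
    show "\<forall>v. vis idx g v \<longrightarrow> v \<noteq> bh \<and> ptr ?g v \<le> deg v" using d lt by (auto simp: dfs_def pt)
    show "distinct (x # r)" "\<forall>v\<in>set (x # r). vis idx g v" using d by (auto simp: dfs_def)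
    show "chain ?g (x # r)" by (rule c)
    show "\<forall>v. vis idx g v \<and> v \<notin> set (x # r) \<longrightarrow> ptr ?g v = deg v" using d by (auto simp: dfs_def pt)
    show "\<forall>v j. vis idx g v \<and> j < ptr ?g v \<longrightarrow> vis idx g (port v j) \<or> (v, j) \<in> K'"
    proof (intro allI impI)
      fix v j assume a: "vis idx g v \<and> j < ptr ?g v"
      then consider "j < ptr g v" | "v = x" "j = ptr g x" by (auto simp: pt less_Suc_eq split: if_splits)
      then show "vis idx g (port v j) \<or> (v, j) \<in> K'"
      proof cases
        case 1
        then have "vis idx g (port v j) \<or> (v, j) \<in> K" using d a unfolding dfs_def by blast
        then show ?thesis using KK by blast
      next
        case 2 then show ?thesis using K by simp
      qed
    qed
  qed
qed

lemma dfs_push: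
  assumes d: "dfs idx g K st" and o: "ordr idx g st x p True" and nv: "\<not> vis idx g (port x p)" and nb: "port x p \<noteq> bh"
  shows "dfs idx (g(port x p := (idx, Suc (rp x p), 0))) K (port x p # st)"
proof -
  let ?y = "port x p" let ?g = "g(?y := (idx, Suc (rp x p), 0))"
  have x: "x < n" "p < deg x" "hd st = x" "p = ptr g x" using o by (auto simp: ordr_def vis_def)
  obtain r where st: "st = x # r" using d x chain_ne by (cases st) (auto simp: dfs_def)
  have yn: "?y < n" using port_lt x by auto
  have ny: "?y \<notin> set st" using d nv by (auto simp: dfs_def)
  have v: "vis idx ?g v \<longleftrightarrow> vis idx g v \<or> v = ?y" for v using yn by (auto simp: vis_def)
  have ch: "chain g (x # r)" using d by (simp add: dfs_def st)
  have c1: "chain ?g st" unfolding st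
    by (rule chain_cong[OF ch]) (use ny in \<open>auto simp: st par_def\<close>)
  have c: "chain ?g (?y # st)"
    using c1 rp[OF x(1,2)] ny x(2,4) by (auto simp: st par_def ptr_def)
  have pt: "ptr ?g v = (if v = ?y then 0 else ptr g v)" for v by (simp add: ptr_def)
  show ?thesis unfolding dfs_def v pt
  proof (intro conjI)
    show "chain ?g (?y # st)" by (rule c)
    show "\<forall>v. (vis idx g v \<or> v = ?y) \<and> v \<notin> set (?y # st) \<longrightarrow> (if v = ?y then 0 else ptr g v) = deg v"
      using d by (auto simp: dfs_def)
    show "\<forall>v j. (vis idx g v \<or> v = ?y) \<and> j < (if v = ?y then 0 else ptr g v) \<longrightarrow>
       (vis idx g (port v j) \<or> port v j = ?y) \<or> (v, j) \<in> K"
      using d unfolding dfs_def by (metis not_less0)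
  qed (use d nb ny in \<open>simp_all add: dfs_def\<close>)
qed

text \<open>Each arrival raises the rank by at least 20: a new node adds 40, turning round at a
  known node adds the 20 for switching \<open>m\<close> off, and a return adds 40 for the pointer
  while losing at most the 20 for \<open>m\<close>.\<close>

lemma think_arrive:
  assumes d: "dfs idx g K st" and o: "ordr idx g st x p m" and nb: "port x p \<noteq> bh"
    and idx: "idx = (if k then 1 else i)"
    and th: "think k (Arr (rp x p) m) (g (port x p)) (deg (port x p)) clk i = (mk', p', m', i')"
  shows "(\<exists>st'. i' = i \<and> dfs idx (g(port x p := mk')) K st' \<and> ordr idx (g(port x p := mk')) st' (port x p) p' m' \<and>
            rk idx g m + 20 \<le> rk idx (g(port x p := mk')) m' \<and>
            (\<forall>e. avoids e st \<and> {x, port x p} \<noteq> e \<longrightarrow> avoids e st' \<and> (\<not> m' \<longrightarrow> {port x p, port (port x p) p'} \<noteq> e)))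
    \<or> closed_in K (port x p) \<and> (mk', p', m', i') = (((if k then 1 else clk), 0, 0), 0, True, clk)"
proof -
  let ?y = "port x p" let ?g = "g(?y := mk')"
  have x: "x < n" "p < deg x" "vis idx g x" using o by (auto simp: ordr_def vis_def)
  have yn: "?y < n" using port_lt x by auto
  note rp = rp[OF x(1,2)]
  obtain j pa pt where gy: "g ?y = (j, pa, pt)" using prod_cases3 by blast
  show ?thesis
  proof (cases m)
    case True
    note m = this
    have px: "hd st = x" "p = ptr g x" using o m by (auto simp: ordr_def)
    obtain r where st: "st = x # r" using d px chain_ne by (cases st) (auto simp: dfs_def)
    show ?thesis
    proof (cases "j = idx")
      case False
      let ?h = "g(?y := (idx, Suc (rp x p), 0))"
      have nv: "\<not> vis idx g ?y" using False gy by (auto simp: vis_def)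
      have dh: "dfs idx ?h K (?y # st)" using dfs_push[OF d _ nv nb] o m by simp
      have "nxt k (idx, Suc (rp x p), 0) (deg ?y) clk i = (mk', p', m', i')"
        using th gy False m idx by (auto split: if_splits)
      \<comment> \<open>The new node has at least the port of entry, so its first order is always
        port 0.\<close>
      then have e: "mk' = (idx, Suc (rp x p), 0)" "p' = 0" "m'" "i' = i" using rp(1) by auto
      have "ordr idx ?h (?y # st) ?y 0 True" using yn rp(1) by (auto simp: ordr_def ptr_def vis_def)
      moreover have "base idx ?h = base idx g + 1"
        using base_upd[OF yn, of idx g "(idx, Suc (rp x p), 0)"] gy False by simp
      moreover have "\<forall>e. avoids e st \<and> {x, ?y} \<noteq> e \<longrightarrow> avoids e (?y # st)" by (auto simp: st insert_commute)
      ultimately show ?thesis using e dh m by (intro disjI1 exI[of _ "?y # st"]) (auto simp: rk_def)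
    next
      case True
      then have e: "mk' = g ?y" "p' = rp x p" "\<not> m'" "i' = i" using th gy m idx by (auto split: if_splits)
      have g: "?g = g" using e by auto
      have "ordr idx g st ?y (rp x p) False" using rp yn px x True gy by (auto simp: ordr_def vis_def)
      then show ?thesis using e d m rp(2) by (intro disjI1 exI[of _ st]) (auto simp: g rk_def insert_commute)
    qed
  next
    case False
    have px: "hd st = ?y" "ptr g ?y < deg ?y" "port ?y (ptr g ?y) = x" using o False by (auto simp: ordr_def)
    obtain r where st: "st = ?y # r" using d px chain_ne by (cases st) (auto simp: dfs_def)
    have ji: "j = idx" using d st gy by (auto simp: dfs_def vis_def)
    have n: "nxt k (idx, pa, Suc pt) (deg ?y) clk i = (mk', p', m', i')" using th gy False ji by simp
    let ?h = "g(?y := (idx, pa, Suc pt))"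
    have he: "?h = g(?y := (idx, par g ?y, Suc (ptr g ?y)))" using gy by (simp add: par_def ptr_def)
    have dh: "dfs idx ?h K (?y # r)" unfolding he by (rule dfs_upd_ptr) (use d st px x in auto)
    have b: "base idx ?h = base idx g + 1"
      using base_upd[OF yn, of idx g "(idx, pa, Suc pt)"] gy ji by (simp add: ptr_def)
    have n': "nxt k (idx, pa, Suc pt) (deg ?y) clk i = (mk', p', m', i')" by (rule n)
    from nxt_spec[OF dh _ n'] show ?thesis
    proof
      assume "\<exists>st'. i' = i \<and> mk' = ?h ?y \<and> dfs idx ?h K st' \<and> ordr idx ?h st' ?y p' m' \<and>
        (\<forall>e. avoids e (?y # r) \<longrightarrow> avoids e st' \<and> (\<not> m' \<longrightarrow> {?y, port ?y p'} \<noteq> e))"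
      then obtain st' where h: "i' = i" "mk' = ?h ?y" "dfs idx ?h K st'" "ordr idx ?h st' ?y p' m'"
        "\<forall>e. avoids e (?y # r) \<longrightarrow> avoids e st' \<and> (\<not> m' \<longrightarrow> {?y, port ?y p'} \<noteq> e)" by blast
      have g: "?g = ?h" using h(2) by simp
      show ?thesis unfolding g using h b False st by (intro disjI1 exI[of _ st']) (auto simp: rk_def)
    qed (use px in \<open>auto\<close>)
  qed
qed

text \<open>The pointer advances without a crossing; the port enters \<open>K\<close> as the excuse
  for its other end being possibly unvisited.\<close>

lemma think_skip:
  assumes d: "dfs idx g K st" and o: "ordr idx g st x p True"
    and th: "think k SkipF (g x) (deg x) clk i = (mk', p', m', i')"
  shows "(\<exists>st'. i' = i \<and> dfs idx (g(x := mk')) (insert (x, p) K) st' \<and> ordr idx (g(x := mk')) st' x p' m' \<and>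
            rk idx g True + 20 \<le> rk idx (g(x := mk')) m' \<and>
            (\<forall>e. avoids e st \<longrightarrow> avoids e st' \<and> (\<not> m' \<longrightarrow> {x, port x p'} \<noteq> e)))
    \<or> closed_in (insert (x, p) K) x \<and> (mk', p', m', i') = (((if k then 1 else clk), 0, 0), 0, True, clk)"
proof -
  have x: "x < n" "p < deg x" "hd st = x" "p = ptr g x" "vis idx g x" using o by (auto simp: ordr_def vis_def)
  obtain r where st: "st = x # r" using d x chain_ne by (cases st) (auto simp: dfs_def)
  obtain j pa pt where gx: "g x = (j, pa, pt)" using prod_cases3 by blast
  have ji: "j = idx" using x gx by (auto simp: vis_def)
  let ?h = "g(x := (idx, pa, Suc pt))"
  have he: "?h = g(x := (idx, par g x, Suc (ptr g x)))" using gx by (simp add: par_def ptr_def)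
  have dh: "dfs idx ?h (insert (x, p) K) (x # r)" unfolding he by (rule dfs_upd_ptr) (use d st x in auto)
  have b: "base idx ?h = base idx g + 1"
    using base_upd[OF x(1), of idx g "(idx, pa, Suc pt)"] gx ji by (simp add: ptr_def)
  have n: "nxt k (idx, pa, Suc pt) (deg x) clk i = (mk', p', m', i')" using th gx ji by simp
  from nxt_spec[OF dh _ n] show ?thesis
  proof
    assume "\<exists>st'. i' = i \<and> mk' = ?h x \<and> dfs idx ?h (insert (x, p) K) st' \<and> ordr idx ?h st' x p' m' \<and>
        (\<forall>e. avoids e (x # r) \<longrightarrow> avoids e st' \<and> (\<not> m' \<longrightarrow> {x, port x p'} \<noteq> e))"
    then obtain st' where h: "i' = i" "mk' = ?h x" "dfs idx ?h (insert (x, p) K) st'" "ordr idx ?h st' x p' m'"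
        "\<forall>e. avoids e (x # r) \<longrightarrow> avoids e st' \<and> (\<not> m' \<longrightarrow> {x, port x p'} \<noteq> e)" by blast
    have g: "g(x := mk') = ?h" using h(2) by simp
    show ?thesis unfolding g using h b st by (intro disjI1 exI[of _ st']) (auto simp: rk_def)
  qed auto
qed

text \<open>A fresh identifier turns all old marks into marks of unvisited nodes, so nothing has to
  be erased.\<close>

lemma restart_dfs:
  assumes "x < n" "x \<noteq> bh" "0 < deg x" "\<And>v. v < n \<Longrightarrow> v \<noteq> x \<Longrightarrow> fst (g v) \<noteq> idx"
  shows "dfs idx (g(x := (idx, 0, 0))) {} [x]" "ordr idx (g(x := (idx, 0, 0))) [x] x 0 True"
proof -
  have v: "vis idx (g(x := (idx, 0, 0))) v \<longleftrightarrow> v = x" for v using assms by (auto simp: vis_def)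
  show "dfs idx (g(x := (idx, 0, 0))) {} [x]" "ordr idx (g(x := (idx, 0, 0))) [x] x 0 True"
    using assms by (auto simp: dfs_def ordr_def v par_def ptr_def)
qed

lemma edges_port: "v < n \<Longrightarrow> p < deg v \<Longrightarrow> {v, port v p} \<in> E"
  by (auto simp: edges_def)

lemma edgesD: assumes "{v, w} \<in> E" "v < n" shows "\<exists>p<deg v. port v p = w"
proof -
  obtain v' p where h: "{v, w} = {v', port v' p}" "v' < n" "p < deg v'" using assms by (auto simp: edges_def)
  then consider "v = v'" "w = port v' p" | "v = port v' p" "w = v'" by (auto simp: doubleton_eq_iff)
  then show ?thesis
  proof cases
    case 2 then show ?thesis using rp[OF h(2,3)] by auto
  qed (use h in auto)
qed

text \<open>Every port leading out of the closed set lies in \<open>K\<close>, so no edge of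
  \<open>E'\<close> leaves the set; but the black hole is outside and \<open>E'\<close> is
  connected.\<close>

lemma not_closed:
  assumes "closed_in K y" "connected_on n E'" "E' \<subseteq> E" "\<And>v j. (v, j) \<in> K \<Longrightarrow> {v, port v j} \<notin> E'"
  shows False
proof -
  obtain S where S: "y \<in> S" "S \<subseteq> {..<n} - {bh}" "\<forall>v\<in>S. \<forall>j<deg v. port v j \<in> S \<or> (v, j) \<in> K"
    using assms(1) by (auto simp: closed_in_def)
  have "(y, z) \<in> (adj_rel E')\<^sup>* \<Longrightarrow> z \<in> S" for z
  proof (induction rule: rtrancl_induct)
    case (step v w)
    then have e: "{v, w} \<in> E'" by (simp add: adj_rel_def)
    moreover have "v < n" using step S(2) by auto
    ultimately obtain p where "p < deg v" "port v p = w" using edgesD assms(3) by blast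
    then show ?case using S(3) step assms(4) e by blast
  qed (use S in simp)
  moreover have "(y, bh) \<in> (adj_rel E')\<^sup>*" using assms(2) S bhn by (auto simp: connected_on_def)
  ultimately show False using S(2) by auto
qed

section \<open>Counting ports and edges\<close>

lemma finite_E: "finite E"
proof -
  have "E \<subseteq> Pow {..<n}" using port_lt by (auto simp: edges_def)
  then show ?thesis by (rule finite_subset) simp
qed

text \<open>Double counting: a port is determined by its edge together with the node at which it
  lies, and an edge has at most two ends.\<close>

lemma sum_deg: "(\<Sum>v<n. deg v) \<le> 2 * card E"
proof -
  let ?A = "SIGMA v:{..<n}. {..<deg v}" let ?B = "SIGMA e:E. e"
  have "(\<Sum>v<n. deg v) = card ?A" by simp
  also have "\<dots> \<le> card ?B"
  proof (rule card_inj_on_le[of "\<lambda>(v, p). ({v, port v p}, v)"])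
    show "inj_on (\<lambda>(v, p). ({v, port v p}, v)) ?A"
      using port_inj by (auto simp: inj_on_def doubleton_eq_iff)
    show "(\<lambda>(v, p). ({v, port v p}, v)) ` ?A \<subseteq> ?B" using edges_port by auto
    show "finite ?B" using finite_E by (intro finite_SigmaI) (auto simp: edges_def)
  qed
  also have "\<dots> = (\<Sum>e\<in>E. card e)" using finite_E by (intro card_SigmaI) (auto simp: edges_def)
  also have "\<dots> \<le> (\<Sum>e\<in>E. 2)" by (rule sum_mono) (auto simp: edges_def intro: order.trans[OF card_insert_le_m1])
  finally show ?thesis by simp
qed

lemma deg_pos: assumes "v < n" "1 < n" shows "0 < deg v"
proof -
  obtain w where w: "w < n" "w \<noteq> v" using assms by (metis less_one nat_neq_iff not_less_iff_gr_or_eq zero_less_one less_trans)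
  have "(v, w) \<in> (adj_rel E)\<^sup>*" using pg assms w by (auto simp: port_graph_def connected_on_def)
  then obtain z where "(v, z) \<in> adj_rel E" using w by (metis converse_rtranclE)
  then show ?thesis using edgesD[of v z] assms by (auto simp: adj_rel_def)
qed

lemma n_le: assumes "1 < n" shows "n \<le> 2 * card E"
proof -
  have "n = (\<Sum>v<n. 1)" by simp
  also have "\<dots> \<le> (\<Sum>v<n. deg v)" using deg_pos assms by (intro sum_mono) (auto simp: Suc_le_eq)
  finally show ?thesis using sum_deg by simp
qed

text \<open>\<open>base\<close> is at most the degree sum plus \<open>n\<close>, hence at most
  \<open>4 * card E\<close>. The final 40 covers the 20 for \<open>m\<close> and another 20 for what
  is added to the rank within one search step.\<close>

definition RB :: nat where "RB = 40 * (4 * card E) + 40"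

lemma rk_le: assumes "dfs idx g K st" "1 < n" shows "rk idx g m + 20 \<le> RB"
proof -
  have "base idx g \<le> (\<Sum>v<n. Suc (deg v))" unfolding base_def
    using assms by (intro sum_mono) (auto simp: dfs_def vis_def)
  also have "\<dots> = (\<Sum>v<n. deg v) + n" by (simp add: sum_Suc)
  also have "\<dots> \<le> 4 * card E" using sum_deg n_le[OF assms(2)] by simp
  finally show ?thesis by (simp add: rk_def RB_def)
qed

end

section \<open>Interplay of the two teams\<close>

context graph
begin

definition ed :: "team \<Rightarrow> nat set" where "ed T = {tu T, tw T}"

text \<open>Ports are injective at every node, so two teams at one edge either agree in node and
  port or face each other with outgoing and return ports exchanged.\<close>

lemma ed_eq:
  assumes "geo T" "geo T'" "ed T = ed T'"
  shows "tu T = tu T' \<and> tp T = tp T' \<or> tu T = tw T' \<and> tw T = tu T' \<and> tp T = tr T' \<and> tr T = tp T'"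
proof -
  note g = assms(1,2)[unfolded geo_def]
  consider "tu T = tu T'" "tw T = tw T'" | "tu T = tw T'" "tw T = tu T'"
    using assms(3) by (auto simp: ed_def doubleton_eq_iff)
  then show ?thesis
  proof cases
    case 1
    then show ?thesis using port_inj[of "tu T" "tp T" "tp T'"] g by (auto simp: tw_def)
  next
    case 2
    have "tr T' = tp T"
      using rp_eq[of "tu T'" "tp T'" "tp T"] g 2 by (simp add: tr_def tw_def)
    moreover have "tr T = tp T'"
      using rp_eq[of "tu T" "tp T" "tp T'"] g 2 by (simp add: tr_def tw_def)
    ultimately show ?thesis using 2 by simp
  qed
qed

lemma tr_lt: "geo T \<Longrightarrow> tr T < deg (tw T)" "geo T \<Longrightarrow> port (tw T) (tr T) = tu T" "geo T \<Longrightarrow> tw T < n"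
  "geo T \<Longrightarrow> rp (tw T) (tr T) = tp T" "geo T \<Longrightarrow> port (tu T) (tp T) = tw T" "geo T \<Longrightarrow> rp (tu T) (tp T) = tr T"
  using rp[of "tu T" "tp T"] port_lt[of "tu T" "tp T"] rp_rp[of "tu T" "tp T"] by (auto simp: geo_def tr_def tw_def)

section \<open>The flags between two teams in terms of their situations\<close>

definition SW1 :: "team \<Rightarrow> team \<Rightarrow> bool" where
  "SW1 T T' \<longleftrightarrow> tk T \<and> tph T = Ord \<and> tph T' \<in> {Snt, Tst, Saf} \<and> tu T' = tu T \<and> tp T' = tp T"
definition SW2 :: "team \<Rightarrow> team \<Rightarrow> bool" where
  "SW2 T T' \<longleftrightarrow> tk T \<and> tph T = Ord \<and> tph T' \<in> {Tst, Saf} \<and> tw T' = tu T \<and> tr T' = tp T"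
definition YSK :: "team \<Rightarrow> team \<Rightarrow> bool" where
  "YSK T T' \<longleftrightarrow> lpos T' = tu T \<and> tp T' = tp T \<or>
     (tph T' \<in> {Tst, Saf} \<and> tw T' = tu T \<and> tr T' = tp T \<or> tph T' = Rev \<and> tu T' = tu T \<and> tr T' = tp T \<or>
      tph T' = Cmp \<and> tu T' = tu T \<and> tq T' = tp T) \<or>
     tph T' \<in> {Snt, Rev} \<and> tw T' = tu T"
definition EXCH :: "team \<Rightarrow> team \<Rightarrow> bool" where
  "EXCH T T' \<longleftrightarrow> tph T' = Snt \<and> tu T' = tw T \<and> tp T' = tr T"

context
  fixes c t T T'
  assumes own: "own c t T" and own': "own c (\<not> t) T'" and geo: "geo T" and geo': "geo T'"
begin

lemma xord_iff: "xord (vw c v) t \<longleftrightarrow> v = tu T \<and> tk T \<and> tph T = Ord"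
proof (cases "v = lpos T")
  case True
  show ?thesis unfolding True using own_ldr[OF own geo] own_A[OF own geo, of "lpos T"] geo_uw[OF geo]
    by (cases "tph T") (auto simp: xord_def own_L[OF own geo] lpos_def)
next
  case False
  then show ?thesis by (auto simp: xord_def own_L[OF own geo] lpos_def)
qed

lemma split_iff: "split_at (vw c v) (\<not> t) p \<longleftrightarrow> v = tu T' \<and> tp T' = p \<and> tph T' \<in> {Snt, Tst, Saf}"
proof (cases "v = lpos T'")
  case True
  show ?thesis unfolding True using own_ldr[OF own' geo'] own_A[OF own' geo', of "lpos T'"] own_B[OF own' geo', of "lpos T'"] own_S[OF own' geo', of "lpos T'"] geo_uw[OF geo']
    by (cases "tph T'") (auto simp: split_at_def own_L[OF own' geo'] lpos_def)
next
  case False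
  then show ?thesis by (auto simp: split_at_def own_L[OF own' geo'] lpos_def)
qed

lemma ldr_ord: "tph T = Ord \<Longrightarrow> ldr (vw c (tu T)) t = ldst t T PO"
  using own_ldr[OF own geo] by (simp add: lpos_def)

lemma sw1_iff: "sw1 (vw c v) t \<longleftrightarrow> v = tu T \<and> SW1 T T'"
  using ldr_ord by (auto simp: sw1_def xord_iff split_iff SW1_def)

lemma sw2_iff: "sw2 (vw c v) t \<longleftrightarrow> v = tu T \<and> SW2 T T'"
proof (cases "v = tu T \<and> tk T \<and> tph T = Ord")
  case True
  then have v: "v = tu T" and o: "tk T" "tph T = Ord" and l: "ldr (vw c (tu T)) t = ldst t T PO" using ldr_ord by auto
  have "sw2 (vw c v) t \<longleftrightarrow> tu T \<noteq> lpos T' \<and> (\<exists>k. Sc (\<not> t) (tp T) k \<in> vw c (tu T))"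
    using o by (simp add: v sw2_def xord_iff l own_L[OF own' geo'])
  also have "\<dots> \<longleftrightarrow> SW2 T T'"
    using o geo geo_uw[OF geo'] by (cases "tph T'") (auto simp: own_Sc[OF own' geo'] SW2_def lpos_def geo_def)
  finally show ?thesis using v by simp
next
  case False
  then show ?thesis by (auto simp: sw2_def xord_iff SW2_def)
qed

lemma xsw_iff: "xsw c t T \<longleftrightarrow> SW1 T T' \<or> SW2 T T'"
  by (auto simp: xsw_def sw1_iff sw2_iff)

lemma got_iff: "got c (\<not> t) T' = (if SW1 T T' then Some (tmd T) else None)"
proof -
  have "tu T' = tu T \<and> tph T = Ord" if "SW1 T T'" using that by (auto simp: SW1_def)
  then show ?thesis using ldr_ord by (auto simp: got_def sw1_iff)
qed

lemma gtk_iff: "gtk c (\<not> t) T' = (if SW2 T T' then Some (tmd T) else None)"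
proof -
  have "tw T' = tu T \<and> tph T = Ord \<and> tr T' = tp T" if "SW2 T T'" using that by (auto simp: SW2_def)
  then show ?thesis using ldr_ord by (auto simp: gtk_def sw2_iff)
qed

lemma ysk_iff: "tph T = Ord \<Longrightarrow> ysk c t T \<longleftrightarrow> YSK T T'"
proof -
  assume o: "tph T = Ord"
  have l: "lpos T' = tu T \<Longrightarrow> ldr (vw c (tu T)) (\<not> t) = ldst (\<not> t) T' (lphs (tph T') (tx T'))" using own_ldr[OF own' geo'] by simp
  let ?V = "vw c (tu T)"
  have 1: "hasL ?V (\<not> t) \<and> lp (ldr ?V (\<not> t)) = tp T \<longleftrightarrow> lpos T' = tu T \<and> tp T' = tp T"
    using l by (auto simp: own_L[OF own' geo'])
  have 2: "(\<exists>k. Sc (\<not> t) (tp T) k \<in> ?V) \<longleftrightarrow> tph T' \<in> {Tst, Saf} \<and> tw T' = tu T \<and> tr T' = tp T \<or>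
      tph T' = Rev \<and> tu T' = tu T \<and> tr T' = tp T \<or> tph T' = Cmp \<and> tu T' = tu T \<and> tq T' = tp T"
    using geo by (cases "tph T'") (auto simp: own_Sc[OF own' geo'] geo_def)
  have 3: "\<not> hasL ?V (\<not> t) \<and> (\<exists>r. Tr (\<not> t) r \<in> ?V) \<longleftrightarrow> tph T' \<in> {Snt, Rev} \<and> tw T' = tu T"
    using geo geo_uw[OF geo'] by (cases "tph T'") (auto simp: own_L[OF own' geo'] own_Tr[OF own' geo'] lpos_def geo_def)
  have 4: "lp (ldr ?V t) = tp T" using ldr_ord[OF o] by simp
  show ?thesis unfolding ysk_def skp_def YSK_def 4 1 2 3 by blast
qed

lemma exch_iff: "exch c t T \<longleftrightarrow> EXCH T T'"
proof (cases "tw T = lpos T'")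
  case True
  have l: "ldr (vw c (tw T)) (\<not> t) = ldst (\<not> t) T' (lphs (tph T') (tx T'))" using own_ldr[OF own' geo'] True by simp
  show ?thesis using True l own_A[OF own' geo', of "tw T"] geo_uw[OF geo']
    by (cases "tph T'") (auto simp: exch_def EXCH_def own_L[OF own' geo'] lpos_def)
next
  case False
  then show ?thesis by (auto simp: exch_def EXCH_def own_L[OF own' geo'] lpos_def)
qed

end

fun nextph :: "bool \<Rightarrow> bool \<Rightarrow> tph \<Rightarrow> tph" where
  "nextph P s Ord = (if P then Snt else Ord)"
| "nextph P s Snt = (if P \<and> s then Cmp else Tst)"
| "nextph P s Tst = (if P then (if s then Rev else Ded) else Tst)"
| "nextph P s Rev = (if P then Cmp else Saf)"
| "nextph P s Ded = Ded"
| "nextph P s Cmp = (if P then Crs else Blk)"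
| "nextph P s Saf = (if P then Cmp else Saf)"
| "nextph P s Blk = (if P then Crs else Blk)"
| "nextph P s Crs = Ord"

definition same :: "team \<Rightarrow> team \<Rightarrow> bool" where "same T T1 \<longleftrightarrow> tu T1 = tu T \<and> tp T1 = tp T"

lemma sameD: "same T T1 \<Longrightarrow> tw T1 = tw T" "same T T1 \<Longrightarrow> tr T1 = tr T" "same T T1 \<Longrightarrow> ed T1 = ed T"
  "same T T1 \<Longrightarrow> tu T1 = tu T" "same T T1 \<Longrightarrow> tp T1 = tp T"
  by (auto simp: same_def tw_def tr_def ed_def)

definition stp :: "nat set set \<Rightarrow> team \<Rightarrow> team \<Rightarrow> bool" where
  "stp M T T1 \<longleftrightarrow> tph T1 = Ord \<and> \<not> tx T1 \<or> same T T1 \<and> tph T1 = nextph (ed T \<notin> M) (tw T \<noteq> bh) (tph T)"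

text \<open>When the second team is split over the edge that the first team wants to cross, it is
about to find out and to swap or exchange agents with it.\<close>
definition EXC :: "team \<Rightarrow> team \<Rightarrow> bool" where
  "EXC T T' \<longleftrightarrow> (tph T' \<in> {Snt, Tst, Rev, Saf} \<and> ed T = ed T' \<and> tph T \<noteq> Crs \<longrightarrow>
     tph T = Ord \<or> tph T = Snt \<and> tph T' = Snt \<and> tu T \<noteq> tu T')"

text \<open>A violation after the round requires that both teams kept a common edge. If the second
  team sends its scout only now, the leader of the first cannot wait at the same port, which would
  have been skipped; the teams face each other, and since the edge is present the first one either
  crosses or sends its scout simultaneously. If the second team was split before, the first one was
  in \<open>Ord\<close>; either the split is noticed, which is the excluded swap, or the present
  edge lets the split team become complete.\<close>

lemma EXC_step:
  assumes g: "geo T" "geo T'" and ex: "EXC T T'" and s: "stp M T T1" "stp M T' T1'"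
    and nd: "tph T \<noteq> Ded" "tph T' \<noteq> Ded" and k: "tph T = Ord \<longrightarrow> tk T"
    and sw: "\<not> SW1 T T'" "\<not> SW2 T T'"
    and nx: "\<not> (tph T = Snt \<and> tph T' = Snt \<and> ed T = ed T' \<and> tu T \<noteq> tu T')"
    and sk: "tph T' = Ord \<and> tph T1' = Snt \<longrightarrow> \<not> YSK T' T"
    and bad: "tw T = bh \<longrightarrow> tph T \<in> {Ord, Snt, Tst}" "tw T' = bh \<longrightarrow> tph T' \<in> {Ord, Snt, Tst}"
  shows "EXC T1 T1'"
  unfolding EXC_def
proof (intro impI)
  assume a: "tph T1' \<in> {Snt, Tst, Rev, Saf} \<and> ed T1 = ed T1' \<and> tph T1 \<noteq> Crs"
  have sm': "same T' T1'" and n': "tph T1' = nextph (ed T' \<notin> M) (tw T' \<noteq> bh) (tph T')" using s(2) a by (auto simp: stp_def)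
  show "tph T1 = Ord \<or> tph T1 = Snt \<and> tph T1' = Snt \<and> tu T1 \<noteq> tu T1'"
  proof (cases "tph T1 = Ord")
    case False
    then have sm: "same T T1" and n1: "tph T1 = nextph (ed T \<notin> M) (tw T \<noteq> bh) (tph T)" using s(1) by (auto simp: stp_def)
    have e: "ed T = ed T'" using a sameD[OF sm] sameD[OF sm'] by simp
    have nc: "tph T \<noteq> Crs" using n1 False by (cases "tph T") auto
    have uu: "tu T \<noteq> bh" "tu T' \<noteq> bh" using g by (auto simp: geo_def)
    note u = ed_eq[OF g e] geo_uw[OF g(1)] geo_uw[OF g(2)]
    have 1: "tph T = Ord" if "tph T' \<in> {Snt, Tst, Rev, Saf}" using that ex e nc nx by (auto simp: EXC_def)
    show ?thesis
    proof (cases "tph T' = Ord")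
      case True
      then have p: "ed T' \<notin> M" "tph T1' = Snt" using n' a by (auto split: if_splits)
      then have nk: "\<not> YSK T' T" using sk True by simp
      have opp: "tu T = tw T'" "tw T = tu T'" "tp T = tr T'" "tr T = tp T'"
        using u(1) nk nc by (auto simp: YSK_def lpos_def)
      have "tph T \<notin> {Tst, Saf, Snt, Rev}" using nk opp by (auto simp: YSK_def)
      then have "tph T1 = Snt" using n1 p e a nd False nc by (cases "tph T") auto
      then show ?thesis using p opp u sameD[OF sm] sameD[OF sm'] by auto
    next
      case False
      then have "tph T' \<in> {Snt, Tst, Rev, Saf}" using n' a by (cases "tph T'") (auto split: if_splits)
      with 1 have o: "tph T = Ord" by blast
      then have p: "ed T \<notin> M" "tph T1 = Snt" using n1 \<open>tph T1 \<noteq> Ord\<close> by (auto split: if_splits)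
      have "tph T' \<in> {Snt, Tst, Rev, Saf}" by fact
      then show ?thesis
      proof (elim insertE)
        assume h: "tph T' = Snt"
        \<comment> \<open>Over a present edge only a destroyed scout fails to return; and as no team
          stands in the black hole, both leaders are then on the same side.\<close>
        then have "tw T' = bh" using n' p e a by (auto split: if_splits)
        then have "SW1 T T'" using u(1) uu o k h by (auto simp: SW1_def)
        then show ?thesis using sw by simp
      next
        assume h: "tph T' = Tst"
        then have "SW1 T T' \<or> SW2 T T'" using u(1) o k by (auto simp: SW1_def SW2_def)
        then show ?thesis using sw by simp
      next
        assume h: "tph T' = Rev"
        then show ?thesis using n' p e a by auto
      next
        assume h: "tph T' = Saf"
        then show ?thesis using n' p e a by auto
      qed simp
    qed
  qed simp
qed

context
  fixes c t T
  assumes rel: "teamrel c t T" and own: "own c t T" and geo: "geo T"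
begin

lemma member_plan:
  assumes "i = ta T \<or> i = tb T" "alv c i"
  shows "\<exists>s a. plc c i = Do s a \<and> (\<forall>p. a \<noteq> Halt p)"
  using assms rel
  by (cases "tph T"; cases "tw T = bh")
    (auto simp: teamrel_def plan_Ord[OF rel own geo] plan_Snt[OF rel own geo] plan_Tst[OF rel own geo] plan_Rev[OF rel own geo]
      plan_Cmp[OF rel own geo] plan_Saf[OF rel own geo] plan_Blk[OF rel own geo] plan_Crs[OF rel own geo])

lemma leader_loc: "loc c (tl T) (lpos T) (ldst t T (lphs (tph T) (tx T)))" "alv c (tl T)"
  using rel by (auto simp: teamrel_def loc_def)

lemmas leader_plans = plan_Ord(1)[OF rel own geo] plan_Snt(1)[OF rel own geo] plan_Tst(1)[OF rel own geo]
  plan_Rev(1)[OF rel own geo] plan_Ded[OF rel own geo] plan_Cmp(1)[OF rel own geo] plan_Saf(1)[OF rel own geo]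
  plan_Blk(1)[OF rel own geo] plan_Crs(1)[OF rel own geo]

lemma leader_Halt: assumes "plc c (tl T) = Do s (Halt p)" shows "tph T = Ded" "p = tp T"
proof -
  have "tph T = Ded \<and> p = tp T"
    using assms by (cases "tph T"; simp add: leader_plans split: if_splits option.splits)
  then show "tph T = Ded" "p = tp T" by auto
qed

lemma leader_Th: assumes "plc c (tl T) = Th k x"
  shows "tph T = Ord \<and> tk T \<and> xsw c t T \<and> \<not> k \<or> tph T = Ord \<and> \<not> tk T \<and> (tx T \<or> ysk c t T) \<and> \<not> k \<or>
    tph T = Cmp \<and> (tarr T \<and> k = tk T \<or> \<not> tarr T \<and> ttok T \<noteq> None \<and> k) \<or> tph T = Blk \<and> \<not> tk T \<and> \<not> k \<or> tph T = Crs \<and> k = tk T"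
  using assms by (cases "tph T"; auto simp add: leader_plans split: if_splits option.splits)

lemma team_running: assumes "i \<in> {ta T, tb T, tl T}" "alv c i" shows "\<exists>v s. loc c i v s \<and> s \<noteq> Ini"
proof (cases "i = tl T")
  case True
  then show ?thesis using leader_loc(1) ldst_neq(4) by blast
next
  case False
  define R where "R i \<longleftrightarrow> (\<exists>v s. loc c i v s \<and> s \<noteq> Ini)" for i
  have R: "loc c i v (F a b) \<Longrightarrow> R i" "loc c i v (Tr a b) \<Longrightarrow> R i" "loc c i v (Sc a q k) \<Longrightarrow> R i" for v a b q k i
    unfolding R_def by blast+
  have "alv c (tb T) \<Longrightarrow> R (tb T)" using rel
    by (cases "tph T") (simp_all add: teamrel_def R split: if_splits, (elim conjE, erule R)+)
  moreover have "alv c (ta T) \<Longrightarrow> R (ta T)" using rel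
    by (cases "tph T") (simp_all add: teamrel_def R split: if_splits, (elim conjE, erule R)+)
  ultimately show ?thesis using assms False unfolding R_def by blast
qed

end

end

context graph
begin

lemma tick_simps[simp]: "ta (tick T) = ta T" "tb (tick T) = tb T" "tl (tick T) = tl T" "tu (tick T) = tu T"
  "tp (tick T) = tp T" "tph (tick T) = tph T" "tx (tick T) = tx T" "tk (tick T) = tk T" "tmd (tick T) = tmd T"
  "tarr (tick T) = tarr T" "ttok (tick T) = ttok T" "tck (tick T) = Suc (tck T)" "tid (tick T) = tid T"
  by (simp_all add: tick_def)

lemma absorb_None[simp]: "absorb None T = T" "tabsorb None T = T"
  by (simp_all add: absorb_def tabsorb_def)

text \<open>Positions along the cycle of one search step. A failed attempt lifts \<open>Ord\<close>
  from 0 to 1, so that the first failure counts as progress and only its repetition as a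
  standstill.\<close>

definition sub :: "team \<Rightarrow> nat" where
  "sub T = (case tph T of Ord \<Rightarrow> of_bool (tx T) | Snt \<Rightarrow> 2 | Tst \<Rightarrow> 3 | Rev \<Rightarrow> 4 | Ded \<Rightarrow> 5 | Saf \<Rightarrow> 5
     | Cmp \<Rightarrow> 6 | Blk \<Rightarrow> 7 | Crs \<Rightarrow> 8)"

lemma sub_le: "sub T \<le> 8" by (cases "tph T") (auto simp: sub_def)

text \<open>While \<open>rem\<close> holds, the order of the global search belongs to the far end of the edge over which the
team is split, and its scout carries the order or has just delivered it.\<close>
definition xkind :: "bool \<Rightarrow> bool \<Rightarrow> team \<Rightarrow> bool" where
  "xkind rem m T \<longleftrightarrow> (if rem then tph T \<in> {Tst, Rev, Saf, Cmp} \<and> tw T \<noteq> bh \<and>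
       (\<not> tk T \<and> \<not> tarr T \<and> ttok T = Some m \<or>
        tk T \<and> tarr T \<and> ttok T = None \<and> tmd T = m \<and> tph T \<in> {Saf, Cmp})
     else tk T \<and> \<not> tarr T \<and> ttok T = None \<and> tmd T = m)"

definition ykind :: "team \<Rightarrow> bool" where "ykind T \<longleftrightarrow> \<not> tk T \<and> \<not> tarr T \<and> ttok T = None"

definition ox :: "bool \<Rightarrow> team \<Rightarrow> nat" where "ox rem T = (if rem then tw T else tu T)"
definition op :: "bool \<Rightarrow> team \<Rightarrow> nat" where "op rem T = (if rem then tr T else tp T)"

text \<open>At most 8 + 9 = 17 is added to the rank within one search step, less than the 20 gained
  by the next step.\<close>

definition xrk :: "(nat \<Rightarrow> mark) \<Rightarrow> bool \<Rightarrow> bool \<Rightarrow> team \<Rightarrow> nat" where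
  "xrk g rem m T = rk 1 g m + sub T + (if rem then 9 else 0)"

definition crew :: "team \<Rightarrow> team \<Rightarrow> bool" where
  "crew T T1 \<longleftrightarrow> tl T1 = tl T \<and> (ta T1 = ta T \<and> tb T1 = tb T \<or> ta T1 = tb T \<and> tb T1 = ta T) \<and> tck T1 = Suc (tck T)"

text \<open>The second search explores the graph without the edge \<open>e\<close> since its last restart.\<close>
definition FR :: "nat set \<Rightarrow> team \<Rightarrow> nat list \<Rightarrow> (nat \<times> nat) set \<Rightarrow> bool" where
  "FR e T st K \<longleftrightarrow> (\<forall>(v, j)\<in>K. {v, port v j} = e) \<and> avoids e st \<and>
     (\<not> tmd T \<or> tph T \<noteq> Ord \<longrightarrow> ed T \<noteq> e) \<and> (tph T = Ord \<and> tx T \<longrightarrow> ed T = e) \<and> tph T \<noteq> Blk"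

definition yrk :: "(nat \<Rightarrow> mark) \<Rightarrow> team \<Rightarrow> nat" where "yrk g T = rk (tid T) g (tmd T) + sub T"

text \<open>The bonus makes a restart profitable: it may discard the whole rank of a search that
  violates \<open>FR\<close>, whereas a search satisfying \<open>FR\<close> is not restarted while
  \<open>e\<close> alone is missing.\<close>

definition yms :: "nat set \<Rightarrow> (nat \<Rightarrow> mark) \<Rightarrow> team \<Rightarrow> nat list \<Rightarrow> (nat \<times> nat) set \<Rightarrow> nat" where
  "yms e g T st K = (if FR e T st K then RB else 0) + yrk g T"

lemma yms_less: "yrk g T < yrk g1 T1 \<Longrightarrow> (FR e T st K \<Longrightarrow> FR e T1 st1 K1) \<Longrightarrow> yms e g T st K < yms e g1 T1 st1 K1"
  by (auto simp: yms_def)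

lemma yms_restart: "\<not> FR e T st K \<Longrightarrow> FR e T1 st1 K1 \<Longrightarrow> yrk g T < RB \<Longrightarrow> yms e g T st K < yms e g1 T1 st1 K1"
  by (auto simp: yms_def)

lemma geo_same: "geo T \<Longrightarrow> same T T1 \<Longrightarrow> crew T T1 \<Longrightarrow> geo T1"
  by (auto simp: geo_def same_def crew_def)

lemma sub_reord: "sub (reord T v k p b j) = 0" "tph (reord T v k p b j) = Ord" "\<not> tx (reord T v k p b j)"
  "tu (reord T v k p b j) = v" "tp (reord T v k p b j) = p" "tmd (reord T v k p b j) = b" "tid (reord T v k p b j) = j"
  "crew T (reord T v k p b j)" "tk (reord T v k p b j) = k" "\<not> tarr (reord T v k p b j)" "ttok (reord T v k p b j) = None"
  "tck (reord T v k p b j) = Suc (tck T)"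
  by (simp_all add: reord_def sub_def crew_def)

section \<open>Progress of a team that neither takes over an order nor exchanges scouts\<close>

context
  fixes c :: cfg and t :: bool and T :: team and ids :: "nat \<Rightarrow> nat" and M :: "nat set set"
  assumes run: "running c" and one: "one_writer c"
    and rel: "teamrel c t T" and own: "own c t T" and geo: "geo T"
    and nd: "tph T \<noteq> Ded" and ng: "got c t T = None" "gtk c t T = None"
    and nex: "tph T \<in> {Snt, Rev} \<longrightarrow> \<not> exch c t T"
begin

abbreviation (input) "cm \<equiv> step bhs_alg deg port bh ids 6 M c"

lemma pr_ed: "graph.pr port T M \<longleftrightarrow> ed T \<notin> M"
  using pr_def[OF run one rel own geo, of M] by (simp add: ed_def)

lemma bh_phase: "tw T = bh \<Longrightarrow> tph T \<in> {Ord, Snt, Tst}"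
  using rel nd by (cases "tph T") (auto simp: teamrel_def)

lemma quiet_step:
  assumes q: "tph T \<in> {Snt, Tst, Rev, Saf} \<or> tph T = Ord \<and> (if tk T then \<not> xsw c t T else \<not> tx T \<and> \<not> ysk c t T) \<or>
      tph T = Cmp \<and> \<not> tarr T \<and> ttok T = None \<or> tph T = Blk \<and> tk T"
  shows "\<exists>T1. teamrel cm t T1 \<and> same T T1 \<and> crew T T1 \<and> tph T1 = nextph (ed T \<notin> M) (tw T \<noteq> bh) (tph T) \<and> tid T1 = tid T \<and>
     (tph T = Ord \<longrightarrow> tx T1 = (tx T \<or> ed T \<in> M)) \<and>
     (if tph T = Rev \<and> ttok T \<noteq> None then tk T1 \<and> Some (tmd T1) = ttok T \<and> tarr T1 \<and> ttok T1 = None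
      else tk T1 = tk T \<and> tmd T1 = tmd T \<and> tarr T1 = tarr T \<and> ttok T1 = (if tph T \<in> {Snt, Rev} then None else ttok T))"
proof -
  consider "tph T = Ord" | "tph T = Snt" | "tph T = Tst" | "tph T = Rev" | "tph T = Saf" | "tph T \<in> {Cmp, Blk}"
    using q by auto
  then show ?thesis
  proof cases
    case 1
    then have "if tk T then \<not> xsw c t T else \<not> tx T \<and> \<not> ysk c t T" using q by auto
    note s = step_Ord_try[OF run one rel own geo 1 this, of ids M]
    show ?thesis by (rule exI, rule conjI[OF s]) (auto simp: 1 pr_ed same_def crew_def)
  next
    case 2
    have "tw T \<noteq> bh \<Longrightarrow> \<not> exch c t T" using nex 2 by simp
    note s = step_Snt[OF run one rel own geo 2 this, of ids M]
    show ?thesis by (rule exI, rule conjI[OF s]) (auto simp: 2 ng pr_ed same_def crew_def)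
  next
    case 3
    note s = step_Tst[OF run one rel own geo 3, of ids M]
    show ?thesis by (rule exI, rule conjI[OF s]) (auto simp: 3 ng pr_ed same_def crew_def)
  next
    case 4
    have "\<not> exch c t T" using nex 4 by simp
    note s = step_Rev[OF run one rel own geo 4 this, of ids M]
    show ?thesis by (rule exI, rule conjI[OF s]) (auto simp: 4 ng pr_ed same_def crew_def split: option.split)
  next
    case 5
    note s = step_Saf[OF run one rel own geo 5, of ids M]
    show ?thesis by (rule exI, rule conjI[OF s]) (auto simp: 5 ng pr_ed same_def crew_def)
  next
    case 6
    then have "tph T = Cmp \<and> \<not> tarr T \<and> ttok T = None \<or> tph T = Blk \<and> tk T" using q by auto
    note s = step_go[OF run one rel own geo this, of ids M]
    show ?thesis by (rule exI, rule conjI[OF s]) (use 6 in \<open>auto simp: pr_ed same_def crew_def\<close>)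
  qed
qed

text \<open>A round without progress requires that the edge of the team is missing and that the team
  is in a situation that waits for it. As no port is ever skipped, connectivity keeps this search
  from being exhausted.\<close>

lemma X_step:
  assumes xk: "xkind rem m T" and nsw: "tph T = Ord \<longrightarrow> \<not> xsw c t T"
    and d: "dfs 1 (mk c True) {} st" and o: "ordr 1 (mk c True) st (ox rem T) (op rem T) m"
    and w: "\<forall>v. (\<forall>x. plc c (tl T) \<noteq> Th True x) \<or> v \<noteq> lpos T \<longrightarrow> mk cm True v = mk c True v"
    and con: "connected_on n E"
  shows "\<exists>T1 rem1 m1 st1. teamrel cm t T1 \<and> geo T1 \<and> xkind rem1 m1 T1 \<and> stp M T T1 \<and> crew T T1 \<and>
     dfs 1 (mk cm True) {} st1 \<and> ordr 1 (mk cm True) st1 (ox rem1 T1) (op rem1 T1) m1 \<and>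
     (xrk (mk c True) rem m T < xrk (mk cm True) rem1 m1 T1 \<or>
      xrk (mk c True) rem m T = xrk (mk cm True) rem1 m1 T1 \<and> ed T \<in> M \<and> ed T1 = ed T \<and> tph T \<in> {Ord, Tst, Saf, Blk})"
proof (cases "tph T = Crs \<or> tph T = Cmp \<and> rem")
  case True
  \<comment> \<open>Where the pending move ends. With \<open>rem\<close> it starts at the far end,
    so it ends at the leader's own node as soon as the scout is back.\<close>
  define y where "y = (if rem then tu T else tw T)"
  define e where "e = (if rem then tp T else tr T)"
  have y: "port (ox rem T) (op rem T) = y" "rp (ox rem T) (op rem T) = e"
    using tr_lt[OF geo] by (auto simp: y_def e_def ox_def op_def)
  have Crs: "tph T = Crs \<Longrightarrow> \<not> rem" using xk by (auto simp: xkind_def)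
  have yb: "y \<noteq> bh" "y = lpos T" "y < n"
    using rel geo True Crs tr_lt[OF geo] by (auto simp: y_def geo_def teamrel_def lpos_def)
  obtain mk' p b j where th: "think True (Arr e m) (mk c True y) (deg y) (tck T) (tid T) = (mk', p, b, j)"
    using prod_cases4 by blast
  have s: "teamrel cm t (reord T y True p b j)" "mk cm True y = mk'"
  proof -
    have "teamrel cm t (reord T y True p b j) \<and> mk cm True y = mk'"
    proof (cases rem)
      case True
      then have ph: "tph T = Cmp" using \<open>tph T = Crs \<or> _\<close> Crs by auto
      have k: "tarr T \<and> ttok T = None \<and> True = tk T \<and> m = tmd T \<or> \<not> tarr T \<and> ttok T = Some m \<and> True"
        using xk True by (auto simp: xkind_def)
      have yy: "y = tu T" "e = tp T" using True by (auto simp: y_def e_def)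
      show ?thesis using step_Cmp_think(1,2)[OF run one rel own geo ph k th[unfolded yy], of ids M] by (simp add: yy)
    next
      case False
      then have ph: "tph T = Crs" using \<open>tph T = Crs \<or> _\<close> by auto
      have k: "tk T" "tmd T = m" using xk False by (auto simp: xkind_def)
      have yy: "y = tw T" "e = tr T" using False by (auto simp: y_def e_def)
      show ?thesis using step_Crs(1,2)[OF run one rel own geo ph, of mk' p b j ids M] th k by (simp add: yy)
    qed
    then show "teamrel cm t (reord T y True p b j)" "mk cm True y = mk'" by auto
  qed
  have g: "mk cm True = (mk c True)(y := mk')"
    using w s(2) yb(2) by (intro ext) auto
  have nc: "\<not> closed_in {} y" using not_closed[of "{}" y E] con by auto
  have a: "\<exists>st'. dfs 1 (mk cm True) {} st' \<and> ordr 1 (mk cm True) st' y p b \<and> rk 1 (mk c True) m + 20 \<le> rk 1 (mk cm True) b"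
    using think_arrive[OF d o, of True "tid T" "tck T" mk' p b j] yb nc th unfolding y g by auto
  then obtain st' where st': "dfs 1 (mk cm True) {} st'" "ordr 1 (mk cm True) st' y p b" "rk 1 (mk c True) m + 20 \<le> rk 1 (mk cm True) b"
    by blast
  let ?T1 = "reord T y True p b j"
  have "geo ?T1" using st'(2) yb geo by (auto simp: geo_def ordr_def reord_def)
  moreover have "xkind False b ?T1" by (simp add: xkind_def reord_def)
  moreover have "stp M T ?T1" by (simp add: stp_def sub_reord)
  moreover have "xrk (mk c True) rem m T < xrk (mk cm True) False b ?T1"
    using st'(3) sub_le[of T] by (auto simp: xrk_def sub_reord)
  ultimately show ?thesis using s(1) st' sub_reord(8)
    by (intro exI[of _ ?T1] exI[of _ False] exI[of _ b] exI[of _ st']) (simp add: ox_def op_def sub_reord)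
next
  case False
  have q: "tph T \<in> {Snt, Tst, Rev, Saf} \<or> tph T = Ord \<and> (if tk T then \<not> xsw c t T else \<not> tx T \<and> \<not> ysk c t T) \<or>
      tph T = Cmp \<and> \<not> tarr T \<and> ttok T = None \<or> tph T = Blk \<and> tk T"
    using False xk nsw nd by (cases "tph T") (auto simp: xkind_def split: if_splits)
  have nt: "plc c (tl T) \<noteq> Th True x" for x
    using leader_Th[OF rel own geo, of True x] False xk by (auto simp: xkind_def split: if_splits)
  have g: "mk cm True = mk c True" using w nt by (intro ext) auto
  from quiet_step[OF q] obtain T1 where T1: "teamrel cm t T1" "same T T1" "crew T T1"
     "tph T1 = nextph (ed T \<notin> M) (tw T \<noteq> bh) (tph T)" "tid T1 = tid T"
     "(tph T = Ord \<longrightarrow> tx T1 = (tx T \<or> ed T \<in> M))"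
     "(if tph T = Rev \<and> ttok T \<noteq> None then tk T1 \<and> Some (tmd T1) = ttok T \<and> tarr T1 \<and> ttok T1 = None
      else tk T1 = tk T \<and> tmd T1 = tmd T \<and> tarr T1 = tarr T \<and> ttok T1 = (if tph T \<in> {Snt, Rev} then None else ttok T))"
    by blast
  note sm = sameD[OF T1(2)]
  have xk1: "xkind rem m T1"
    using xk T1(4,7) sm q by (cases "tph T"; cases rem) (auto simp: xkind_def split: if_splits)
  have o1: "ordr 1 (mk cm True) st (ox rem T1) (op rem T1) m" using o by (cases rem) (simp_all add: g ox_def op_def sm)
  have "sub T < sub T1 \<or> sub T = sub T1 \<and> ed T \<in> M \<and> tph T \<in> {Ord, Tst, Saf, Blk}"
    using T1(4,6) False nd bh_phase by (cases "tph T") (auto simp: sub_def split: if_splits)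
  then have "xrk (mk c True) rem m T < xrk (mk cm True) rem m T1 \<or>
      xrk (mk c True) rem m T = xrk (mk cm True) rem m T1 \<and> ed T \<in> M \<and> ed T1 = ed T \<and> tph T \<in> {Ord, Tst, Saf, Blk}"
    by (auto simp: xrk_def g sm)
  moreover have "stp M T T1" using T1(2,4) by (simp add: stp_def)
  ultimately show ?thesis using T1(1,3) geo_same[OF geo T1(2,3)] xk1 d o1 unfolding g by blast
qed

text \<open>If \<open>e\<close> is the only missing edge, every failed attempt concerns
  \<open>e\<close>, and so does every skip by assumption; hence \<open>FR\<close> persists, and
  exhaustion would give a set closed in the connected graph without \<open>e\<close>. A search
  violating \<open>FR\<close> advances or restarts, and a restart establishes \<open>FR\<close>. The
  side conditions exclude skips at other edges and a futile wait for the own scout; for two teams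
  they come from \<open>YSK\<close> and \<open>EXC\<close>.\<close>

lemma Y_step:
  assumes yk: "ykind T" and n1: "1 < n"
    and d: "dfs (tid T) (mk c False) K st" and o: "ordr (tid T) (mk c False) st (tu T) (tp T) (tmd T)"
    and fresh: "\<forall>v<n. fst (mk c False v) < tck T"
    and w: "\<forall>v. (\<forall>x. plc c (tl T) \<noteq> Th False x) \<or> v \<noteq> lpos T \<longrightarrow> mk cm False v = mk c False v"
    and con: "\<forall>e. M = {e} \<longrightarrow> connected_on n (E - M)"
  shows "\<exists>T1 st1 K1. teamrel cm t T1 \<and> geo T1 \<and> ykind T1 \<and> stp M T T1 \<and> crew T T1 \<and>
     dfs (tid T1) (mk cm False) K1 st1 \<and> ordr (tid T1) (mk cm False) st1 (tu T1) (tp T1) (tmd T1) \<and>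
     (\<forall>v<n. fst (mk cm False v) < tck T1) \<and> (tph T = Ord \<and> tph T1 = Snt \<longrightarrow> \<not> ysk c t T) \<and>
     (\<forall>e. M = {e} \<and> (tph T = Ord \<and> ysk c t T \<longrightarrow> ed T = e) \<and> (tph T \<in> {Tst, Saf} \<longrightarrow> ed T \<noteq> e) \<longrightarrow>
        yms e (mk c False) T st K < yms e (mk cm False) T1 st1 K1)"
proof -
  let ?g = "mk c False" and ?g1 = "mk cm False" and ?i = "tid T"
  have y: "\<not> tk T" "\<not> tarr T" "ttok T = None" using yk by (auto simp: ykind_def)
  have yl: "yrk ?g T < RB" using rk_le[OF d n1, of "tmd T"] sub_le[of T] by (simp add: yrk_def)
  have dg: "0 < deg v" if "v < n" for v using deg_pos that n1 by blast
  \<comment> \<open>A restart is harmless where \<open>FR\<close> fails: the bonus outweighs the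
    abandoned rank, and the identifier \<open>tck T\<close> exceeds all marks.\<close>
  have restart: ?thesis if rs: "teamrel cm t (reord T v False 0 True (tck T))" "?g1 v = (tck T, 0, 0)"
     "v = lpos T" "\<And>e. M = {e} \<Longrightarrow> (tph T = Ord \<and> ysk c t T \<longrightarrow> ed T = e) \<Longrightarrow> \<not> FR e T st K" for v
  proof -
    let ?T1 = "reord T v False 0 True (tck T)"
    have v: "v < n" "v \<noteq> bh" using rs(3) geo rel tr_lt[OF geo] by (auto simp: lpos_def geo_def teamrel_def)
    have g: "?g1 = ?g(v := (tck T, 0, 0))" using w rs(2,3) by (intro ext) auto
    have dd: "dfs (tck T) ?g1 {} [v]" "ordr (tck T) ?g1 [v] v 0 True"
      unfolding g using restart_dfs[OF v dg[OF v(1)], of "?g" "tck T"] fresh by (auto dest: order.strict_implies_not_eq)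
    have FR: "FR e ?T1 [v] {}" for e by (simp add: FR_def sub_reord)
    have "geo ?T1" using geo v dg by (auto simp: geo_def reord_def)
    moreover have "\<forall>u<n. fst (?g1 u) < tck ?T1" using fresh by (auto simp: g sub_reord less_Suc_eq)
    moreover have "yms e ?g T st K < yms e ?g1 ?T1 [v] {}"
      if "M = {e}" "tph T = Ord \<and> ysk c t T \<longrightarrow> ed T = e" for e
      using yms_restart[OF rs(4)[OF that] FR yl] .
    then have "\<forall>e. M = {e} \<and> (tph T = Ord \<and> ysk c t T \<longrightarrow> ed T = e) \<and> (tph T \<in> {Tst, Saf} \<longrightarrow> ed T \<noteq> e) \<longrightarrow>
        yms e ?g T st K < yms e ?g1 ?T1 [v] {}" by blast
    ultimately show ?thesis using rs(1) dd
      by (intro exI[of _ ?T1] exI[of _ "[v]"] exI[of _ "{}"]) (simp add: ykind_def sub_reord stp_def)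
  qed
  have think_go: ?thesis if rs: "teamrel cm t (reord T v False p b j)" "v = lpos T" "j = tid T"
      "dfs ?i ?g1 K' st'" "ordr ?i ?g1 st' v p b"
      "?g1 = ?g(v := mk')" "tph T \<in> {Ord, Crs} \<and> rk ?i ?g (tmd T) + 20 \<le> rk ?i ?g1 b"
      "\<And>e. FR e T st K \<Longrightarrow> (tph T = Ord \<and> ysk c t T \<longrightarrow> ed T = e) \<Longrightarrow> FR e (reord T v False p b j) st' K'"
    for v p b j st' K' mk'
  proof -
    let ?T1 = "reord T v False p b j"
    have v: "v < n" "v \<noteq> bh" using rs(2) geo rel tr_lt[OF geo] by (auto simp: lpos_def geo_def teamrel_def)
    have "vis ?i ?g1 v" "vis ?i ?g (tu T)" using rs(5) o by (auto simp: ordr_def)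
    then have f: "fst (?g1 v) = tid T" "tid T < tck T" using fresh by (auto simp: vis_def)
    have "geo ?T1" using geo v rs(5) by (auto simp: geo_def reord_def ordr_def)
    moreover have "\<forall>u<n. fst (?g1 u) < tck ?T1" using fresh f by (auto simp: rs(6) sub_reord less_Suc_eq)
    moreover have "yms e ?g T st K < yms e ?g1 ?T1 st' K'"
      if "tph T = Ord \<and> ysk c t T \<longrightarrow> ed T = e" for e
    proof (rule yms_less)
      show "yrk ?g T < yrk ?g1 ?T1" using rs(3,7) sub_le[of T] by (simp add: yrk_def sub_reord)
    qed (rule rs(8)[OF _ that])
    then have "\<forall>e. M = {e} \<and> (tph T = Ord \<and> ysk c t T \<longrightarrow> ed T = e) \<and> (tph T \<in> {Tst, Saf} \<longrightarrow> ed T \<noteq> e) \<longrightarrow>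
        yms e ?g T st K < yms e ?g1 ?T1 st' K'" by blast
    ultimately show ?thesis using rs(1,3,4,5)
      by (intro exI[of _ ?T1] exI[of _ st'] exI[of _ K']) (simp add: ykind_def sub_reord stp_def)
  qed
  have cl: "\<not> closed_in K' v" if "M = {e}" "\<forall>(v, j)\<in>K'. {v, port v j} = e" for e v K'
    using not_closed[of K' v "E - M"] con[rule_format, OF that(1)] that by fastforce
  show ?thesis
  proof (cases "tph T = Ord \<and> (tx T \<or> ysk c t T) \<or> tph T = Crs \<or> tph T = Blk")
    case False
    then have q: "tph T \<in> {Snt, Tst, Rev, Saf} \<or> tph T = Ord \<and> (if tk T then \<not> xsw c t T else \<not> tx T \<and> \<not> ysk c t T) \<or>
      tph T = Cmp \<and> \<not> tarr T \<and> ttok T = None \<or> tph T = Blk \<and> tk T"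
      using y nd by (cases "tph T") auto
    have nt: "plc c (tl T) \<noteq> Th False x" for x
      using leader_Th[OF rel own geo, of False x] False y by auto
    have g: "?g1 = ?g" using w nt by (intro ext) auto
    from quiet_step[OF q] obtain T1 where T1: "teamrel cm t T1" "same T T1" "crew T T1"
     "tph T1 = nextph (ed T \<notin> M) (tw T \<noteq> bh) (tph T)" "tid T1 = tid T"
     "(tph T = Ord \<longrightarrow> tx T1 = (tx T \<or> ed T \<in> M))"
     "tk T1 = tk T" "tmd T1 = tmd T" "tarr T1 = tarr T" "ttok T1 = None"
      using y by (auto split: if_splits)
    note sm = sameD[OF T1(2)]
    have "yms e ?g T st K < yms e ?g1 T1 st K"
      if e: "M = {e}" "tph T \<in> {Tst, Saf} \<longrightarrow> ed T \<noteq> e" for e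
    proof (rule yms_less)
      show "yrk ?g T < yrk ?g1 T1"
      proof -
        have "tph T \<in> {Tst, Saf} \<longrightarrow> ed T \<notin> M" "tph T = Ord \<longrightarrow> \<not> tx T" using e False by auto
        then have "sub T < sub T1"
          using T1(4,6) False nd bh_phase by (cases "tph T") (auto simp: sub_def split: if_splits)
        then show ?thesis using T1(5,8) by (simp add: yrk_def g)
      qed
      show "FR e T1 st K" if "FR e T st K"
        using that T1(4,6,8) e False nd sm(3) by (cases "tph T") (auto simp: FR_def split: if_splits)
    qed
    moreover have "stp M T T1" using T1(2,4) by (simp add: stp_def)
    moreover have "ykind T1" using T1 y by (simp add: ykind_def)
    moreover have "\<forall>v<n. fst (?g1 v) < tck T1" using fresh T1(3) by (auto simp: g crew_def less_Suc_eq)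
    moreover have "tph T = Ord \<and> tph T1 = Snt \<longrightarrow> \<not> ysk c t T" using False by auto
    moreover have "ordr (tid T1) ?g1 st (tu T1) (tp T1) (tmd T1)" using o by (simp add: g T1 sm)
    moreover have "dfs (tid T1) ?g1 K st" using d by (simp add: g T1(5))
    ultimately show ?thesis using T1(1,3) geo_same[OF geo T1(2,3)]
      by (intro exI[of _ T1] exI[of _ st] exI[of _ K] conjI) blast+
  next
    case True
    then consider "tph T = Crs" | "tph T = Blk" | "tph T = Ord" "tx T \<or> ysk c t T" by auto
    then show ?thesis
    proof cases
      case 2
      have "think False Restart (?g (tu T)) (deg (tu T)) (tck T) ?i = ((tck T, 0, 0), 0, True, tck T)"
        by (cases "?g (tu T)") simp
      note s = step_Blk_think(1,2)[OF run one rel own geo 2 y(1) this, of ids M]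
      show ?thesis
      proof (rule restart[OF s(1,2)])
        show "tu T = lpos T" using 2 by (simp add: lpos_def)
        fix e assume e: "M = {e}"
        show "\<not> FR e T st K" using 2 by (simp add: FR_def)
      qed
    next
      case 1
      obtain mk' p b j where th: "think False (Arr (tr T) (tmd T)) (?g (tw T)) (deg (tw T)) (tck T) ?i = (mk', p, b, j)"
        using prod_cases4 by blast
      have s: "teamrel cm t (reord T (tw T) False p b j)" "?g1 (tw T) = mk'"
        using step_Crs(1,2)[OF run one rel own geo 1, of mk' p b j ids M] th y by auto
      have wb: "tw T \<noteq> bh" "tw T = lpos T" using rel 1 by (auto simp: teamrel_def lpos_def)
      have g: "?g1 = ?g(tw T := mk')" using w s(2) wb(2) by (intro ext) auto
      from think_arrive[OF d o, of False "tid T" "tck T" mk' p b j] wb th tr_lt[OF geo]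
      have "(\<exists>st'. j = tid T \<and> dfs ?i ?g1 K st' \<and> ordr ?i ?g1 st' (tw T) p b \<and>
            rk ?i ?g (tmd T) + 20 \<le> rk ?i ?g1 b \<and>
            (\<forall>e. avoids e st \<and> ed T \<noteq> e \<longrightarrow> avoids e st' \<and> (\<not> b \<longrightarrow> {tw T, port (tw T) p} \<noteq> e)))
          \<or> closed_in K (tw T) \<and> (mk', p, b, j) = ((tck T, 0, 0), 0, True, tck T)"
        unfolding g by (simp add: ed_def)
      then show ?thesis
      proof (elim disjE exE conjE)
        fix st' assume h: "j = tid T" "dfs ?i ?g1 K st'" "ordr ?i ?g1 st' (tw T) p b"
            "rk ?i ?g (tmd T) + 20 \<le> rk ?i ?g1 b"
            "\<forall>e. avoids e st \<and> ed T \<noteq> e \<longrightarrow> avoids e st' \<and> (\<not> b \<longrightarrow> {tw T, port (tw T) p} \<noteq> e)"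
        let ?T1 = "reord T (tw T) False p b j"
        have FR: "FR e ?T1 st' K" if "FR e T st K" for e
        proof -
          have "ed ?T1 = {tw T, port (tw T) p}" by (simp add: ed_def sub_reord tw_def[of ?T1])
          then show ?thesis using that h(5) 1 by (auto simp: FR_def sub_reord)
        qed
        show ?thesis by (rule think_go[OF s(1) _ h(1-3) _ _ FR]) (use h(4) g wb 1 in auto)
      next
        assume h: "closed_in K (tw T)" "(mk', p, b, j) = ((tck T, 0, 0), 0, True, tck T)"
        show ?thesis
        proof (rule restart[OF _ _ wb(2)])
          show "teamrel cm t (reord T (tw T) False 0 True (tck T))" "?g1 (tw T) = (tck T, 0, 0)" using s h(2) by auto
          fix e assume "M = {e}"
          then show "\<not> FR e T st K" using cl[of e K "tw T"] h(1) by (auto simp: FR_def)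
        qed
      qed
    next
      case 3
      have lu: "tu T = lpos T" using 3 by (simp add: lpos_def)
      show ?thesis
      proof (cases "tmd T")
        case False
        have "think False Restart (?g (tu T)) (deg (tu T)) (tck T) ?i = ((tck T, 0, 0), 0, True, tck T)"
          by (cases "?g (tu T)") simp
        note s = step_Ord_think(1,2)[OF run one rel own geo 3(1), of "(tck T, 0, 0)" 0 True "tck T" ids M]
        have s': "teamrel cm t (reord T (tu T) False 0 True (tck T))" "?g1 (tu T) = (tck T, 0, 0)"
          using s 3 y False \<open>think False Restart _ _ _ _ = _\<close> by auto
        show ?thesis
        proof (rule restart[OF s' lu])
          \<comment> \<open>Being hindered here means standing at \<open>e\<close>, but a search
            satisfying \<open>FR\<close> never backtracks through \<open>e\<close>.\<close>
          fix e assume "M = {e}" "tph T = Ord \<and> ysk c t T \<longrightarrow> ed T = e"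
          then show "\<not> FR e T st K" using 3 False by (auto simp: FR_def)
        qed
      next
        case True
        obtain mk' p b j where th: "think False SkipF (?g (tu T)) (deg (tu T)) (tck T) ?i = (mk', p, b, j)"
          using prod_cases4 by blast
        have s: "teamrel cm t (reord T (tu T) False p b j)" "?g1 (tu T) = mk'"
          using step_Ord_think(1,2)[OF run one rel own geo 3(1), of mk' p b j ids M] th y 3 True by auto
        have g: "?g1 = ?g(tu T := mk')" using w s(2) lu by (intro ext) auto
        let ?K = "insert (tu T, tp T) K"
        have o': "ordr ?i ?g st (tu T) (tp T) True" using o True by simp
        from think_skip[OF d o' th]
        show ?thesis unfolding g[symmetric]
        proof (elim disjE exE conjE)
          fix st' assume h: "j = tid T" "dfs ?i ?g1 ?K st'" "ordr ?i ?g1 st' (tu T) p b"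
              "rk ?i ?g True + 20 \<le> rk ?i ?g1 b"
              "\<forall>e. avoids e st \<longrightarrow> avoids e st' \<and> (\<not> b \<longrightarrow> {tu T, port (tu T) p} \<noteq> e)"
          let ?T1 = "reord T (tu T) False p b j"
          have FR: "FR e ?T1 st' ?K" if "FR e T st K" "tph T = Ord \<and> ysk c t T \<longrightarrow> ed T = e" for e
          proof -
            have "ed T = e" using that 3 by (auto simp: FR_def)
            then have "{tu T, port (tu T) (tp T)} = e" by (simp add: ed_def tw_def)
            then show ?thesis using that h(5) by (auto simp: FR_def sub_reord ed_def tw_def)
          qed
          show ?thesis by (rule think_go[OF s(1) _ h(1-3) _ _ FR]) (use h(4) g lu 3 True in auto)
        next
          assume h: "closed_in ?K (tu T)" "(mk', p, b, j) = (((if False then 1 else tck T), 0, 0), 0, True, tck T)"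
          show ?thesis
          proof (rule restart[OF _ _ lu])
            show "teamrel cm t (reord T (tu T) False 0 True (tck T))" "?g1 (tu T) = (tck T, 0, 0)" using s h(2) by auto
            fix e assume e: "M = {e}" "tph T = Ord \<and> ysk c t T \<longrightarrow> ed T = e"
            show "\<not> FR e T st K"
            proof
              assume f: "FR e T st K"
              then have "ed T = e" using e 3 by (auto simp: FR_def)
              then have "\<forall>(v, j)\<in>?K. {v, port v j} = e" using f by (auto simp: FR_def ed_def tw_def)
              then show False using cl[of e ?K "tu T"] h(1) e by blast
            qed
          qed
        qed
      qed
    qed
  qed
qed

end

end

section \<open>The joint invariant\<close>

context graph
begin

lemma EXCH_ed: "geo T \<Longrightarrow> EXCH T T' \<Longrightarrow> ed T = ed T' \<and> tu T \<noteq> tu T'"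
  using tr_lt(2)[of T] geo_uw[of T] by (simp add: EXCH_def ed_def tw_def[of T'] insert_commute)

text \<open>\<open>T\<close> is the team of the global search and \<open>T'\<close> the other one;
  \<open>t\<close> changes with every swap. The clocks agree because after a swap the former global
  team restarts with its own clock as identifier, which must exceed all marks written by the other
  team.\<close>

definition inv :: "cfg \<Rightarrow> bool \<Rightarrow> team \<Rightarrow> team \<Rightarrow> bool \<Rightarrow> bool \<Rightarrow> nat list \<Rightarrow> nat list \<Rightarrow> (nat \<times> nat) set \<Rightarrow> bool" where
  "inv c t T T' rem m st st' K \<longleftrightarrow>
     teamrel c t T \<and> teamrel c (\<not> t) T' \<and> geo T \<and> geo T' \<and>
     {ta T, tb T, tl T, ta T', tb T', tl T'} = {..<6} \<and> (\<forall>i<6. ag_out (ags c i) = None) \<and>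
     xkind rem m T \<and> ykind T' \<and> tck T = tck T' \<and> (\<forall>v<n. fst (mk c False v) < tck T') \<and> EXC T T' \<and>
     dfs 1 (mk c True) {} st \<and> ordr 1 (mk c True) st (ox rem T) (op rem T) m \<and>
     dfs (tid T') (mk c False) K st' \<and> ordr (tid T') (mk c False) st' (tu T') (tp T') (tmd T')"

text \<open>Every round in which the global search makes no progress is spent with its edge missing, and then
the other search progresses.\<close>
definition Phi :: "cfg \<Rightarrow> team \<Rightarrow> team \<Rightarrow> bool \<Rightarrow> bool \<Rightarrow> nat list \<Rightarrow> (nat \<times> nat) set \<Rightarrow> nat" where
  "Phi c T T' rem m st' K = xrk (mk c True) rem m T * (2 * RB) + yms (ed T) (mk c False) T' st' K"

context
  fixes c t T T' rem m st st' K
  assumes inv: "inv c t T T' rem m st st' K" and n1: "1 < n"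
begin

lemma invD: "teamrel c t T" "teamrel c (\<not> t) T'" "geo T" "geo T'"
  "{ta T, tb T, tl T, ta T', tb T', tl T'} = {..<6}" "i < 6 \<Longrightarrow> ag_out (ags c i) = None"
  "xkind rem m T" "ykind T'" "tck T = tck T'" "\<forall>v<n. fst (mk c False v) < tck T'" "EXC T T'"
  "dfs 1 (mk c True) {} st" "ordr 1 (mk c True) st (ox rem T) (op rem T) m"
  "dfs (tid T') (mk c False) K st'" "ordr (tid T') (mk c False) st' (tu T') (tp T') (tmd T')"
  using inv by (auto simp: inv_def)

lemma owns: "own c t T" "own c (\<not> t) T'"
  using ownI[OF invD(1-5)] by auto

lemma own': "own c (\<not> \<not> t) T"
  using owns(1) by simp

lemma member: "i < 6 \<Longrightarrow> i \<in> {ta T, tb T, tl T} \<or> i \<in> {ta T', tb T', tl T'}"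
  using invD(5) by blast

lemmas relX = invD(1) owns(1) invD(3)
lemmas relY = invD(2) owns(2) invD(4)

lemma run: "running c"
  unfolding running_def
  using member team_running[OF relX] team_running[OF relY] by blast

lemma xordD: "tph T = Ord \<Longrightarrow> tk T \<and> \<not> rem \<and> tmd T = m"
  using invD(7) by (auto simp: xkind_def split: if_splits)

lemmas flags = xsw_iff[OF owns invD(3,4)] got_iff[OF owns invD(3,4)] gtk_iff[OF owns invD(3,4)] exch_iff[OF owns invD(3,4)]
lemma flags': "got c t T = None" "gtk c t T = None" "exch c (\<not> t) T' \<longleftrightarrow> EXCH T' T"
   "tph T' = Ord \<Longrightarrow> ysk c (\<not> t) T' \<longleftrightarrow> YSK T' T"
  using got_iff[OF owns(2) own' invD(4,3)] gtk_iff[OF owns(2) own' invD(4,3)] exch_iff[OF owns(2) own' invD(4,3)]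
    ysk_iff[OF owns(2) own' invD(4,3)] invD(8) by (auto simp: SW1_def SW2_def ykind_def)

lemma X_Th: "plc c (tl T) = Th k x \<Longrightarrow> k \<or> SW1 T T' \<or> SW2 T T'"
  using leader_Th[OF relX] invD(7) by (fastforce simp: flags(1) xkind_def split: if_splits)

lemma Y_Th: "plc c (tl T') = Th k x \<Longrightarrow> \<not> k \<and> tph T' \<in> {Ord, Blk, Crs}"
  using leader_Th[OF relY] invD(8) by (fastforce simp: ykind_def)

lemma Th_leader: assumes "i < 6" "alv c i" "plc c i = Th k x" shows "i = tl T \<or> i = tl T'"
  using member[OF assms(1)] member_plan[OF relX, of i] member_plan[OF relY, of i] assms by auto

text \<open>The leader of the global search writes into the other search only when it swaps; a swap
  needs the other team to be split, and a split team writes nothing.\<close>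

lemma XY_Th: "plc c (tl T) = Th k x \<Longrightarrow> plc c (tl T') = Th k y \<Longrightarrow> False"
  using X_Th[of k x] Y_Th[of k y] by (auto simp: SW1_def SW2_def)

lemma one: "one_writer c"
  unfolding one_writer_def using Th_leader XY_Th by metis

lemma locs: "loc c (tl T) v s \<Longrightarrow> v = lpos T" "loc c (tl T') v s \<Longrightarrow> v = lpos T'"
  using leader_loc(1)[OF relX] leader_loc(1)[OF relY] by (auto simp: loc_def)

section \<open>Joint rounds: termination, swap, exchange and the ordinary case\<close>

context
  fixes ids :: "nat \<Rightarrow> nat" and M :: "nat set set"
begin

abbreviation (input) "cs \<equiv> step bhs_alg deg port bh ids 6 M c"

lemma marks: assumes "(\<forall>x. plc c (tl T) \<noteq> Th k x) \<or> v \<noteq> lpos T" "(\<forall>x. plc c (tl T') \<noteq> Th k x) \<or> v \<noteq> lpos T'"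
  shows "mk cs k v = mk c k v"
proof (rule mk_unwritten[OF run one])
  fix i s x assume i: "i < 6" "loc c i v s"
  show "plc c i \<noteq> Th k x"
  proof
    assume p: "plc c i = Th k x"
    have "alv c i" using i by (auto simp: loc_def)
    from Th_leader[OF i(1) this p] show False using p assms locs i by blast
  qed
qed

lemma Halt_leader:
  assumes "i < 6" "ag_out (ags cs i) = Some p"
  shows "alv c i \<and> (i = tl T \<and> tph T = Ded \<and> p = tp T \<or> i = tl T' \<and> tph T' = Ded \<and> p = tp T')"
proof -
  have a: "alv c i"
  proof (rule ccontr)
    assume "\<not> alv c i"
    then have "ags cs i = ags c i" by (simp add: step_def upd_agent_def Let_def)
    then show False using assms invD(6)[OF assms(1)] by simp
  qed
  obtain v s s' where h: "loc c i v s" "plc c i = Do s' (Halt p)" using out_step[OF run one assms a] by blast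
  have "i = tl T \<or> i = tl T'"
    using member[OF assms(1)] member_plan[OF relX, of i] member_plan[OF relY, of i] a h by auto
  then show ?thesis
    using leader_Halt[OF relX] leader_Halt[OF relY] a h(2) by auto
qed

lemma halting:
  assumes "tph T = Ded \<or> tph T' = Ded"
  shows "(\<exists>i<6. alv cs i \<and> ag_out (ags cs i) \<noteq> None) \<and>
     (\<forall>i<6. \<forall>p. ag_out (ags cs i) = Some p \<longrightarrow> alv cs i \<and> p < deg (ag_pos (ags cs i)) \<and> port (ag_pos (ags cs i)) p = bh)"
proof -
  have X: "alv cs (tl T) \<and> ag_out (ags cs (tl T)) = Some (tp T) \<and> ag_pos (ags cs (tl T)) = tu T \<and> port (tu T) (tp T) = bh" if "tph T = Ded"
    using halt_step[OF run one _ leader_loc(1)[OF relX] plan_Ded[OF relX that], of deg port bh ids M]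
      invD(3,1) that by (auto simp: geo_def lpos_def teamrel_def tw_def)
  have Y: "alv cs (tl T') \<and> ag_out (ags cs (tl T')) = Some (tp T') \<and> ag_pos (ags cs (tl T')) = tu T' \<and> port (tu T') (tp T') = bh" if "tph T' = Ded"
    using halt_step[OF run one _ leader_loc(1)[OF relY] plan_Ded[OF relY that], of deg port bh ids M]
      invD(4,2) that by (auto simp: geo_def lpos_def teamrel_def tw_def)
  have "\<exists>i<6. alv cs i \<and> ag_out (ags cs i) \<noteq> None"
    using assms X Y invD(3,4) by (auto simp: geo_def)
  moreover have "alv cs i \<and> p < deg (ag_pos (ags cs i)) \<and> port (ag_pos (ags cs i)) p = bh"
    if "i < 6" "ag_out (ags cs i) = Some p" for i p
    using Halt_leader[OF that] X Y invD(3,4) by (auto simp: geo_def)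
  ultimately show ?thesis by blast
qed

lemma outs: "tph T \<noteq> Ded \<Longrightarrow> tph T' \<noteq> Ded \<Longrightarrow> \<forall>i<6. ag_out (ags cs i) = None"
  using Halt_leader by fastforce

lemma x_bound: "xrk (mk c True) rem m T < RB"
  using rk_le[OF invD(12) n1, of m] sub_le[of T] by (simp add: xrk_def)

lemma y_bound: "yms e (mk c False) T' st' K < 2 * RB"
  using rk_le[OF invD(14) n1, of "tmd T'"] sub_le[of T'] by (simp add: yms_def yrk_def)

lemma Phi_bound: "Phi c T T' rem m st' K < 2 * RB * RB"
proof -
  have "Phi c T T' rem m st' K < (xrk (mk c True) rem m T + 1) * (2 * RB)" using y_bound[of "ed T"] by (simp add: Phi_def)
  also have "\<dots> \<le> RB * (2 * RB)" using x_bound by (intro mult_right_mono) auto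
  finally show ?thesis by (simp add: algebra_simps)
qed

text \<open>One unit of the global rank outweighs any loss in the second component, which stays
  below \<open>2 * RB\<close>; what becomes of the second search is then irrelevant.\<close>

lemma Phi_up: "xrk (mk c True) rem m T < xrk (mk c2 True) rem2 m2 T2 \<Longrightarrow> Phi c T T' rem m st' K < Phi c2 T2 T2' rem2 m2 st2' K2"
proof -
  assume a: "xrk (mk c True) rem m T < xrk (mk c2 True) rem2 m2 T2"
  have "Phi c T T' rem m st' K < (xrk (mk c True) rem m T + 1) * (2 * RB)" using y_bound[of "ed T"] by (simp add: Phi_def)
  also have "\<dots> \<le> xrk (mk c2 True) rem2 m2 T2 * (2 * RB)" using a by (intro mult_right_mono) auto
  finally show ?thesis by (simp add: Phi_def)
qed

text \<open>The split team inherits marks and stack of the global search unchanged, while the intact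
  team restarts on a stack of one node. The potential rises because \<open>sub\<close> jumps from at
  most 1 in \<open>Ord\<close> to at least 3.\<close>

lemma round_swap:
  assumes sw: "SW1 T T' \<or> SW2 T T'"
  shows "\<exists>t2 T2 T2' rem2 m2 st2 st2' K2. inv cs t2 T2 T2' rem2 m2 st2 st2' K2 \<and>
     Phi c T T' rem m st' K < Phi cs T2 T2' rem2 m2 st2' K2"
proof -
  have o: "tph T = Ord" and p: "tph T' \<in> {Snt, Tst, Saf}" using sw by (auto simp: SW1_def SW2_def)
  have nd: "tph T \<noteq> Ded" "tph T' \<noteq> Ded" using o p by auto
  note k = xordD[OF o]
  have lT: "lpos T = tu T" using o by (simp add: lpos_def)
  have excl: "\<not> (SW1 T T' \<and> SW2 T T')" using geo_uw[OF invD(4)] by (auto simp: SW1_def SW2_def)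
  let ?Y = "reord T (tu T) False 0 True (tck T)"
  have th: "think False Restart (mk c False (tu T)) (deg (tu T)) (tck T) (tid T) = ((tck T, 0, 0), 0, True, tck T)"
    by (cases "mk c False (tu T)") simp
  have Y: "teamrel cs t ?Y" "mk cs False (tu T) = (tck T, 0, 0)"
    using step_Ord_think(1,2)[OF run one relX o, of "(tck T, 0, 0)" 0 True "tck T" ids M] k sw th by (auto simp: flags)
  have nY: "plc c (tl T') \<noteq> Th k x" for k x using Y_Th[of k x] p by auto
  have XT: "plc c (tl T) = Th False Restart"
    using plan_Ord(1)[OF relX o] k sw by (simp add: flags)
  have gT: "mk cs True = mk c True" by (rule ext, rule marks) (auto simp: XT nY)
  have gF: "mk cs False = (mk c False)(tu T := (tck T, 0, 0))"
  proof
    fix v show "mk cs False v = ((mk c False)(tu T := (tck T, 0, 0))) v"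
      using Y(2) marks[of False v] by (cases "v = tu T") (auto simp: lT nY)
  qed
  have nex: "\<not> exch c (\<not> t) T'" using o by (simp add: flags' EXCH_def)
  obtain X where X: "teamrel cs (\<not> t) X" "same T' X" "crew T' X" "tph X \<in> {Tst, Cmp, Rev, Saf, Ded}"
      "tarr X = tarr T'" "tx X \<or> True"
      "if SW1 T T' then tk X \<and> tmd X = m \<and> ttok X = None else \<not> tk X \<and> ttok X = Some m \<and> tph X \<in> {Tst, Cmp, Rev, Saf}"
  proof -
    have yk: "\<not> tk T'" "\<not> tarr T'" "ttok T' = None" using invD(8) by (auto simp: ykind_def)
    have wb: "SW2 T T' \<Longrightarrow> tw T' \<noteq> bh" using invD(3) by (auto simp: SW2_def geo_def)
    consider "tph T' = Snt" | "tph T' = Tst" | "tph T' = Saf" using p by auto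
    then show thesis
    proof cases
      case 1
      then have s1: "SW1 T T'" "\<not> SW2 T T'" using sw by (auto simp: SW2_def)
      note s = step_Snt[OF run one relY 1 nex, of ids M]
      show thesis by (rule that[OF s]) (auto simp: s1 flags absorb_def same_def crew_def k)
    next
      case 2
      note s = step_Tst[OF run one relY 2, of ids M]
      show thesis by (rule that[OF s]) (use excl sw wb in \<open>auto simp: flags absorb_def tabsorb_def same_def crew_def k yk\<close>)
    next
      case 3
      note s = step_Saf[OF run one relY 3, of ids M]
      show thesis by (rule that[OF s]) (use excl sw in \<open>auto simp: flags absorb_def tabsorb_def same_def crew_def k yk\<close>)
    qed
  qed
  note sm = sameD[OF X(2)]
  let ?r = "SW2 T T'"
  have xk: "xkind ?r m X"
  proof (cases "SW2 T T'")
    case True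
    then have "\<not> SW1 T T'" "tw T' \<noteq> bh" using excl invD(3) by (auto simp: SW2_def geo_def)
    then show ?thesis using True X(4,5,7) invD(8) by (auto simp: xkind_def ykind_def sm)
  next
    case False
    then have "SW1 T T'" using sw by simp
    then show ?thesis using False X(5,7) invD(8) by (simp add: xkind_def ykind_def)
  qed
  have od: "ordr 1 (mk cs True) st (ox ?r X) (op ?r X) m"
  proof -
    have "ox ?r X = ox rem T" "op ?r X = op rem T" using k sw excl by (auto simp: ox_def op_def sm SW1_def SW2_def)
    then show ?thesis using invD(13) by (simp add: gT)
  qed
  have vT: "tu T < n" "tu T \<noteq> bh" using invD(3) by (auto simp: geo_def)
  have dd: "dfs (tid ?Y) (mk cs False) {} [tu T]" "ordr (tid ?Y) (mk cs False) [tu T] (tu ?Y) (tp ?Y) (tmd ?Y)"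
    unfolding gF sub_reord using restart_dfs[OF vT deg_pos[OF vT(1) n1], of "mk c False" "tck T"] invD(9,10) by (auto dest: order.strict_implies_not_eq)
  have "inv cs (\<not> t) X ?Y ?r m st [tu T] {}" unfolding inv_def
  proof (intro conjI)
    show "teamrel cs (\<not> t) X" by (rule X(1))
    show "teamrel cs (\<not> \<not> t) ?Y" using Y(1) by simp
    show "geo X" by (rule geo_same[OF invD(4) X(2,3)])
    show "geo ?Y" using invD(3) deg_pos[OF vT(1) n1] by (auto simp: geo_def reord_def)
    have "{ta X, tb X, tl X, ta ?Y, tb ?Y, tl ?Y} = {ta T, tb T, tl T, ta T', tb T', tl T'}"
      using X(3) by (auto simp: crew_def reord_def)
    then show "{ta X, tb X, tl X, ta ?Y, tb ?Y, tl ?Y} = {..<6}" using invD(5) by simp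
    show "\<forall>i<6. ag_out (ags cs i) = None" by (rule outs[OF nd])
    show "xkind ?r m X" by (rule xk)
    show "ykind ?Y" by (simp add: ykind_def sub_reord)
    show "tck X = tck ?Y" using X(3) invD(9) by (simp add: crew_def sub_reord)
    show "\<forall>v<n. fst (mk cs False v) < tck ?Y" using invD(9,10) by (auto simp: gF sub_reord less_Suc_eq)
    show "EXC X ?Y" by (simp add: EXC_def sub_reord)
    show "dfs 1 (mk cs True) {} st" using invD(12) by (simp add: gT)
  qed (use od dd in auto)
  moreover have "xrk (mk c True) rem m T < xrk (mk cs True) ?r m X"
  proof -
    have "sub T \<le> 1" "1 < sub X" using o X(4) by (auto simp: sub_def)
    then show ?thesis using k by (simp add: xrk_def gT)
  qed
  ultimately show ?thesis using Phi_up by blast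
qed

text \<open>Each scout already stands at the node of the other leader, so the exchange completes
  both teams even if the edge is now missing.\<close>

lemma round_exch:
  assumes h: "tph T = Snt" "tph T' = Snt" "ed T = ed T'" "tu T \<noteq> tu T'"
  shows "\<exists>t2 T2 T2' rem2 m2 st2 st2' K2. inv cs t2 T2 T2' rem2 m2 st2 st2' K2 \<and>
     Phi c T T' rem m st' K < Phi cs T2 T2' rem2 m2 st2' K2"
proof -
  have e: "tu T = tw T'" "tw T = tu T'" "tp T = tr T'" "tr T = tp T'" using ed_eq[OF invD(3,4) h(3)] h(4) by auto
  have wb: "tw T \<noteq> bh" "tw T' \<noteq> bh" using e invD(3,4) by (auto simp: geo_def)
  have ex: "exch c t T" "exch c (\<not> t) T'" using h e by (auto simp: flags flags' EXCH_def)
  have nS: "\<not> SW1 T T'" using h by (simp add: SW1_def)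
  have nr: "\<not> rem" using invD(7) h by (auto simp: xkind_def)
  note X = step_exch[OF run one relX h(1) wb(1) ex(1), of ids M]
  note Y = step_exch[OF run one relY h(2) wb(2) ex(2), of ids M]
  have g: "mk cs k = mk c k" for k
  proof (rule ext, rule marks)
    show "(\<forall>x. plc c (tl T) \<noteq> Th k x) \<or> v \<noteq> lpos T" for v using plan_Snt(1)[OF relX h(1)] by simp
    show "(\<forall>x. plc c (tl T') \<noteq> Th k x) \<or> v \<noteq> lpos T'" for v using plan_Snt(1)[OF relY h(2)] by simp
  qed
  define A where "A = (tick T)\<lparr>tph := Cmp, tx := False, ta := ta T', ttok := None, tq := tr T'\<rparr>"
  define B where "B = (tick T')\<lparr>tph := Cmp, tx := False, ta := ta T, ttok := None, tq := tr T\<rparr>"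
  have A: "tu A = tu T" "tp A = tp T" "tph A = Cmp" "\<not> tx A" "ta A = ta T'" "tb A = tb T" "tl A = tl T" "ttok A = None" "tq A = tr T'"
    "tk A = tk T" "tarr A = tarr T" "tmd A = tmd T" "tck A = Suc (tck T)" "ldst t (tick T) PU = ldst t A PU" "tw A = tw T" "tr A = tr T"
    by (simp_all add: A_def ldst_def tw_def tr_def)
  have B: "tu B = tu T'" "tp B = tp T'" "tph B = Cmp" "\<not> tx B" "ta B = ta T" "tb B = tb T'" "tl B = tl T'" "ttok B = None" "tq B = tr T"
    "tk B = tk T'" "tarr B = tarr T'" "tmd B = tmd T'" "tck B = Suc (tck T')" "ldst (\<not> t) (tick T') PU = ldst (\<not> t) B PU" "tw B = tw T'" "tid B = tid T'"
    by (simp_all add: B_def ldst_def tw_def)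
  have "inv cs t A B rem m st st' K" unfolding inv_def
  proof (intro conjI)
    show "teamrel cs t A" using X Y wb e by (simp add: teamrel_def lpos_def A(1-9,14,15) flags' flags)
    show "teamrel cs (\<not> t) B" using X Y wb e nS by (simp add: teamrel_def lpos_def B(1-9,14,15) flags' flags)
    show "geo A" "geo B" using invD(3,4) by (auto simp: geo_def A B)
    have "{ta A, tb A, tl A, ta B, tb B, tl B} = {ta T, tb T, tl T, ta T', tb T', tl T'}" by (auto simp: A B)
    then show "{ta A, tb A, tl A, ta B, tb B, tl B} = {..<6}" using invD(5) by simp
    show "\<forall>i<6. ag_out (ags cs i) = None" by (rule outs) (use h in auto)
    show "xkind rem m A" using invD(7) nr by (auto simp: xkind_def A)
    show "ykind B" using invD(8) by (auto simp: ykind_def B)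
    show "tck A = tck B" using invD(9) by (simp add: A B)
    show "\<forall>v<n. fst (mk cs False v) < tck B" using invD(10) by (auto simp: g B less_Suc_eq)
    show "EXC A B" by (simp add: EXC_def B)
    show "ordr 1 (mk cs True) st (ox rem A) (op rem A) m" using invD(13) nr by (simp add: g ox_def op_def A)
  qed (use invD(12,14,15) in \<open>auto simp: g A B\<close>)
  moreover have "xrk (mk c True) rem m T < xrk (mk cs True) rem m A"
    by (simp add: xrk_def g sub_def A h)
  ultimately show ?thesis using Phi_up by blast
qed

text \<open>If the global rank stands still, the single removable edge is the one the first team
  waits for. \<open>EXC\<close> and the absence of a swap then keep the second team from waiting at
  that edge too, so \<open>yms\<close> rises for this edge.\<close>

lemma round:
  assumes nd: "tph T \<noteq> Ded" "tph T' \<noteq> Ded"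
    and M: "M \<subseteq> E" "card M \<le> 1" "connected_on n (E - M)"
  shows "\<exists>t2 T2 T2' rem2 m2 st2 st2' K2. inv cs t2 T2 T2' rem2 m2 st2 st2' K2 \<and>
     Phi c T T' rem m st' K < Phi cs T2 T2' rem2 m2 st2' K2"
proof (cases "(SW1 T T' \<or> SW2 T T') \<or> (tph T = Snt \<and> tph T' = Snt \<and> ed T = ed T' \<and> tu T \<noteq> tu T')")
  case True
  then show ?thesis using round_swap round_exch by blast
next
  case False
  then have nsw: "\<not> SW1 T T'" "\<not> SW2 T T'" and nx: "\<not> (tph T = Snt \<and> tph T' = Snt \<and> ed T = ed T' \<and> tu T \<noteq> tu T')" by auto
  have EXed: "ed T = ed T' \<and> tu T \<noteq> tu T'" if "EXCH T T' \<or> EXCH T' T"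
    using that EXCH_ed[OF invD(3)] EXCH_ed[OF invD(4)] by metis
  have nexX: "tph T \<in> {Snt, Rev} \<longrightarrow> \<not> exch c t T"
    using EXed nx invD(11) by (auto simp: flags EXC_def EXCH_def)
  have nexY: "tph T' \<in> {Snt, Rev} \<longrightarrow> \<not> exch c (\<not> t) T'"
    using EXed nx invD(11) by (auto simp: flags' EXC_def EXCH_def)
  have con: "connected_on n E" using pg by (simp add: port_graph_def)
  have gY: "got c (\<not> t) T' = None" "gtk c (\<not> t) T' = None" using nsw by (simp_all add: flags)
  have wX: "\<forall>v. (\<forall>x. plc c (tl T) \<noteq> Th True x) \<or> v \<noteq> lpos T \<longrightarrow> mk cs True v = mk c True v"
    using marks[of True] Y_Th by blast
  have wY: "\<forall>v. (\<forall>x. plc c (tl T') \<noteq> Th False x) \<or> v \<noteq> lpos T' \<longrightarrow> mk cs False v = mk c False v"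
    using marks[of False] X_Th nsw by blast
  have nxs: "tph T = Ord \<longrightarrow> \<not> xsw c t T" using nsw by (simp add: flags)
  obtain T1 rem1 m1 st1 where X: "teamrel cs t T1" "geo T1" "xkind rem1 m1 T1" "stp M T T1" "crew T T1"
     "dfs 1 (mk cs True) {} st1" "ordr 1 (mk cs True) st1 (ox rem1 T1) (op rem1 T1) m1"
     "xrk (mk c True) rem m T < xrk (mk cs True) rem1 m1 T1 \<or>
      xrk (mk c True) rem m T = xrk (mk cs True) rem1 m1 T1 \<and> ed T \<in> M \<and> ed T1 = ed T \<and> tph T \<in> {Ord, Tst, Saf, Blk}"
    using X_step[where ids = ids and M = M, OF run one relX nd(1) flags'(1,2) nexX invD(7) nxs invD(12,13) wX con]
    by (elim exE conjE) (rule that; assumption)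
  have conM: "\<forall>e. M = {e} \<longrightarrow> connected_on n (E - M)" using M(3) by blast
  obtain T1' st1' K1 where Y: "teamrel cs (\<not> t) T1'" "geo T1'" "ykind T1'" "stp M T' T1'" "crew T' T1'"
     "dfs (tid T1') (mk cs False) K1 st1'" "ordr (tid T1') (mk cs False) st1' (tu T1') (tp T1') (tmd T1')"
     "\<forall>v<n. fst (mk cs False v) < tck T1'" "tph T' = Ord \<and> tph T1' = Snt \<longrightarrow> \<not> ysk c (\<not> t) T'"
     "\<forall>e. M = {e} \<and> (tph T' = Ord \<and> ysk c (\<not> t) T' \<longrightarrow> ed T' = e) \<and> (tph T' \<in> {Tst, Saf} \<longrightarrow> ed T' \<noteq> e) \<longrightarrow>
        yms e (mk c False) T' st' K < yms e (mk cs False) T1' st1' K1"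
    using Y_step[where ids = ids and M = M, OF run one relY nd(2) gY nexY invD(8) n1 invD(14,15,10) wY conM]
    by (elim exE conjE) (rule that; assumption)
  have "inv cs t T1 T1' rem1 m1 st1 st1' K1" unfolding inv_def
  proof (intro conjI)
    have "{ta T1, tb T1, tl T1, ta T1', tb T1', tl T1'} = {ta T, tb T, tl T, ta T', tb T', tl T'}"
      using X(5) Y(5) unfolding crew_def by auto
    then show "{ta T1, tb T1, tl T1, ta T1', tb T1', tl T1'} = {..<6}" using invD(5) by simp
    show "\<forall>i<6. ag_out (ags cs i) = None" by (rule outs[OF nd])
    show "tck T1 = tck T1'" using X(5) Y(5) invD(9) by (simp add: crew_def)
    show "EXC T1 T1'"
    proof (rule EXC_step[OF invD(3,4,11) X(4) Y(4) nd _ nsw nx])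
      show "tph T = Ord \<longrightarrow> tk T" using xordD by blast
      show "tph T' = Ord \<and> tph T1' = Snt \<longrightarrow> \<not> YSK T' T" using Y(9) flags'(4) by blast
      show "tw T = bh \<longrightarrow> tph T \<in> {Ord, Snt, Tst}"
        using invD(1) nd(1) by (cases "tph T") (auto simp: teamrel_def)
      show "tw T' = bh \<longrightarrow> tph T' \<in> {Ord, Snt, Tst}"
        using invD(2) nd(2) by (cases "tph T'") (auto simp: teamrel_def)
    qed
  qed (use X Y in auto)
  moreover have "Phi c T T' rem m st' K < Phi cs T1 T1' rem1 m1 st1' K1"
  proof (cases "xrk (mk c True) rem m T < xrk (mk cs True) rem1 m1 T1")
    case True
    then show ?thesis by (rule Phi_up)
  next
    case False
    then have s: "xrk (mk c True) rem m T = xrk (mk cs True) rem1 m1 T1" "ed T \<in> M" "ed T1 = ed T" "tph T \<in> {Ord, Tst, Saf, Blk}"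
      using X(8) by auto
    have "finite M" using M(1) finite_E by (rule finite_subset)
    then have Me: "M = {ed T}" using s(2) M(2) card_le_Suc0_iff_eq[of M] by auto
    \<comment> \<open>A skip caused by the first team concerns its edge: the other alternatives of
      \<open>YSK\<close> need situations in which the first team progresses.\<close>
    have sk: "ed T' = ed T" if "tph T' = Ord \<and> ysk c (\<not> t) T'"
    proof -
      have "YSK T' T" using that flags'(4) by blast
      then consider "tu T = tu T'" "tp T = tp T'" | "tw T = tu T'" "tr T = tp T'"
        using s(4) by (auto simp: YSK_def lpos_def)
      then show ?thesis
      proof cases
        case 1
        then show ?thesis by (simp add: ed_def tw_def)
      next
        case 2
        then have "tw T' = tu T" using tr_lt(2)[OF invD(3)] by (simp add: tw_def[of T'])
        then show ?thesis using 2 by (simp add: ed_def insert_commute)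
      qed
    qed
    have sp: "ed T' \<noteq> ed T" if "tph T' \<in> {Tst, Saf}"
    proof
      assume e: "ed T' = ed T"
      have o: "tph T = Ord" using invD(11) that e s(4) by (auto simp: EXC_def)
      then show False using ed_eq[OF invD(3,4) e[symmetric]] xordD[OF o] that nsw by (auto simp: SW1_def SW2_def)
    qed
    have "yms (ed T) (mk c False) T' st' K < yms (ed T) (mk cs False) T1' st1' K1" using Y(10) Me sk sp by blast
    then show ?thesis using s by (simp add: Phi_def)
  qed
  ultimately show ?thesis by blast
qed

end

end

end

section \<open>The first round and the time bound\<close>

lemma decw_0: "decw 0 k = (0, 0, 0)"
proof -
  have "encw (\<lambda>_. (0, 0, 0)) = 0" by (simp add: encw_def prod_encode_def)
  then show ?thesis by (metis decw_encw)
qed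

context graph
begin

text \<open>\<open>running\<close> fails for the states \<open>Ini\<close>, so this round is
  computed directly. The ranks of the six distinct IDs assign the roles; ranks 0 and 3 become
  leaders and write different parts of the whiteboard.\<close>

lemma initial:
  fixes ids :: "nat \<Rightarrow> nat"
  assumes inj: "inj_on ids {..<6}" and s: "s < n" "s \<noteq> bh"
  shows "\<exists>t T T' rem m st st' K. inv (step bhs_alg deg port bh ids 6 M (init_cfg s)) t T T' rem m st st' K"
proof -
  let ?c = "init_cfg s" let ?d = "step bhs_alg deg port bh ids 6 M ?c"
  have n1: "1 < n" using s bhn by linarith
  define r where "r i = card {j. j < 6 \<and> ids j < ids i}" for i
  have r_lt: "r i < r j" if "ids i < ids j" "i < 6" for i j
    unfolding r_def by (rule psubset_card_mono) (use that in auto)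
  have r6: "r i < 6" if "i < 6" for i
  proof -
    have "r i < card {..<6::nat}" unfolding r_def by (rule psubset_card_mono) (use that in auto)
    then show ?thesis by simp
  qed
  have r_inj: "inj_on r {..<6}"
  proof (rule inj_onI)
    fix i j assume "i \<in> {..<6}" "j \<in> {..<6}" "r i = r j"
    then have "ids i = ids j" using r_lt[of i j] r_lt[of j i] by (metis lessThan_iff less_irrefl nat_neq_iff)
    then show "i = j" using inj \<open>i \<in> _\<close> \<open>j \<in> _\<close> by (auto dest: inj_onD)
  qed
  have "r ` {..<6} = {..<6}" using r6 r_inj by (intro endo_inj_surj) auto
  then have "\<forall>k<6. \<exists>i<6. r i = k" by (metis imageE lessThan_iff)
  then obtain a where a: "\<And>k. k < 6 \<Longrightarrow> a k < 6 \<and> r (a k) = k" by metis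
  have h: "set (here ids 6 ?c v) = (if v = s then {..<6} else {})" for v
    by (auto simp: set_here init_cfg_def)
  have rk: "length (filter (\<lambda>x. fst x < ids i) (map (\<lambda>j. (ids j, ag_st (ags ?c j))) (filter (\<lambda>j. j \<noteq> i) (here ids 6 ?c s)))) = r i" for i
  proof -
    have "length (filter (\<lambda>x. fst x < ids i) (map (\<lambda>j. (ids j, ag_st (ags ?c j))) (filter (\<lambda>j. j \<noteq> i) (here ids 6 ?c s))))
        = length (filter (\<lambda>j. ids j < ids i) (filter (\<lambda>j. j \<noteq> i) (here ids 6 ?c s)))"
      by (simp add: filter_map comp_def)
    also have "\<dots> = card (set (filter (\<lambda>j. ids j < ids i) (filter (\<lambda>j. j \<noteq> i) (here ids 6 ?c s))))"
      by (rule distinct_card[symmetric]) (simp add: distinct_here)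
    also have "set (filter (\<lambda>j. ids j < ids i) (filter (\<lambda>j. j \<noteq> i) (here ids 6 ?c s))) = {j. j < 6 \<and> ids j < ids i}"
      using h[of s] by auto
    finally show ?thesis by (simp add: r_def)
  qed
  let ?xs = "filter (\<lambda>j. ag_out (ags ?c j) = None) (here ids 6 ?c s)"
  define S where "S i = (if r i = 0 then L False True PO 0 True False 2 1 else if r i = 1 then F False False
      else if r i = 2 then F False True else if r i = 3 then L True False PO 0 True False 2 1
      else if r i = 4 then F True False else F True True)" for i
  \<comment> \<open>Substitute plans, so that \<open>seqc_separate\<close> applies: it matters only
    which agent writes and which part.\<close>
  define P where "P i = (if r i = 0 then Th True Restart else if r i = 3 then Th False Restart else Do Ini Stay)" for i
  let ?f = "\<lambda>i w. bhs_alg (ids i) (ag_st (ags ?c i)) (deg s) (ent ?c i) (fld ?c i)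
                   (map (\<lambda>j. (ids j, ag_st (ags ?c j))) (filter (\<lambda>j. j \<noteq> i) (here ids 6 ?c s))) w"
  have st0: "ag_st (ags ?c i) = 0" for i by (simp add: init_cfg_def)
  have f: "?f i w = ini (r i) w" for i w
    unfolding bhs_alg_def rk by (simp add: st0)
  let ?W = "\<lambda>_::bool. (0, 0, 0) :: mark"
  have xs: "set ?xs = {..<6}" using h[of s] by (auto simp: init_cfg_def)
  have "\<exists>W' r'. seqc ?f ?xs (encw ?W) = (encw W', r') \<and>
     (\<forall>i\<in>set ?xs. map_of r' i = Some (enc (S i), Stay)) \<and>
     (\<forall>i\<in>set ?xs. \<forall>k x. P i = Th k x \<longrightarrow> W' k = (1, 0, 0)) \<and>
     (\<forall>k. (\<forall>i\<in>set ?xs. \<forall>x. P i \<noteq> Th k x) \<longrightarrow> W' k = ?W k)"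
  proof (rule seqc_separate[where ?W0.0 = ?W])
    fix i j k x y assume "i \<in> set ?xs" "j \<in> set ?xs" "P i = Th k x" "P j = Th k y"
    then have "r i = r j" by (auto simp: P_def split: if_splits)
    then show "i = j" using r_inj \<open>i \<in> _\<close> \<open>j \<in> _\<close> xs by (auto dest: inj_onD)
  next
    show "distinct ?xs" by (simp add: distinct_here)
  qed (auto simp: f S_def P_def simp del: enc.simps split: if_splits)
  then obtain W' r' where W': "seqc ?f ?xs (encw ?W) = (encw W', r')"
     "\<And>i. i < 6 \<Longrightarrow> map_of r' i = Some (enc (S i), Stay)"
     "\<And>i k x. i < 6 \<Longrightarrow> P i = Th k x \<Longrightarrow> W' k = (1, 0, 0)"
    unfolding xs by blast
  have wk: "W' k = (1, 0, 0)" for k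
  proof (cases k)
    case True then show ?thesis using W'(3)[of "a 0" True Restart] a[of 0] by (simp add: P_def)
  next
    case False then show ?thesis using W'(3)[of "a 3" False Restart] a[of 3] by (simp add: P_def)
  qed
  have w0: "wbs ?c v = encw ?W" for v using decw_0 by (metis (no_types, lifting) encw_decw ext init_cfg_def cfg.select_convs(2))
  have nr: "node_res bhs_alg deg ids 6 ?c s = (encw W', r')"
    unfolding node_res_def w0 using W'(1) by simp
  have nr2: "fst (node_res bhs_alg deg ids 6 ?c v) = encw ?W" if "v \<noteq> s" for v
  proof -
    have "here ids 6 ?c v = []" using h[of v] that by simp
    then show ?thesis unfolding node_res_def w0 by simp
  qed
  have mkd: "mk ?d k = (\<lambda>_. (0, 0, 0))(s := (1, 0, 0))" for k
    by (rule ext) (use nr nr2 wk in \<open>auto simp: mk_def step_def\<close>)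
  have ag: "loc ?d i s (S i)" "ag_out (ags ?d i) = None" if "i < 6" for i
  proof -
    have "ag_alive (ags ?c i)" "ag_pos (ags ?c i) = s" "ag_out (ags ?c i) = None" by (simp_all add: init_cfg_def)
    then show "loc ?d i s (S i)" "ag_out (ags ?d i) = None"
      using nr W'(2)[OF that] by (simp_all add: step_def upd_agent_def Let_def loc_def del: enc.simps)
  qed
  have loc: "loc ?d (a k) s (S (a k))" "r (a k) = k" "a k < 6" if "k < 6" for k using ag a[OF that] by auto
  define T where "T = \<lparr>ta = a 1, tb = a 2, tl = a 0, tu = s, tp = 0, tph = Ord, tx = False, tk = True, tmd = True,
     tarr = False, ttok = None, tq = 0, tck = 2, tid = 1\<rparr>"
  define T' where "T' = T\<lparr>ta := a 4, tb := a 5, tl := a 3, tk := False\<rparr>"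
  have d0: "0 < deg s" using deg_pos s n1 by blast
  have "dfs 1 (mk ?d k) {} [s]" "ordr 1 (mk ?d k) [s] s 0 True" for k
    unfolding mkd using restart_dfs[OF s d0, of "\<lambda>_. (0, 0, 0)" 1] by auto
  note dd = this
  have "a ` {..<6} = {..<6}"
  proof (rule endo_inj_surj)
    show "inj_on a {..<6}"
    proof (rule inj_onI)
      fix i j assume i: "i \<in> {..<6}" "j \<in> {..<6}" and e: "a i = a j"
      have "r (a i) = i" "r (a j) = j" using a i by blast+
      then show "i = j" unfolding e by (rule trans[OF sym])
    qed
    show "a ` {..<6} \<subseteq> {..<6}" using a by blast
  qed simp
  moreover have "{..<6::nat} = {0, 1, 2, 3, 4, 5}" by auto
  moreover have "{a 1, a 2, a 0, a 4, a 5, a 3} = a ` {0, 1, 2, 3, 4, 5}" by auto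
  ultimately have six: "{a 1, a 2, a 0, a 4, a 5, a 3} = {..<6}" by simp
  have "inv ?d False T T' False True [s] [s] {}" unfolding inv_def
  proof (intro conjI)
    show "teamrel ?d False T"
      using loc[of 0] loc[of 1] loc[of 2] by (simp add: teamrel_def T_def lpos_def ldst_def S_def)
    show "teamrel ?d (\<not> False) T'"
      using loc[of 3] loc[of 4] loc[of 5] by (simp add: teamrel_def T_def T'_def lpos_def ldst_def S_def)
    show "geo T" "geo T'" using s d0 a by (auto simp: geo_def T_def T'_def)
    show "{ta T, tb T, tl T, ta T', tb T', tl T'} = {..<6}" using six by (simp add: T_def T'_def)
    show "\<forall>i<6. ag_out (ags ?d i) = None" using ag by blast
    show "xkind False True T" "ykind T'" "tck T = tck T'" "EXC T T'"
      by (simp_all add: xkind_def ykind_def EXC_def T_def T'_def)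
    show "\<forall>v<n. fst (mk ?d False v) < tck T'" by (simp add: mkd T_def T'_def)
  qed (use dd in \<open>simp_all add: T_def T'_def ox_def op_def\<close>)
  then show ?thesis by blast
qed

definition solved :: "cfg \<Rightarrow> bool" where
  "solved c \<longleftrightarrow> (\<exists>i<6. alv c i \<and> ag_out (ags c i) \<noteq> None) \<and>
     (\<forall>i<6. \<forall>p. ag_out (ags c i) = Some p \<longrightarrow> alv c i \<and> p < deg (ag_pos (ags c i)) \<and> port (ag_pos (ags c i)) p = bh)"

text \<open>\<open>Phi\<close> rises in every round after the first and stays below
  \<open>2 * RB * RB\<close>, so by then some leader has lost both companions. The additional 2
  allows for the first round and the round of halting.\<close>

lemma solved_in_time:
  assumes inj: "inj_on ids {..<6}" and s: "s < n" "s \<noteq> bh" and adv: "one_bhs_adversary n E M"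
  shows "\<exists>T \<le> 2 * RB * RB + 2. solved (exec bhs_alg deg port bh s ids 6 M T)"
proof (rule ccontr)
  let ?c = "exec bhs_alg deg port bh s ids 6 M"
  assume no: "\<not> ?thesis"
  have n1: "1 < n" using s bhn by linarith
  have "\<exists>t T T' rem m st st' K. inv (?c (Suc k)) t T T' rem m st st' K \<and> k \<le> Phi (?c (Suc k)) T T' rem m st' K"
    if "k \<le> 2 * RB * RB" for k using that
  proof (induction k)
    case 0
    have "?c (Suc 0) = step bhs_alg deg port bh ids 6 (M 0) (init_cfg s)" by simp
    then show ?case using initial[OF inj s, of "M 0"] by (metis le0)
  next
    case (Suc k)
    then obtain t T T' rem m st st' K where i: "inv (?c (Suc k)) t T T' rem m st st' K" "k \<le> Phi (?c (Suc k)) T T' rem m st' K"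
      by auto
    have e: "?c (Suc (Suc k)) = step bhs_alg deg port bh ids 6 (M (Suc k)) (?c (Suc k))" by simp
    have nd: "tph T \<noteq> Ded \<and> tph T' \<noteq> Ded"
    proof (rule ccontr)
      assume nd0: "\<not> ?thesis"
      have "solved (?c (Suc (Suc k)))"
        unfolding e solved_def using nd0 halting[OF i(1) n1, of ids "M (Suc k)"] by blast
      moreover have "Suc (Suc k) \<le> 2 * RB * RB + 2" using Suc.prems by simp
      ultimately show False using no by blast
    qed
    have "M (Suc k) \<subseteq> E" "card (M (Suc k)) \<le> 1" "connected_on n (E - M (Suc k))"
      using adv by (auto simp: one_bhs_adversary_def)
    from round[OF i(1) n1 _ _ this, of ids] nd obtain t2 T2 T2' rem2 m2 st2 st2' K2 where
      "inv (?c (Suc (Suc k))) t2 T2 T2' rem2 m2 st2 st2' K2"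
      "Phi (?c (Suc k)) T T' rem m st' K < Phi (?c (Suc (Suc k))) T2 T2' rem2 m2 st2' K2"
      unfolding e by blast
    then show ?case using i(2) by (metis Suc_leI le_less_trans)
  qed
  from this[of "2 * RB * RB"] obtain t T T' rem m st st' K where
    "inv (?c (Suc (2 * RB * RB))) t T T' rem m st st' K" "2 * RB * RB \<le> Phi (?c (Suc (2 * RB * RB))) T T' rem m st' K" by auto
  with Phi_bound[OF this(1) n1] show False by simp
qed

end

section \<open>Memory\<close>

fun szl :: "nat \<Rightarrow> lst \<Rightarrow> bool" where
  "szl N (L t k ph p m arr clk i) \<longleftrightarrow> p \<le> N \<and> clk \<le> N \<and> i \<le> N"
| "szl N (Sc t q k) \<longleftrightarrow> q \<le> N"
| "szl N s \<longleftrightarrow> True"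

fun szm :: "nat \<Rightarrow> mark \<Rightarrow> bool" where
  "szm N (a, b, c) \<longleftrightarrow> a \<le> N \<and> b \<le> N \<and> c \<le> N"

lemma szl_mono: "szl N s \<Longrightarrow> N \<le> N' \<Longrightarrow> szl N' s" by (cases s) auto
lemma szm_mono: "szm N x \<Longrightarrow> N \<le> N' \<Longrightarrow> szm N' x" by (cases x) auto

lemma planF_cases: "\<exists>s a. planF V fl own t r = Do s a \<and> (s = F t r \<or> s = Tr t r)"
  by (cases "lph (ldr V t)") (simp_all add: planF_def Let_def)

lemma plan_sz:
  assumes "szl N s" "eport en \<le> N"
  shows "plan V en fl s = Do s' a \<Longrightarrow> szl (Suc N) s'"
    and "plan V en fl s = Th k (Arr e m) \<Longrightarrow> e \<le> N"
proof -
  have "(plan V en fl s = Do s' a \<longrightarrow> szl (Suc N) s') \<and> (plan V en fl s = Th k (Arr e m) \<longrightarrow> e \<le> N)"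
  proof (cases s)
    case Ini
    then show ?thesis by auto
  next
    case (L t kk ph p mm arr clk i)
    have sz: "p \<le> N" "clk \<le> N" "i \<le> N" using assms L by auto
    show ?thesis
    proof (cases ph)
      case PO
      show ?thesis using sz unfolding L PO
        by (cases "sw1 V (\<not> t)"; cases "hasA V t"; cases kk) (auto split: if_splits)
    next
      case PU
      show ?thesis using sz unfolding L PU
        by (cases "sw1 V (\<not> t)"; cases "hasS V t"; cases "hasB V t"; cases arr; cases "tokof V t") auto
    next
      case PS
      show ?thesis using sz unfolding L PS
        by (cases "sw1 V (\<not> t)"; cases "hasS V t"; cases arr; cases "tokof V t") auto
    next
      case PD
      show ?thesis using sz assms(2) unfolding L PD by (cases fl; cases kk) auto
    qed
  next
    case (F t r)
    then show ?thesis using planF_cases[of V fl False t r] by auto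
  next
    case (Tr t r)
    then show ?thesis using assms planF_cases[of V fl True t r]
      by (cases fl) (auto simp: planT_def)
  next
    case (Sc t q kk)
    then show ?thesis using assms by (auto simp: planS_def split: if_splits)
  qed
  then show "plan V en fl s = Do s' a \<Longrightarrow> szl (Suc N) s'" "plan V en fl s = Th k (Arr e m) \<Longrightarrow> e \<le> N"
    by auto
qed

lemma nxt_sz: "nxt k (j, pa, pt) d clk i = (mk', p, m, i') \<Longrightarrow> j \<le> N \<Longrightarrow> pa \<le> N \<Longrightarrow> pt \<le> N \<Longrightarrow> clk \<le> N \<Longrightarrow> i \<le> N \<Longrightarrow> 1 \<le> N
    \<Longrightarrow> szm N mk' \<and> p \<le> N \<and> i' \<le> N"
  by (auto split: if_splits)

text \<open>The bound grows by one since a pointer advances by one and a parent is stored as a port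
  plus one.\<close>

lemma think_sz:
  assumes "think k x mk0 d clk i = (mk', p, m, i')" "szm N mk0" "clk \<le> N" "i \<le> N" "\<And>e b. x = Arr e b \<Longrightarrow> e \<le> N"
  shows "szm (Suc N) mk' \<and> p \<le> Suc N \<and> i' \<le> Suc N"
proof -
  obtain j pa pt where m: "mk0 = (j, pa, pt)" using prod_cases3 by blast
  show ?thesis
  proof (cases x)
    case (Arr e b)
    then have "e \<le> N" using assms(5) by blast
    then show ?thesis using assms(1-4) m Arr nxt_sz[of k _ _ _ d clk i mk' p m i' "Suc N"]
      by (auto simp del: nxt.simps split: if_splits)
  next
    case SkipF
    then show ?thesis using assms(1-4) m nxt_sz[of k _ _ _ d clk i mk' p m i' "Suc N"]
      by (auto simp del: nxt.simps)
  next
    case Restart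
    then show ?thesis using assms(1-4) m by auto
  qed
qed

definition szw :: "nat \<Rightarrow> nat \<Rightarrow> bool" where "szw N w \<longleftrightarrow> (\<forall>k. szm N (decw w k))"
definition szs :: "nat \<Rightarrow> nat \<Rightarrow> bool" where "szs N st \<longleftrightarrow> (\<exists>s. st = enc s \<and> szl N s)"

text \<open>Two bounds are needed because the agents at a node compute in sequence: their states
  still obey the bound \<open>N\<close> from the beginning of the round, while the whiteboard may
  have grown to \<open>N'\<close>. The 2 is the initial clock.\<close>

lemma alg_sz:
  assumes "szs N st" "eport en \<le> N" "szw N' w" "N \<le> N'" "2 \<le> N"
    "bhs_alg me st d en fl oth w = (st', w', a)"
  shows "szs (Suc N') st'" "szw (Suc N') w'"
proof -
  obtain s where s: "st = enc s" "szl N s" using assms(1) by (auto simp: szs_def)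
  have "szs (Suc N') st' \<and> szw (Suc N') w'"
  proof (cases "s = Ini")
    case True
    have "szm (Suc N') (decw w k)" for k using assms(3) szm_mono[of N' _ "Suc N'"] by (auto simp: szw_def)
    moreover have "szl (Suc N') (F b1 b2)" "szl (Suc N') (L b1 b2 PO 0 True False 2 1)" for b1 b2 using assms(4,5) by auto
    ultimately show ?thesis using assms(6) True s
      by (auto simp: bhs_alg_def szs_def szw_def simp del: enc.simps szl.simps split: if_splits)
  next
    case False
    obtain V where V: "react s (plan V en fl s) d w = (st', w', a)"
      using assms(6) False s by (auto simp: bhs_alg_def simp del: enc.simps)
    show ?thesis
    proof (cases "plan V en fl s")
      case (Do s' a')
      then show ?thesis using V plan_sz(1)[OF s(2) assms(2) Do] szl_mono[of "Suc N" s' "Suc N'"] assms(3,4) szm_mono[of N' _ "Suc N'"]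
        by (auto simp: react_def szs_def szw_def simp del: enc.simps)
    next
      case (Th k x)
      obtain mk' p m i' where th: "think k x (decw w k) d (lclk s) (lid s) = (mk', p, m, i')" using prod_cases4 by blast
      have L: "is_L s"
      proof (rule ccontr)
        assume "\<not> is_L s"
        then show False using Th
          using planF_cases[of V fl True] planF_cases[of V fl False]
          by (cases s) (auto simp: planT_def planS_def split: if_splits, (metis pln.distinct(1))+)
      qed
      then have sz: "lclk s \<le> N'" "lid s \<le> N'" using s(2) assms(4) by (cases s; simp)+
      have e: "e \<le> N'" if "x = Arr e b" for e b using plan_sz(2)[OF s(2) assms(2)] Th that assms(4) by fastforce
      have w: "szm N' (decw w k')" for k' using assms(3) by (simp add: szw_def)
      have "szm (Suc N') mk' \<and> p \<le> Suc N' \<and> i' \<le> Suc N'" by (rule think_sz[OF th w sz e])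
      moreover have "szm (Suc N') (decw w k')" for k' using szm_mono[OF w] by simp
      ultimately show ?thesis using V Th th sz
        by (auto simp: react_def szs_def szw_def simp del: enc.simps think.simps)
    qed
  qed
  then show "szs (Suc N') st'" "szw (Suc N') w'" by auto
qed

lemma seqc_sz:
  assumes "\<And>i w N' s' w' a. i \<in> set xs \<Longrightarrow> szw N' w \<Longrightarrow> N \<le> N' \<Longrightarrow> f i w = (s', w', a) \<Longrightarrow> szs (Suc N') s' \<and> szw (Suc N') w'"
    "szw N1 w" "N \<le> N1" "seqc f xs w = (w2, r)"
  shows "szw (N1 + length xs) w2 \<and> (\<forall>(i, s', a) \<in> set r. szs (N1 + length xs) s')"
  using assms
proof (induction xs arbitrary: N1 w w2 r)
  case (Cons i xs)
  obtain s' w' a where f: "f i w = (s', w', a)" using prod_cases3 by blast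
  obtain r' where r': "seqc f xs w' = (w2, r')" "r = (i, s', a) # r'"
    using Cons.prems(4) f by (auto split: prod.splits)
  have 1: "szs (Suc N1) s'" "szw (Suc N1) w'" using Cons.prems(1)[OF _ Cons.prems(2,3) f] by auto
  have "szw (Suc N1 + length xs) w2 \<and> (\<forall>(i, s', a) \<in> set r'. szs (Suc N1 + length xs) s')"
  proof (rule Cons.IH[OF _ 1(2) _ r'(1)])
    show "szs (Suc N') s' \<and> szw (Suc N') w'" if "j \<in> set xs" "szw N' w" "N \<le> N'" "f j w = (s', w', a)" for j w N' s' w' a
      using Cons.prems(1)[OF _ that(2-4)] that(1) by simp
  qed (use Cons.prems(3) in simp)
  moreover have "szs (Suc N1 + length xs) s'" using 1(1) szl_mono[of "Suc N1" _ "Suc N1 + length xs"] by (auto simp: szs_def)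
  ultimately show ?case using r'(2) by auto
qed simp

lemma szs_mono: "szs N s \<Longrightarrow> N \<le> N' \<Longrightarrow> szs N' s" using szl_mono by (auto simp: szs_def)
lemma szw_mono: "szw N s \<Longrightarrow> N \<le> N' \<Longrightarrow> szw N' s" unfolding szw_def using szm_mono by blast

context graph
begin

definition gb :: "cfg \<Rightarrow> nat \<Rightarrow> bool" where
  "gb c N \<longleftrightarrow> (\<forall>i<6. szs N (ag_st (ags c i)) \<and> ag_pos (ags c i) < n \<and> eport (ent c i) \<le> N) \<and> (\<forall>v. szw N (wbs c v))"

lemma deg_le: assumes "v < n" shows "deg v \<le> n"
proof -
  have "card {..<deg v} \<le> card {..<n}"
    by (rule card_inj_on_le[of "port v"]) (use assms port_inj port_lt in \<open>auto simp: inj_on_def\<close>)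
  then show ?thesis by simp
qed

text \<open>At most six agents compute at a node, each raising the bound by one.\<close>

lemma gb_step:
  assumes "gb c N" "2 \<le> N" "n \<le> N"
  shows "gb (step bhs_alg deg port bh ids 6 M c) (N + 6)"
proof -
  let ?d = "step bhs_alg deg port bh ids 6 M c"
  have g: "szs N (ag_st (ags c i))" "ag_pos (ags c i) < n" "eport (ent c i) \<le> N" if "i < 6" for i
    using assms(1) that by (auto simp: gb_def)
  have node: "szw (N + 6) (fst (node_res bhs_alg deg ids 6 c v)) \<and>
      (\<forall>(i, s', a) \<in> set (snd (node_res bhs_alg deg ids 6 c v)). szs (N + 6) s')" for v
  proof -
    let ?xs = "filter (\<lambda>j. ag_out (ags c j) = None) (here ids 6 c v)"
    obtain w2 r where r: "node_res bhs_alg deg ids 6 c v = (w2, r)" by fastforce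
    have l: "length ?xs \<le> 6"
    proof -
      have "length ?xs = card (set ?xs)" by (rule distinct_card[symmetric]) (simp add: distinct_here)
      also have "\<dots> \<le> card {..<6::nat}" by (rule card_mono) (auto simp: set_here)
      finally show ?thesis by simp
    qed
    have "szw (N + length ?xs) w2 \<and> (\<forall>(i, s', a) \<in> set r. szs (N + length ?xs) s')"
    proof (rule seqc_sz[where N = N])
      show "seqc (\<lambda>i w. bhs_alg (ids i) (ag_st (ags c i)) (deg v) (ent c i) (fld c i)
                   (map (\<lambda>j. (ids j, ag_st (ags c j))) (filter (\<lambda>j. j \<noteq> i) (here ids 6 c v))) w) ?xs (wbs c v) = (w2, r)"
        using r by (simp add: node_res_def)
      show "szw N (wbs c v)" using assms(1) by (simp add: gb_def)
      fix i w N' s' w' a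
      assume i: "i \<in> set ?xs" "szw N' w" "N \<le> N'" "bhs_alg (ids i) (ag_st (ags c i)) (deg v) (ent c i) (fld c i)
                   (map (\<lambda>j. (ids j, ag_st (ags c j))) (filter (\<lambda>j. j \<noteq> i) (here ids 6 c v))) w = (s', w', a)"
      then have "i < 6" by (auto simp: set_here)
      from alg_sz[OF g(1)[OF this] g(3)[OF this] i(2,3) assms(2) i(4)]
      show "szs (Suc N') s' \<and> szw (Suc N') w'" by simp
    qed simp
    then show ?thesis using l r by (auto intro: szs_mono szw_mono)
  qed
  have "szs (N + 6) (ag_st (ags ?d i)) \<and> ag_pos (ags ?d i) < n \<and> eport (ent ?d i) \<le> N + 6" if i: "i < 6" for i
  proof -
    have st: "szs (N + 6) (ag_st (ags c i))" "eport (ent c i) \<le> N + 6" using g[OF i] szs_mono by auto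
    let ?v = "ag_pos (ags c i)"
    have rp: "rport deg port ?v p \<le> N + 6" "port ?v p < n" if "p < deg ?v" for p
      using rp[OF g(2)[OF i] that] port_lt[OF g(2)[OF i] that] deg_le[of "port ?v p"] assms(3) by auto
    show ?thesis
    proof (cases "alv c i \<and> ag_out (ags c i) = None")
      case False
      then have "ags ?d i = ags c i" by (auto simp: step_def upd_agent_def Let_def)
      then show ?thesis using st g[OF i] by simp
    next
      case True
      show ?thesis
      proof (cases "map_of (snd (node_res bhs_alg deg ids 6 c ?v)) i")
        case None
        then have "ags ?d i = ags c i" using True by (auto simp: step_def upd_agent_def Let_def)
        then show ?thesis using st g[OF i] by simp
      next
        case (Some x)
        obtain s' a where x: "x = (s', a)" by fastforce
        have "szs (N + 6) s'" using node[of ?v] map_of_SomeD[OF Some] x by auto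
        then show ?thesis using True Some x st g[OF i] rp
          by (cases a) (auto simp: step_def upd_agent_def Let_def)
      qed
    qed
  qed
  moreover have "szw (N + 6) (wbs ?d v)" for v using node[of v] by (simp add: step_def)
  ultimately show ?thesis by (simp add: gb_def)
qed

lemma gb_exec: assumes "s < n" shows "gb (exec bhs_alg deg port bh s ids 6 M t) (n + 2 + 6 * t)"
proof (induction t)
  case 0
  have "szs N 0" for N unfolding szs_def by (rule exI[of _ Ini]) simp
  then show ?case using assms by (auto simp: gb_def init_cfg_def eport_def szw_def decw_0)
next
  case (Suc t)
  from gb_step[OF Suc.IH, of ids "M t"] show ?case by (simp add: algebra_simps)
qed

end

text \<open>The Cantor pairing is quadratic: \<open>pe a b\<close> is below the square of a + b + 1,
  so k bits become 2k + 2.\<close>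

lemma pe_less: assumes "a < 2 ^ k" "b < 2 ^ k" shows "pe a b < 2 ^ (2 * k + 2)"
proof -
  have "(a + b) * Suc (a + b) div 2 \<le> (a + b) * Suc (a + b)" by simp
  then have "pe a b \<le> (a + b) * Suc (a + b) + a" by (simp add: prod_encode_def triangle_def)
  also have "\<dots> < (a + b + 1) * (a + b + 1)" by (simp add: algebra_simps)
  also have "\<dots> \<le> (2 ^ (k + 1)) * (2 ^ (k + 1))" using assms by (intro mult_mono) auto
  also have "\<dots> = 2 ^ (2 * k + 2)" by (simp add: power_add[symmetric])
  finally show ?thesis .
qed

lemma less_pow_mono: "a < 2 ^ k \<Longrightarrow> k \<le> k' \<Longrightarrow> a < (2 :: nat) ^ k'"
  by (erule less_le_trans) (simp add: power_increasing)

lemma pe_less': assumes "a < 2 ^ j" "b < 2 ^ k" "j \<le> k" "l = 2 * k + 2" shows "pe a b < 2 ^ l"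
  using pe_less[OF less_pow_mono[OF assms(1,3)] assms(2)] assms(4) by simp

text \<open>Iterating 2k + 2 over the eight nested pairings of a leader's state gives 256k + 510;
  the outer \<open>Suc\<close> costs one more bit.\<close>

lemma enc_less:
  assumes "szl N s" "N < 2 ^ k" "2 \<le> k"
  shows "enc s < 2 ^ (256 * k + 511)"
proof -
  have b: "of_bool x < (2 :: nat) ^ k" for x using assms(3) less_pow_mono[of "of_bool x" 1 k] by auto
  have c: "x < 2 ^ k" if "x \<le> 3" for x :: nat using that assms(3) less_pow_mono[of x 2 k] by auto
  have ph: "phc x \<le> 3" for x by (cases x) auto
  have tk: "tokc x \<le> 3" for x by (cases x) (auto simp: of_bool_def)
  have "enc s < 2 ^ (256 * k + 510) + 1"
  proof (cases s)
    case (L t kk p q m arr clk i)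
    have q: "q < 2 ^ k" "clk < 2 ^ k" "i < 2 ^ k" using assms L by auto
    have "pe 0 (pe (of_bool t) (pe (of_bool kk) (pe (phc p) (pe q (pe (of_bool m) (pe (of_bool arr) (pe clk i))))))) < 2 ^ (256 * k + 510)"
      by (rule pe_less'[OF c pe_less'[OF b pe_less'[OF b pe_less'[OF c[OF ph] pe_less'[OF q(1) pe_less'[OF b pe_less'[OF b pe_less'[OF q(2,3)]]]]]]]]) auto
    then show ?thesis by (simp add: L)
  next
    case (F t r)
    have "pe 1 (pe (of_bool t) (of_bool r)) < 2 ^ (4 * k + 6)" by (rule pe_less'[OF c pe_less'[OF b b]]) auto
    then have "pe 1 (pe (of_bool t) (of_bool r)) < 2 ^ (256 * k + 510)" by (rule less_pow_mono) simp
    then show ?thesis by (simp add: F)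
  next
    case (Tr t r)
    have "pe 2 (pe (of_bool t) (of_bool r)) < 2 ^ (4 * k + 6)" by (rule pe_less'[OF c pe_less'[OF b b]]) auto
    then have "pe 2 (pe (of_bool t) (of_bool r)) < 2 ^ (256 * k + 510)" by (rule less_pow_mono) simp
    then show ?thesis by (simp add: Tr)
  next
    case (Sc t q kk)
    have q: "q < 2 ^ k" using assms Sc by auto
    have "pe 3 (pe (of_bool t) (pe q (tokc kk))) < 2 ^ (8 * k + 14)"
      by (rule pe_less'[OF c pe_less'[OF b pe_less'[OF q c[OF tk]]]]) auto
    then have "pe 3 (pe (of_bool t) (pe q (tokc kk))) < 2 ^ (256 * k + 510)" by (rule less_pow_mono) simp
    then show ?thesis by (simp add: Sc)
  qed simp
  moreover have "(2 :: nat) ^ (256 * k + 511) = 2 * 2 ^ (256 * k + 510)" by (subst power_Suc[symmetric]) simp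
  moreover have "1 \<le> (2 :: nat) ^ (256 * k + 510)" by simp
  ultimately show ?thesis by linarith
qed

lemma encw_less:
  assumes "szw N w" "N < 2 ^ k"
  shows "w < 2 ^ (8 * k + 14)"
proof -
  have m: "encm (decw w b) < 2 ^ (4 * k + 6)" for b
  proof -
    obtain x y z where d: "decw w b = (x, y, z)" using prod_cases3 by blast
    have "szm N (decw w b)" using assms(1) by (simp add: szw_def)
    then have "x < 2 ^ k" "y < 2 ^ k" "z < 2 ^ k" using assms(2) d by auto
    then have "pe x (pe y z) < 2 ^ (4 * k + 6)" by (intro pe_less'[OF _ pe_less']) auto
    then show ?thesis by (simp add: d)
  qed
  have "encw (decw w) < 2 ^ (8 * k + 14)" unfolding encw_def by (rule pe_less'[OF m m]) auto
  then show ?thesis by simp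
qed

context graph
begin

lemma card_E: "card E \<le> n * n"
proof -
  have "E \<subseteq> (\<lambda>(v, p). {v, port v p}) ` (SIGMA v:{..<n}. {..<deg v})" by (auto simp: edges_def)
  then have "card E \<le> card (SIGMA v:{..<n}. {..<deg v})" by (rule surj_card_le[rotated]) simp
  also have "\<dots> = (\<Sum>v<n. deg v)" by simp
  also have "\<dots> \<le> (\<Sum>v<n. n)" using deg_le by (intro sum_mono) auto
  finally show ?thesis by simp
qed

text \<open>All numbers grow linearly with time, and the time is quadratic in |E|, hence at most of
  order n^4; so logarithmically many bits suffice. The constant 100000 serves for time and memory
  alike.\<close>

theorem bhs_correct:
  assumes inj: "inj_on ids {..<6}" and s: "s < n" "s \<noteq> bh" and adv: "one_bhs_adversary n E M"
  shows "\<exists>T \<le> 100000 * card E ^ 2. solves_within bhs_alg n deg port bh s ids 6 M 100000 T"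
proof -
  let ?c = "exec bhs_alg deg port bh s ids 6 M" let ?m = "card E" let ?l = "floorlog 2 n"
  have n1: "1 < n" using s bhn by linarith
  obtain T where T: "T \<le> 2 * RB * RB + 2" "solved (?c T)" using solved_in_time[OF inj s adv] by blast
  have m1: "1 \<le> ?m" using n_le[OF n1] n1 by linarith
  \<comment> \<open>As there is an edge, the additive 40 is absorbed: 160 + 40 = 200.\<close>
  then have "RB \<le> 200 * ?m" by (simp add: RB_def)
  then have "RB * RB \<le> (200 * ?m) * (200 * ?m)" by (intro mult_mono) auto
  moreover have "1 \<le> ?m * ?m" using m1 by (metis mult_le_mono nat_mult_1)
  moreover have "T \<le> 2 * (RB * RB) + 2" using T(1) by (simp add: mult.assoc)
  moreover have "(200 * ?m) * (200 * ?m) = 40000 * (?m * ?m)" by simp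
  ultimately have T1: "T \<le> 80002 * (?m * ?m)" by linarith
  have nl: "n < 2 ^ ?l" using floorlog_bounds[of n 2] n1 by simp
  have "Suc 1 \<le> ?l" by (rule floorlog_ge_SucI) (use n1 in auto)
  then have l2: "2 \<le> ?l" by simp
  define N where "N = n + 2 + 6 * T"
  \<comment> \<open>\<open>N\<close> is at most 500000 times n^4, where 500000 is below
    \<open>2 ^ 20\<close> and \<open>n\<close> is below \<open>2 ^ ?l\<close>.\<close>
  define k where "k = 20 + 4 * ?l"
  have Nk: "N < 2 ^ k"
  proof -
    have "?m * ?m \<le> (n * n) * (n * n)" using card_E by (intro mult_mono) auto
    then have T2: "T \<le> 80002 * (n * n * (n * n))" using T1 by simp
    have "n * 1 \<le> n * (n * (n * n))" using n1 by (intro mult_le_mono2) simp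
    then have "n \<le> n * n * (n * n)" by (simp only: mult.assoc mult_1_right)
    then have "N \<le> 500000 * (n * n * (n * n))" using T2 n1 unfolding N_def by linarith
    also have "n * n * (n * n) \<le> (2 ^ ?l * 2 ^ ?l) * (2 ^ ?l * 2 ^ ?l)" using nl by (intro mult_mono) auto
    also have "500000 * ((2 ^ ?l * 2 ^ ?l) * (2 ^ ?l * 2 ^ ?l)) < 2 ^ 20 * ((2 ^ ?l * 2 ^ ?l) * (2 ^ ?l * 2 ^ ?l) :: nat)" by simp
    also have "\<dots> = 2 ^ k" by (simp only: k_def power_add[symmetric]) (simp add: algebra_simps)
    finally show ?thesis by simp
  qed
  have gbt: "gb (?c t) N" if "t \<le> T" for t
  proof -
    have "n + 2 + 6 * t \<le> N" using that by (simp add: N_def)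
    then show ?thesis using gb_exec[OF s(1), of ids M t] szs_mono szw_mono unfolding gb_def by (meson le_trans)
  qed
  have st: "floorlog 2 (ag_st (ags (?c t) i)) \<le> 100000 * ?l" if h: "t \<le> T" "i < 6" for t i
  proof -
    obtain x where x: "ag_st (ags (?c t) i) = enc x" "szl N x" using gbt[OF h(1)] h(2) by (auto simp: gb_def szs_def)
    have "enc x < 2 ^ (256 * k + 511)" by (rule enc_less[OF x(2) Nk]) (simp add: k_def)
    then have "floorlog 2 (enc x) \<le> 256 * k + 511" by (intro floorlog_leI) auto
    then show ?thesis using l2 by (simp add: x k_def)
  qed
  have wb: "floorlog 2 (wbs (?c t) v) \<le> 100000 * ?l" if "t \<le> T" for t v
  proof -
    have "wbs (?c t) v < 2 ^ (8 * k + 14)" by (rule encw_less[OF _ Nk]) (use gbt[OF that] in \<open>simp add: gb_def\<close>)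
    then have "floorlog 2 (wbs (?c t) v) \<le> 8 * k + 14" by (intro floorlog_leI) auto
    then show ?thesis using l2 by (simp add: k_def)
  qed
  have "solves_within bhs_alg n deg port bh s ids 6 M 100000 T"
    unfolding solves_within_def Let_def using T(2) st wb unfolding solved_def by blast
  moreover have "T \<le> 100000 * ?m ^ 2" using T1 by (simp add: power2_eq_square)
  ultimately show ?thesis by blast
qed

end

theorem theorem12:
  "\<exists>\<delta> :: alg. \<forall>c::real. c > 1 \<longrightarrow> (\<exists>K::nat.
     \<forall>n deg port bh s (ids :: nat \<Rightarrow> nat) M.
       port_graph n deg port \<and> bh < n \<and> s < n \<and> s \<noteq> bh \<and>
       inj_on ids {..<6} \<and> (\<forall>i<6. 1 \<le> ids i \<and> real (ids i) \<le> real n powr c) \<and>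
       one_bhs_adversary n (edges n deg port) M
       \<longrightarrow> (\<exists>T \<le> K * card (edges n deg port) ^ 2.
              solves_within \<delta> n deg port bh s ids 6 M K T))"
proof (intro exI[of _ bhs_alg] allI impI)
  fix c :: real
  have "\<exists>T \<le> 100000 * card (edges n deg port) ^ 2. solves_within bhs_alg n deg port bh s ids 6 M 100000 T"
    if a: "port_graph n deg port \<and> bh < n \<and> s < n \<and> s \<noteq> bh \<and>
       inj_on ids {..<6} \<and> (\<forall>i<6. 1 \<le> ids i \<and> real (ids i) \<le> real n powr c) \<and>
       one_bhs_adversary n (edges n deg port) M" for n deg port bh s M and ids :: "nat \<Rightarrow> nat"
  proof -
    interpret graph n deg port bh by unfold_locales (use a in auto)
    show ?thesis using bhs_correct[of ids s M] a by blast
  qed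
  then show "\<exists>K. \<forall>n deg port bh s (ids :: nat \<Rightarrow> nat) M.
       port_graph n deg port \<and> bh < n \<and> s < n \<and> s \<noteq> bh \<and>
       inj_on ids {..<6} \<and> (\<forall>i<6. 1 \<le> ids i \<and> real (ids i) \<le> real n powr c) \<and>
       one_bhs_adversary n (edges n deg port) M
       \<longrightarrow> (\<exists>T \<le> K * card (edges n deg port) ^ 2.
              solves_within bhs_alg n deg port bh s ids 6 M K T)"
    by blast
qed

end
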